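(* Let $\rho<\frac{1}{2(n-1)}$ and let $(M,g(t),\phi(t))$, $t\in[0,T)$, be a solution on the smooth closed oriented Riemannian manifold $(M^{n},g_{0},\phi_{0})$ of the system $$\frac{d}{dt}g(t)=-2Ric(g(t))+2\rho R(g(t))g(t),\quad g(0)=g_{0},\qquad \frac{\partial \phi}{\partial t}=\Delta\phi,\quad \phi(0)=\phi_{0},$$ where $\Delta$ is the Laplace operator of $g(t)$. Let $\lambda(t)$ denote the evolution of the first non-zero eigenvalue of the weighted $p$-Laplacian $\Delta_{p,\phi}$ corresponding to the eigenfunction $f(t)$ under this flow, and let $\lambda(t,f(t))$ be the associated smooth function described in the context. Then, with $Z=|\nabla f|^{p-2}$ and all integrals on the right-hand side evaluated at $t=t_{0}$, $$\frac{\partial}{\partial t}\lambda(t,f(t))\Big|_{t=t_{0}}=\lambda(t_{0})(1-n\rho)\int_{M}R|f|^{p}\,d\mu-(1+\rho p-\rho n)\int_{M}R|\nabla f|^{p}\,d\mu+p\int_{M}Z\,R^{ij}\nabla_{i}f\nabla_{j}f\,d\mu+\lambda(t_{0})\int_{M}(\Delta\phi)|f|^{p}\,d\mu-\int_{M}(\Delta\phi)|\nabla f|^{p}\,d\mu .$$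
   Context: $Ric$ (components $R_{ij}$) and $R$ are the Ricci tensor and scalar curvature of $g(t)$; indices are raised with $g(t)$. $d\nu$ is the Riemannian volume measure of $g(t)$ and $d\mu=e^{-\phi}d\nu$. $\rho$ is a real constant and $p\in[1,+\infty)$. The weighted $p$-Laplacian is $\Delta_{p,\phi}f=e^{\phi}\,\mathrm{div}(e^{-\phi}|\nabla f|^{p-2}\nabla f)$. A number $\Lambda$ is an eigenvalue of $\Delta_{p,\phi}$ (at time $t$) with eigenfunction $0\neq f\in W^{1,p}(M)$ if $-\Delta_{p,\phi}f=\Lambda|f|^{p-2}f$; $\lambda(t)$ denotes the first (smallest) non-zero eigenvalue at time $t$. Standing assumption: $\lambda(t)$ exists and is $C^{1}$ in $t\in[0,T)$. Definition of $\lambda(t,f(t))$: fix $t_{0}\in[0,T)$. Let $f(t)$ be a family of functions on $M$, depending smoothly on $t$, such that $\int_{M}|f(t)|^{p}\,d\mu=1$ for all $t$ and $f(t_{0})$ is an eigenfunction of $\Delta_{p,\phi}$ at time $t_{0}$ for $\lambda(t_{0})$ (for example $f(t)=h(t)/(\int_{M}|h(t)|^{p}d\mu)^{1/p}$ with $h(t)=f(t_{0})\left[\det(g_{ij}(t_{0}))/\det(g_{ij}(t))\right]^{\frac{1}{2(p-1)}}$). Set $\lambda(t,f(t))=-\int_{M}f\,\Delta_{p,\phi}f\,d\mu$, where $\Delta_{p,\phi}$ and $d\mu$ are taken at time $t$. Both $f(t)$ and $\lambda(t,f(t))$ are assumed smooth, and $\lambda(t_{0},f(t_{0}))=\lambda(t_{0})$.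 *)

theory Defs
  imports "HOL-Analysis.Analysis"
begin

text \<open>
  Conventions. The manifold is the whole type \<open>'m\<close>, with its topology and an oriented smooth atlas
  \<open>A\<close> of charts into \<open>real ^ 'n\<close>, so that the dimension is \<open>CARD('n)\<close>. Tensor fields are families of
  components, one for each chart \<open>c\<close> and each coordinate vector \<open>y\<close> in the image of \<open>c\<close>, subject to the
  usual transformation law. Values outside the image of a chart are irrelevant.
\<close>


section \<open>Smooth functions\<close>

text \<open>
  \<open>S\<close> is either open, or a product of an interval with nonempty interior (time) and an open set. In
  both cases the derivative within \<open>S\<close> is unique; it is one-sided at an endpoint of the interval.
\<close>

primrec Ck_on :: "nat \<Rightarrow> 'e::euclidean_space set \<Rightarrow> ('e \<Rightarrow> real) \<Rightarrow> bool" where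
  "Ck_on 0 S u \<longleftrightarrow> continuous_on S u"
| "Ck_on (Suc k) S u \<longleftrightarrow>
     u differentiable_on S \<and>
     (\<forall>b\<in>Basis. Ck_on k S (\<lambda>x. frechet_derivative u (at x within S) b))"

definition smooth_on :: "'e::euclidean_space set \<Rightarrow> ('e \<Rightarrow> real) \<Rightarrow> bool" where
  "smooth_on S u \<longleftrightarrow> (\<forall>k. Ck_on k S u)"

definition pd :: "'n \<Rightarrow> (real ^ 'n \<Rightarrow> real) \<Rightarrow> real ^ 'n \<Rightarrow> real" where
  "pd i u y = frechet_derivative u (at y) (axis i 1)"


section \<open>Closed oriented manifolds\<close>

type_synonym ('m, 'n) chart = "'m set \<times> ('m \<Rightarrow> real ^ 'n)"

definition cdom :: "('m, 'n) chart \<Rightarrow> 'm set" where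
  "cdom c = fst c"

definition cmap :: "('m, 'n) chart \<Rightarrow> 'm \<Rightarrow> real ^ 'n" where
  "cmap c = snd c"

definition cimg :: "('m, 'n) chart \<Rightarrow> (real ^ 'n) set" where
  "cimg c = cmap c ` cdom c"

definition cinv :: "('m, 'n) chart \<Rightarrow> real ^ 'n \<Rightarrow> 'm" where
  "cinv c = inv_into (cdom c) (cmap c)"

definition overlap :: "('m, 'n) chart \<Rightarrow> ('m, 'n) chart \<Rightarrow> (real ^ 'n) set" where
  "overlap c d = cmap c ` (cdom c \<inter> cdom d)"

definition transition :: "('m, 'n) chart \<Rightarrow> ('m, 'n) chart \<Rightarrow> real ^ 'n \<Rightarrow> real ^ 'n" where
  "transition c d = cmap d \<circ> cinv c"

definition jac :: "('m, 'n) chart \<Rightarrow> ('m, 'n) chart \<Rightarrow> real ^ 'n \<Rightarrow> real ^ 'n ^ 'n" where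
  "jac c d y = matrix (frechet_derivative (transition c d) (at y))"

definition closed_oriented_manifold :: "('m::t2_space, 'n::finite) chart set \<Rightarrow> bool" where
  "closed_oriented_manifold A \<longleftrightarrow>
     compact (UNIV :: 'm set) \<and>
     (\<Union>c\<in>A. cdom c) = UNIV \<and>
     (\<forall>c\<in>A. open (cdom c) \<and> open (cimg c) \<and>
        homeomorphism (cdom c) (cimg c) (cmap c) (cinv c)) \<and>
     (\<forall>c\<in>A. \<forall>d\<in>A.
        (\<forall>i. smooth_on (overlap c d) (\<lambda>y. transition c d y $ i)) \<and>
        (\<forall>y\<in>overlap c d. 0 < det (jac c d y)))"

definition smooth_function :: "('m, 'n::finite) chart set \<Rightarrow> ('m \<Rightarrow> real) \<Rightarrow> bool" where
  "smooth_function A u \<longleftrightarrow> (\<forall>c\<in>A. smooth_on (cimg c) (u \<circ> cinv c))"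

text \<open>
  The function on the manifold given by a coordinate expression \<open>F\<close>. It is applied only to
  expressions whose value does not depend on the chart.
\<close>

definition on_M :: "('m, 'n) chart set \<Rightarrow> (('m, 'n) chart \<Rightarrow> real ^ 'n \<Rightarrow> 'b) \<Rightarrow> 'm \<Rightarrow> 'b" where
  "on_M A F x = (let c = (SOME c. c \<in> A \<and> x \<in> cdom c) in F c (cmap c x))"


section \<open>Riemannian metrics\<close>

type_synonym ('m, 'n) tensor2 = "('m, 'n) chart \<Rightarrow> real ^ 'n \<Rightarrow> real ^ 'n ^ 'n"
type_synonym ('m, 'n) covector = "('m, 'n) chart \<Rightarrow> real ^ 'n \<Rightarrow> real ^ 'n"
type_synonym ('m, 'n) vector = "('m, 'n) chart \<Rightarrow> real ^ 'n \<Rightarrow> real ^ 'n"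

definition riemannian_metric :: "('m, 'n::finite) chart set \<Rightarrow> ('m, 'n) tensor2 \<Rightarrow> bool" where
  "riemannian_metric A g \<longleftrightarrow>
     (\<forall>c\<in>A. \<forall>i j. smooth_on (cimg c) (\<lambda>y. g c y $ i $ j)) \<and>
     (\<forall>c\<in>A. \<forall>y\<in>cimg c. transpose (g c y) = g c y \<and> (\<forall>v. v \<noteq> 0 \<longrightarrow> 0 < v \<bullet> (g c y *v v))) \<and>
     (\<forall>c\<in>A. \<forall>d\<in>A. \<forall>y\<in>overlap c d.
        g c y = transpose (jac c d y) ** g d (transition c d y) ** jac c d y)"

text \<open>Local formulas, for a matrix-valued function \<open>G\<close> giving the components \<open>g\<^sub>i\<^sub>j\<close> in one chart.\<close>

definition christoffel ::
  "(real ^ 'n \<Rightarrow> real ^ 'n ^ 'n) \<Rightarrow> 'n::finite \<Rightarrow> 'n \<Rightarrow> 'n \<Rightarrow> real ^ 'n \<Rightarrow> real" where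
  "christoffel G k i j y =
     (\<Sum>l\<in>UNIV. matrix_inv (G y) $ k $ l *
        (pd i (\<lambda>z. G z $ j $ l) y + pd j (\<lambda>z. G z $ i $ l) y - pd l (\<lambda>z. G z $ i $ j) y)) / 2"

definition ricci :: "(real ^ 'n \<Rightarrow> real ^ 'n ^ 'n) \<Rightarrow> real ^ 'n::finite \<Rightarrow> real ^ 'n ^ 'n" where
  "ricci G y = (\<chi> i j.
     (\<Sum>k\<in>UNIV. pd k (christoffel G k i j) y - pd j (christoffel G k i k) y) +
     (\<Sum>k\<in>UNIV. \<Sum>l\<in>UNIV. christoffel G k k l y * christoffel G l i j y
                        - christoffel G k j l y * christoffel G l i k y))"

definition scalar_curv :: "(real ^ 'n \<Rightarrow> real ^ 'n ^ 'n) \<Rightarrow> real ^ 'n::finite \<Rightarrow> real" where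
  "scalar_curv G y = (\<Sum>i\<in>UNIV. \<Sum>j\<in>UNIV. matrix_inv (G y) $ i $ j * ricci G y $ i $ j)"

text \<open>The components \<open>R\<^sup>i\<^sup>j\<close>, with both indices raised.\<close>

definition ricci_up :: "(real ^ 'n \<Rightarrow> real ^ 'n ^ 'n) \<Rightarrow> real ^ 'n::finite \<Rightarrow> real ^ 'n ^ 'n" where
  "ricci_up G y = matrix_inv (G y) ** ricci G y ** matrix_inv (G y)"

definition local_laplacian ::
  "(real ^ 'n \<Rightarrow> real ^ 'n ^ 'n) \<Rightarrow> (real ^ 'n \<Rightarrow> real) \<Rightarrow> real ^ 'n::finite \<Rightarrow> real" where
  "local_laplacian G u y =
     (\<Sum>i\<in>UNIV. \<Sum>j\<in>UNIV.
        pd i (\<lambda>z. sqrt (det (G z)) * matrix_inv (G z) $ i $ j * pd j u z) y) / sqrt (det (G y))"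

definition scal :: "('m, 'n::finite) chart set \<Rightarrow> ('m, 'n) tensor2 \<Rightarrow> 'm \<Rightarrow> real" where
  "scal A g = on_M A (\<lambda>c. scalar_curv (g c))"

definition laplacian ::
  "('m, 'n::finite) chart set \<Rightarrow> ('m, 'n) tensor2 \<Rightarrow> ('m \<Rightarrow> real) \<Rightarrow> 'm \<Rightarrow> real" where
  "laplacian A g u = on_M A (\<lambda>c. local_laplacian (g c) (u \<circ> cinv c))"

definition riemannian_volume ::
  "('m::topological_space, 'n::finite) chart set \<Rightarrow> ('m, 'n) tensor2 \<Rightarrow> 'm measure \<Rightarrow> bool" where
  "riemannian_volume A g \<nu> \<longleftrightarrow>
     sets \<nu> = sets borel \<and>
     (\<forall>c\<in>A. \<forall>B\<in>sets borel. B \<subseteq> cdom c \<longrightarrow>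
        emeasure \<nu> B = (\<integral>\<^sup>+ y\<in>cmap c ` B. ennreal (sqrt (det (g c y))) \<partial>lborel))"

text \<open>The measure \<open>d\<mu> = e\<^sup>-\<^sup>\<phi> d\<nu>\<close>.\<close>

definition weighted :: "'m measure \<Rightarrow> ('m \<Rightarrow> real) \<Rightarrow> 'm measure" where
  "weighted \<nu> \<phi> = density \<nu> (\<lambda>x. ennreal (exp (- \<phi> x)))"


section \<open>Sobolev functions\<close>

definition covector_field :: "('m, 'n::finite) chart set \<Rightarrow> ('m, 'n) covector \<Rightarrow> bool" where
  "covector_field A D \<longleftrightarrow>
     (\<forall>c\<in>A. \<forall>d\<in>A. \<forall>y\<in>overlap c d. D c y = transpose (jac c d y) *v D d (transition c d y))"

definition locally_integrable :: "(real ^ 'n) set \<Rightarrow> (real ^ 'n::finite \<Rightarrow> real) \<Rightarrow> bool" where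
  "locally_integrable S u \<longleftrightarrow> (\<forall>K. compact K \<and> K \<subseteq> S \<longrightarrow> set_integrable lborel K u)"

definition test_function :: "(real ^ 'n) set \<Rightarrow> (real ^ 'n::finite \<Rightarrow> real) \<Rightarrow> bool" where
  "test_function S \<eta> \<longleftrightarrow>
     smooth_on UNIV \<eta> \<and> compact (closure {y. \<eta> y \<noteq> 0}) \<and> closure {y. \<eta> y \<noteq> 0} \<subseteq> S"

definition weak_differential ::
  "('m, 'n::finite) chart set \<Rightarrow> ('m \<Rightarrow> real) \<Rightarrow> ('m, 'n) covector \<Rightarrow> bool" where
  "weak_differential A f D \<longleftrightarrow>
     covector_field A D \<and>
     (\<forall>c\<in>A. locally_integrable (cimg c) (f \<circ> cinv c) \<and>
        (\<forall>i. locally_integrable (cimg c) (\<lambda>y. D c y $ i)) \<and>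
        (\<forall>\<eta> i. test_function (cimg c) \<eta> \<longrightarrow>
           (LINT y:cimg c|lborel. f (cinv c y) * pd i \<eta> y)
           = - (LINT y:cimg c|lborel. D c y $ i * \<eta> y)))"

text \<open>The weak differential; it is unique up to null sets.\<close>

definition diff :: "('m, 'n::finite) chart set \<Rightarrow> ('m \<Rightarrow> real) \<Rightarrow> ('m, 'n) covector" where
  "diff A f = (SOME D. weak_differential A f D)"

definition grad ::
  "('m, 'n::finite) chart set \<Rightarrow> ('m, 'n) tensor2 \<Rightarrow> ('m \<Rightarrow> real) \<Rightarrow> ('m, 'n) vector" where
  "grad A g f c y = matrix_inv (g c y) *v diff A f c y"

text \<open>The length \<open>(g\<^sup>i\<^sup>j D\<^sub>i D\<^sub>j)\<^sup>1\<^sup>/\<^sup>2\<close> of a covector field.\<close>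

definition cnorm ::
  "('m, 'n::finite) tensor2 \<Rightarrow> ('m, 'n) covector \<Rightarrow> ('m, 'n) chart \<Rightarrow> real ^ 'n \<Rightarrow> real" where
  "cnorm g D c y = sqrt (D c y \<bullet> (matrix_inv (g c y) *v D c y))"

text \<open>\<open>|\<nabla>f|\<close> is the length of \<open>df\<close>, since raising the index is an isometry.\<close>

definition grad_norm ::
  "('m, 'n::finite) chart set \<Rightarrow> ('m, 'n) tensor2 \<Rightarrow> ('m \<Rightarrow> real) \<Rightarrow> 'm \<Rightarrow> real" where
  "grad_norm A g f = on_M A (cnorm g (diff A f))"

definition W1p ::
  "('m::topological_space, 'n::finite) chart set \<Rightarrow> ('m, 'n) tensor2 \<Rightarrow> 'm measure \<Rightarrow> real
   \<Rightarrow> ('m \<Rightarrow> real) set" where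
  "W1p A g \<nu> p = {f. f \<in> borel_measurable borel \<and> integrable \<nu> (\<lambda>x. \<bar>f x\<bar> powr p) \<and>
     (\<exists>D. weak_differential A f D) \<and> integrable \<nu> (\<lambda>x. grad_norm A g f x powr p)}"

text \<open>
  \<open>F'\<close> is the derivative of the curve \<open>F\<close> at the time \<open>t\<close> in the norm of \<open>W\<^sup>1\<^sup>,\<^sup>p\<close>: the first integral
  is the \<open>p\<close>-th power of the \<open>L\<^sup>p\<close> norm of the difference of the difference quotient and \<open>F' t\<close>, the
  second one that of its differential.
\<close>

definition W1p_derivative ::
  "('m, 'n::finite) chart set \<Rightarrow> ('m, 'n) tensor2 \<Rightarrow> 'm measure \<Rightarrow> real \<Rightarrow> real set
   \<Rightarrow> (real \<Rightarrow> 'm \<Rightarrow> real) \<Rightarrow> (real \<Rightarrow> 'm \<Rightarrow> real) \<Rightarrow> real \<Rightarrow> bool" where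
  "W1p_derivative A g \<nu> p I F F' t \<longleftrightarrow>
     ((\<lambda>s. (\<integral>x. \<bar>(F s x - F t x) / (s - t) - F' t x\<bar> powr p \<partial>\<nu>)
         + (\<integral>x. on_M A (cnorm g (\<lambda>c y. (diff A (F s) c y - diff A (F t) c y) /\<^sub>R (s - t)
                                        - diff A (F' t) c y)) x powr p \<partial>\<nu>))
      \<longlongrightarrow> 0) (at t within I)"

text \<open>
  Infinitely differentiable curves in \<open>W\<^sup>1\<^sup>,\<^sup>p\<close>. As the manifold is compact, the notion does not depend
  on the metric \<open>g\<close> that is used for the norm.
\<close>

definition smooth_W1p_curve ::
  "('m::topological_space, 'n::finite) chart set \<Rightarrow> ('m, 'n) tensor2 \<Rightarrow> 'm measure \<Rightarrow> real
   \<Rightarrow> real set \<Rightarrow> (real \<Rightarrow> 'm \<Rightarrow> real) \<Rightarrow> bool" where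
  "smooth_W1p_curve A g \<nu> p I F \<longleftrightarrow>
     (\<exists>H :: nat \<Rightarrow> real \<Rightarrow> 'm \<Rightarrow> real. H 0 = F \<and>
        (\<forall>k. \<forall>t\<in>I. H k t \<in> W1p A g \<nu> p \<and> W1p_derivative A g \<nu> p I (H k) (H (Suc k)) t))"


section \<open>The weighted \<open>p\<close>-Laplacian and its eigenvalues\<close>

text \<open>
  The divergence of a vector field \<open>X\<close>, in the weak sense, as a functional on Sobolev functions:
  \<open>\<integral> \<psi> div X d\<nu> = - \<integral> d\<psi>(X) d\<nu>\<close>.
\<close>

definition weak_div ::
  "('m, 'n::finite) chart set \<Rightarrow> 'm measure \<Rightarrow> ('m, 'n) vector \<Rightarrow> ('m \<Rightarrow> real) \<Rightarrow> real" where
  "weak_div A \<nu> X \<psi> = - (\<integral>x. on_M A (\<lambda>c y. diff A \<psi> c y \<bullet> X c y) x \<partial>\<nu>)"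

text \<open>
  The weighted \<open>p\<close>-Laplacian \<open>e\<^sup>\<phi> div (e\<^sup>-\<^sup>\<phi> |\<nabla>f|\<^sup>p\<^sup>-\<^sup>2 \<nabla>f)\<close> of a Sobolev function \<open>f\<close>, as the functional
  \<open>\<psi> \<mapsto> \<integral> \<psi> \<Delta>\<^sub>p\<^sub>,\<^sub>\<phi> f d\<mu>\<close>. The factor \<open>e\<^sup>\<phi>\<close> cancels against the density of \<open>\<mu>\<close>. Note that
  \<open>0 powr a = 0\<close> for every \<open>a\<close>, so that \<open>|\<nabla>f|\<^sup>p\<^sup>-\<^sup>2 \<nabla>f\<close> is \<open>0\<close> where \<open>\<nabla>f = 0\<close>, which for \<open>p > 1\<close> is its
  continuous extension.
\<close>

definition p_laplacian ::
  "('m, 'n::finite) chart set \<Rightarrow> ('m, 'n) tensor2 \<Rightarrow> 'm measure \<Rightarrow> ('m \<Rightarrow> real) \<Rightarrow> real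
   \<Rightarrow> ('m \<Rightarrow> real) \<Rightarrow> ('m \<Rightarrow> real) \<Rightarrow> real" where
  "p_laplacian A g \<nu> \<phi> p f \<psi> =
     weak_div A \<nu>
       (\<lambda>c y. (exp (- \<phi> (cinv c y)) * cnorm g (diff A f) c y powr (p - 2)) *\<^sub>R grad A g f c y) \<psi>"

text \<open>
  For \<open>p = 1\<close> the two sides of \<open>- \<Delta>\<^sub>p\<^sub>,\<^sub>\<phi> f = \<Lambda> |f|\<^sup>p\<^sup>-\<^sup>2 f\<close> involve \<open>\<nabla>f / |\<nabla>f|\<close> and \<open>f / |f|\<close>, which have no
  value (and no continuous extension) where the denominator vanishes. Both are required to be defined
  almost everywhere.
\<close>

definition eigenfunction ::
  "('m::topological_space, 'n::finite) chart set \<Rightarrow> ('m, 'n) tensor2 \<Rightarrow> 'm measure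
   \<Rightarrow> ('m \<Rightarrow> real) \<Rightarrow> real \<Rightarrow> real \<Rightarrow> ('m \<Rightarrow> real) \<Rightarrow> bool" where
  "eigenfunction A g \<nu> \<phi> p \<Lambda> f \<longleftrightarrow>
     f \<in> W1p A g \<nu> p \<and> \<not> (AE x in \<nu>. f x = 0) \<and>
     (p = 1 \<longrightarrow> (AE x in \<nu>. f x \<noteq> 0 \<and> grad_norm A g f x \<noteq> 0)) \<and>
     (\<forall>\<psi>\<in>W1p A g \<nu> p.
        - p_laplacian A g \<nu> \<phi> p f \<psi>
        = \<Lambda> * (\<integral>x. \<bar>f x\<bar> powr (p - 2) * f x * \<psi> x \<partial>weighted \<nu> \<phi>))"

definition eigenvalue ::
  "('m::topological_space, 'n::finite) chart set \<Rightarrow> ('m, 'n) tensor2 \<Rightarrow> 'm measure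
   \<Rightarrow> ('m \<Rightarrow> real) \<Rightarrow> real \<Rightarrow> real \<Rightarrow> bool" where
  "eigenvalue A g \<nu> \<phi> p \<Lambda> \<longleftrightarrow> (\<exists>f. eigenfunction A g \<nu> \<phi> p \<Lambda> f)"

definition first_eigenvalue ::
  "('m::topological_space, 'n::finite) chart set \<Rightarrow> ('m, 'n) tensor2 \<Rightarrow> 'm measure
   \<Rightarrow> ('m \<Rightarrow> real) \<Rightarrow> real \<Rightarrow> real \<Rightarrow> bool" where
  "first_eigenvalue A g \<nu> \<phi> p \<Lambda> \<longleftrightarrow>
     \<Lambda> \<noteq> 0 \<and> eigenvalue A g \<nu> \<phi> p \<Lambda> \<and>
     (\<forall>\<Lambda>'. \<Lambda>' \<noteq> 0 \<and> eigenvalue A g \<nu> \<phi> p \<Lambda>' \<longrightarrow> \<Lambda> \<le> \<Lambda>')"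

text \<open>The quantity \<open>- \<integral> f \<Delta>\<^sub>p\<^sub>,\<^sub>\<phi> f d\<mu>\<close>.\<close>

definition energy ::
  "('m, 'n::finite) chart set \<Rightarrow> ('m, 'n) tensor2 \<Rightarrow> 'm measure \<Rightarrow> ('m \<Rightarrow> real) \<Rightarrow> real
   \<Rightarrow> ('m \<Rightarrow> real) \<Rightarrow> real" where
  "energy A g \<nu> \<phi> p f = - p_laplacian A g \<nu> \<phi> p f f"


section \<open>The flow\<close>

text \<open>
  Solutions on \<open>[0, T)\<close> are smooth in space and time up to \<open>t = 0\<close>.
\<close>

definition flow_solution ::
  "('m, 'n::finite) chart set \<Rightarrow> real \<Rightarrow> real \<Rightarrow> ('m, 'n) tensor2 \<Rightarrow> ('m \<Rightarrow> real)
   \<Rightarrow> (real \<Rightarrow> ('m, 'n) tensor2) \<Rightarrow> (real \<Rightarrow> 'm \<Rightarrow> real) \<Rightarrow> bool" where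
  "flow_solution A \<rho> T g\<^sub>0 \<phi>\<^sub>0 g \<phi> \<longleftrightarrow>
     (\<forall>t\<in>{0..<T}. riemannian_metric A (g t)) \<and>
     (\<forall>c\<in>A. \<forall>i j. smooth_on ({0..<T} \<times> cimg c) (\<lambda>(t, y). g t c y $ i $ j)) \<and>
     (\<forall>c\<in>A. smooth_on ({0..<T} \<times> cimg c) (\<lambda>(t, y). \<phi> t (cinv c y))) \<and>
     (\<forall>t\<in>{0..<T}. \<forall>c\<in>A. \<forall>y\<in>cimg c.
        ((\<lambda>s. g s c y) has_vector_derivative
           (- 2) *\<^sub>R ricci (g t c) y + (2 * \<rho> * scalar_curv (g t c) y) *\<^sub>R g t c y)
        (at t within {0..<T})) \<and>
     (\<forall>t\<in>{0..<T}. \<forall>x.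
        ((\<lambda>s. \<phi> s x) has_real_derivative laplacian A (g t) (\<phi> t) x) (at t within {0..<T})) \<and>
     (\<forall>c\<in>A. \<forall>y\<in>cimg c. g 0 c y = g\<^sub>0 c y) \<and>
     \<phi> 0 = \<phi>\<^sub>0"

end

(*
  At the time t0 the curve f is differentiable in W^{1,p}, so there is a sequence of times t_k -> t0
  along which the difference quotients of f and df converge almost everywhere, with integrable
  p-th power majorants. Transport all integrals to the fixed measure d nu(t0). Along t_k one may then
  differentiate under the integral sign, by dominated convergence, both the normalization
  int |f|^p d mu = 1 and the energy int |df|^p d mu. As the energy is assumed to be smooth, its
  derivative is the limit along t_k. The two resulting identities contain
  int |f|^{p-2} f f' d mu and int |df|^{p-2} <df, df'> d mu, which the eigenvalue equation tested
  with f' relates; eliminating them gives the formula.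
*)
theory Submission
  imports Defs
begin

section \<open>Matrices and quadratic forms\<close>

text \<open>Convergence in W^{1,p} controls integrals only, and the full family of difference
  quotients comes with no common majorant. The times are therefore chosen so that the k-th error
  integral is below (1/2)^k: the sum of all errors is then an integrable majorant, and the errors
  tend to 0 almost everywhere. The obstacle is the zero set of df. The norm is not differentiable
  there, and |df|^{p-2} is unbounded nearby when p < 2. Where df = 0 at the base time, the squared
  norm at step tau is O(tau^2), so its p-th power is o(tau) if p > 1; for p = 1 the definition of
  \<open>eigenfunction\<close> makes such points a null set. The same applies to f. Domination rests
  on |x^p - y^p| <= p m^{p-1} |x - y| for x, y <= m, in which no negative power occurs. The metric
  and the density move too. For a fixed covector D, the product of density and |D|^p has a
  logarithmic derivative in time that is bounded uniformly in the point and in D. Its change between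
  t and s is thus at most C |s - t| times its value at t, which keeps all majorants in terms of the
  metric at the base time.\<close>

lemma matrix_inv_mult:
  fixes M :: "real ^ 'n ^ 'n"
  assumes "det M \<noteq> 0"
  shows "M ** matrix_inv M = mat 1" "matrix_inv M ** M = mat 1"
proof -
  have "\<exists>B. M ** B = mat 1 \<and> B ** M = mat 1"
    using assms by (simp add: invertible_det_nz[symmetric] invertible_def)
  from someI_ex[OF this] show "M ** matrix_inv M = mat 1" "matrix_inv M ** M = mat 1"
    by (simp_all add: matrix_inv_def)
qed

lemma matrix_inv_unique:
  fixes M :: "real ^ 'n ^ 'n"
  assumes "M ** B = mat 1"
  shows "matrix_inv M = B"
proof -
  have "det M * det B = 1" using assms by (metis det_I det_mul)
  hence "det M \<noteq> 0" by auto
  from matrix_inv_mult(2)[OF this] assms show ?thesis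
    by (metis matrix_mul_assoc matrix_mul_lid matrix_mul_rid)
qed

lemma transpose_matrix_inv:
  fixes M :: "real ^ 'n ^ 'n"
  assumes "det M \<noteq> 0"
  shows "transpose (matrix_inv M) = matrix_inv (transpose M)"
  by (metis assms matrix_inv_mult(2) matrix_inv_unique matrix_transpose_mul transpose_mat)

text \<open>The segment from the identity to \<open>M\<close> consists of matrices with positive
  quadratic form, hence of invertible ones; a continuous determinant without zeros keeps the sign
  that it has at the identity.\<close>

lemma det_positive_definite:
  fixes M :: "real ^ 'n ^ 'n"
  assumes "\<And>v. v \<noteq> 0 \<Longrightarrow> 0 < v \<bullet> (M *v v)"
  shows "0 < det M"
proof -
  define P where "P t = (1 - t) *\<^sub>R mat 1 + t *\<^sub>R M" for t :: real
  have nz: "det (P t) \<noteq> 0" if "t \<in> {0..1}" for t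
  proof
    assume "det (P t) = 0"
    hence "\<not> invertible (P t)" by (simp add: invertible_det_nz)
    then obtain v where v: "v \<noteq> 0" "P t *v v = 0"
      by (metis invertible_left_inverse matrix_left_invertible_ker)
    have "v \<bullet> (P t *v v) = (1 - t) * (v \<bullet> v) + t * (v \<bullet> (M *v v))"
      by (simp add: P_def matrix_vector_mult_add_rdistrib scaleR_matrix_vector_assoc[symmetric]
          inner_add_right)
    moreover have "0 < v \<bullet> v" "0 < v \<bullet> (M *v v)" using v assms by auto
    moreover have "0 < (1 - t) * (v \<bullet> v) + t * (v \<bullet> (M *v v))"
    proof (cases "t = 1")
      case False
      then show ?thesis using that calculation
        by (intro add_pos_nonneg mult_pos_pos mult_nonneg_nonneg) auto
    qed (use calculation in auto)
    ultimately show False using v(2) by simp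
  qed
  have cont: "continuous_on {0..1} (\<lambda>t. det (P t))"
    unfolding det_def P_def by (intro continuous_intros) 
  show ?thesis
  proof (rule ccontr)
    assume "\<not> 0 < det M"
    hence "det (P 1) \<le> 0" "0 \<le> det (P 0)" by (simp_all add: P_def)
    from IVT2'[OF this _ cont] obtain t where "t \<in> {0..1}" "det (P t) = 0" by auto
    with nz show False by blast
  qed
qed

text \<open>Cramer's rule for the columns of the inverse. It reduces limits and continuity of the
  inverse to those of determinants, which are polynomials in the entries.\<close>

lemma matrix_inv_component:
  fixes M :: "real ^ 'n ^ 'n"
  assumes "det M \<noteq> 0"
  shows "matrix_inv M $ k $ j = det (\<chi> i l. if l = k then axis j 1 $ i else M $ i $ l) / det M"
proof -
  have "M *v (matrix_inv M *v axis j 1) = axis j 1"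
    by (simp add: matrix_vector_mul_assoc matrix_inv_mult assms)
  with cramer[OF assms] have "matrix_inv M *v axis j 1
      = (\<chi> k. det (\<chi> i l. if l = k then axis j 1 $ i else M $ i $ l) / det M)"
    by blast
  then have "(matrix_inv M *v axis j 1) $ k = det (\<chi> i l. if l = k then axis j 1 $ i else M $ i $ l) / det M"
    by simp
  then show ?thesis
    by (simp add: matrix_vector_mult_def axis_def if_distrib cong: if_cong)
qed

lemma tendsto_det:
  fixes M :: "'a \<Rightarrow> real ^ 'n ^ 'n"
  assumes "\<And>i j. ((\<lambda>x. M x $ i $ j) \<longlongrightarrow> L $ i $ j) F"
  shows "((\<lambda>x. det (M x)) \<longlongrightarrow> det L) F"
  unfolding det_def by (intro tendsto_intros assms)

lemma tendsto_matrix_inv: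
  fixes M :: "'a \<Rightarrow> real ^ 'n ^ 'n"
  assumes M: "\<And>i j. ((\<lambda>x. M x $ i $ j) \<longlongrightarrow> L $ i $ j) F"
    and nz: "\<And>x. det (M x) \<noteq> 0" "det L \<noteq> 0"
  shows "((\<lambda>x. matrix_inv (M x) $ i $ j) \<longlongrightarrow> matrix_inv L $ i $ j) F"
  unfolding matrix_inv_component[OF nz(1)] matrix_inv_component[OF nz(2)]
  by (intro tendsto_divide tendsto_det M nz) (auto intro: M)

lemma continuous_on_det:
  fixes M :: "'a::topological_space \<Rightarrow> real ^ 'n ^ 'n"
  assumes "\<And>i j. continuous_on S (\<lambda>x. M x $ i $ j)"
  shows "continuous_on S (\<lambda>x. det (M x))"
  unfolding det_def by (intro continuous_intros assms)

lemma continuous_on_matrix_inv: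
  fixes M :: "'a::topological_space \<Rightarrow> real ^ 'n ^ 'n"
  assumes M: "\<And>i j. continuous_on S (\<lambda>x. M x $ i $ j)"
    and nz: "\<And>x. x \<in> S \<Longrightarrow> det (M x) \<noteq> 0"
  shows "continuous_on S (\<lambda>x. matrix_inv (M x) $ i $ j)"
proof -
  have "continuous_on S (\<lambda>x. det (\<chi> a l. if l = i then axis j 1 $ a else M x $ a $ l) / det (M x))"
  proof (intro continuous_on_divide continuous_on_det M)
    show "continuous_on S (\<lambda>x. (\<chi> a l. if l = i then axis j 1 $ a else M x $ a $ l) $ a $ b)" for a b
      by (cases "b = i") (simp_all add: M)
  qed (use nz in auto)
  then show ?thesis
    by (rule continuous_on_eq) (simp add: matrix_inv_component nz)
qed

lemma matrix_mult_diff_left: "(M - N) ** B = M ** B - N ** B" for M N :: "real ^ 'n ^ 'm"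
  by (simp add: matrix_matrix_mult_def vec_eq_iff sum_subtractf left_diff_distrib)

lemma matrix_mult_diff_right: "B ** (M - N) = B ** M - B ** N" for M N :: "real ^ 'n ^ 'm"
  by (simp add: matrix_matrix_mult_def vec_eq_iff sum_subtractf right_diff_distrib)

lemma inner_matrix_vector_sum:
  "v \<bullet> (M *v w) = (\<Sum>i\<in>UNIV. \<Sum>j\<in>UNIV. M $ i $ j * (v $ i * w $ j))" for M :: "real ^ 'n ^ 'm"
  by (simp add: inner_vec_def matrix_vector_mult_def sum_distrib_left mult_ac)

lemma has_vector_derivative_entry:
  fixes M :: "real \<Rightarrow> real ^ 'n ^ 'm"
  assumes "(M has_vector_derivative M') F"
  shows "((\<lambda>s. M s $ i $ j) has_real_derivative M' $ i $ j) F"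
proof -
  have "bounded_linear (\<lambda>A :: real ^ 'n ^ 'm. A $ i $ j)"
    by (rule bounded_linear_compose[OF bounded_linear_vec_nth bounded_linear_vec_nth])
  from bounded_linear.has_vector_derivative[OF this assms] show ?thesis
    by (simp add: has_real_derivative_iff_has_vector_derivative)
qed

section \<open>Jacobi's formula and the derivative of the inverse matrix\<close>

lemma det_has_derivative_id:
  fixes M :: "real \<Rightarrow> real ^ 'n ^ 'n"
  assumes d: "\<And>i j. ((\<lambda>s. M s $ i $ j) has_real_derivative M' $ i $ j) (at t within S)"
    and M: "M t = mat 1"
  shows "((\<lambda>s. det (M s)) has_real_derivative trace M') (at t within S)"
proof -
  let ?P = "{\<sigma>. \<sigma> permutes (UNIV :: 'n set)}"
  have prod: "((\<lambda>s. \<Prod>i\<in>UNIV. M s $ i $ \<sigma> i) has_real_derivative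
      (\<Sum>i\<in>UNIV. M' $ i $ \<sigma> i * (\<Prod>j\<in>UNIV - {i}. M t $ j $ \<sigma> j))) (at t within S)" for \<sigma>
  proof -
    have "((\<lambda>s. \<Prod>i\<in>UNIV. M s $ i $ \<sigma> i) has_derivative
        (\<lambda>y. \<Sum>i\<in>UNIV. M' $ i $ \<sigma> i * y * (\<Prod>j\<in>UNIV - {i}. M t $ j $ \<sigma> j))) (at t within S)"
      using d by (intro has_derivative_prod) (simp add: has_field_derivative_def)
    moreover have "(\<lambda>y. \<Sum>i\<in>UNIV. M' $ i $ \<sigma> i * y * (\<Prod>j\<in>UNIV - {i}. M t $ j $ \<sigma> j))
        = (*) (\<Sum>i\<in>UNIV. M' $ i $ \<sigma> i * (\<Prod>j\<in>UNIV - {i}. M t $ j $ \<sigma> j))"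
      by (simp add: fun_eq_iff sum_distrib_left mult_ac)
    ultimately show ?thesis by (simp add: has_field_derivative_def)
  qed
  \<comment> \<open>A permutation other than the identity moves two points, so each term keeps an off-diagonal entry of \<open>M t\<close>.\<close>
  have zero: "(\<Sum>i\<in>UNIV. M' $ i $ \<sigma> i * (\<Prod>j\<in>UNIV - {i}. M t $ j $ \<sigma> j)) = 0"
    if "\<sigma> permutes UNIV" "\<sigma> \<noteq> id" for \<sigma> :: "'n \<Rightarrow> 'n"
  proof (rule sum.neutral, rule ballI)
    fix i
    have "\<exists>j. j \<noteq> i \<and> \<sigma> j \<noteq> j"
    proof (rule ccontr)
      assume "\<not> ?thesis"
      hence fix': "\<sigma> j = j" if "j \<noteq> i" for j using that by blast
      have "\<sigma> i = i"
      proof (rule ccontr)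
        assume "\<sigma> i \<noteq> i"
        hence "\<sigma> (\<sigma> i) = \<sigma> i" by (rule fix')
        with permutes_inj[OF that(1)] \<open>\<sigma> i \<noteq> i\<close> show False by (auto dest: injD)
      qed
      with fix' have "\<sigma> = id" by (metis eq_id_iff)
      with that show False by simp
    qed
    then obtain j where "j \<noteq> i" "\<sigma> j \<noteq> j" by blast
    hence "(\<Prod>j\<in>UNIV - {i}. M t $ j $ \<sigma> j) = 0"
      by (intro prod_zero) (auto simp: M mat_def intro!: bexI[of _ j])
    thus "M' $ i $ \<sigma> i * (\<Prod>j\<in>UNIV - {i}. M t $ j $ \<sigma> j) = 0" by simp
  qed
  have "((\<lambda>s. \<Sum>\<sigma>\<in>?P. of_int (sign \<sigma>) * (\<Prod>i\<in>UNIV. M s $ i $ \<sigma> i)) has_real_derivative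
      (\<Sum>\<sigma>\<in>?P. of_int (sign \<sigma>) * (\<Sum>i\<in>UNIV. M' $ i $ \<sigma> i * (\<Prod>j\<in>UNIV - {i}. M t $ j $ \<sigma> j))))
      (at t within S)"
    by (intro DERIV_sum DERIV_cmult prod)
  also have "(\<Sum>\<sigma>\<in>?P. of_int (sign \<sigma>) * (\<Sum>i\<in>UNIV. M' $ i $ \<sigma> i * (\<Prod>j\<in>UNIV - {i}. M t $ j $ \<sigma> j)))
      = (\<Sum>\<sigma>\<in>{id}. of_int (sign \<sigma>) * (\<Sum>i\<in>UNIV. M' $ i $ \<sigma> i * (\<Prod>j\<in>UNIV - {i}. M t $ j $ \<sigma> j)))"
    using zero by (intro sum.mono_neutral_right) (auto simp: finite_permutations permutes_id)
  also have "\<dots> = trace M'"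
    by (simp add: trace_def M mat_def sign_id)
  finally show ?thesis by (simp add: det_def)
qed

text \<open>Multiplication by the constant matrix \<open>matrix_inv (M t)\<close> moves the base
  point to the identity, where the derivative of the determinant is the trace.\<close>

lemma det_has_derivative:
  fixes M :: "real \<Rightarrow> real ^ 'n ^ 'n"
  assumes d: "\<And>i j. ((\<lambda>s. M s $ i $ j) has_real_derivative M' $ i $ j) (at t within S)"
    and nz: "det (M t) \<noteq> 0"
  shows "((\<lambda>s. det (M s)) has_real_derivative det (M t) * trace (matrix_inv (M t) ** M')) (at t within S)"
proof -
  have "((\<lambda>s. (matrix_inv (M t) ** M s) $ i $ j) has_real_derivative (matrix_inv (M t) ** M') $ i $ j)
      (at t within S)" for i j
    unfolding matrix_matrix_mult_def by (simp, intro DERIV_sum DERIV_cmult d)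
  from det_has_derivative_id[OF this] 
  have "((\<lambda>s. det (matrix_inv (M t) ** M s)) has_real_derivative trace (matrix_inv (M t) ** M')) (at t within S)"
    using matrix_inv_mult[OF nz] by simp
  from DERIV_cmult[OF this, of "det (M t)"]
  show ?thesis using nz
    by (simp add: det_mul[symmetric] matrix_mul_assoc matrix_inv_mult)
qed

text \<open>By the resolvent identity M(s)^-1 (M(s) - M(t)) M(t)^-1 = M(t)^-1 - M(s)^-1, the
  difference quotient is exactly a product of three factors with known limits.\<close>

lemma matrix_inv_form_has_derivative:
  fixes M :: "real \<Rightarrow> real ^ 'n ^ 'n"
  assumes d: "\<And>i j. ((\<lambda>s. M s $ i $ j) has_real_derivative M' $ i $ j) (at t within S)"
    and nz: "\<And>s. s \<in> S \<Longrightarrow> det (M s) \<noteq> 0" and t: "t \<in> S"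
  shows "((\<lambda>s. v \<bullet> (matrix_inv (M s) *v w)) has_real_derivative
      - (v \<bullet> ((matrix_inv (M t) ** M' ** matrix_inv (M t)) *v w))) (at t within S)"
proof -
  \<comment> \<open>\<open>tendsto_matrix_inv\<close> wants invertibility at every argument, which
    is known only on \<open>S\<close>; outside, \<open>M s\<close> is replaced by the invertible
    \<open>M t\<close>. The limit within \<open>S\<close> does not see the change.\<close>
  define N where "N s = (if s \<in> S then M s else M t)" for s
  have nzN: "det (N s) \<noteq> 0" for s using nz t by (simp add: N_def)
  have lim: "((\<lambda>s. N s $ i $ j) \<longlongrightarrow> N t $ i $ j) (at t within S)" for i j
  proof -
    have "((\<lambda>s. M s $ i $ j) \<longlongrightarrow> M t $ i $ j) (at t within S)"
      using DERIV_continuous[OF d[of i j]] by (simp add: continuous_within)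
    thus ?thesis using t
      by (rule_tac Lim_transform_within[of _ _ _ _ 1]) (auto simp: N_def)
  qed
  have inv_lim: "((\<lambda>s. matrix_inv (N s) $ i $ j) \<longlongrightarrow> matrix_inv (M t) $ i $ j) (at t within S)" for i j
    using tendsto_matrix_inv[OF lim nzN nzN] t by (simp add: N_def)
  define Q where "Q s = (\<chi> i j. (M s $ i $ j - M t $ i $ j) / (s - t))" for s
  have Q: "((\<lambda>s. Q s $ i $ j) \<longlongrightarrow> M' $ i $ j) (at t within S)" for i j
    using d[of i j] by (simp add: Q_def has_field_derivative_iff)
  have "((\<lambda>s. - (v \<bullet> ((matrix_inv (N s) ** Q s ** matrix_inv (M t)) *v w))) \<longlongrightarrow>
      - (v \<bullet> ((matrix_inv (M t) ** M' ** matrix_inv (M t)) *v w))) (at t within S)"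
    unfolding inner_matrix_vector_sum matrix_matrix_mult_def
    by (simp, intro tendsto_intros inv_lim Q)
  moreover have "- (v \<bullet> ((matrix_inv (N s) ** Q s ** matrix_inv (M t)) *v w))
     = (v \<bullet> (matrix_inv (M s) *v w) - v \<bullet> (matrix_inv (M t) *v w)) / (s - t)"
    if "s \<in> S" "s \<noteq> t" for s
  proof -
    have Q_eq: "Q s = (1 / (s - t)) *\<^sub>R (M s - M t)"
      by (simp add: Q_def vec_eq_iff)
    have "matrix_inv (M s) ** (M s - M t) ** matrix_inv (M t)
        = matrix_inv (M s) ** M s ** matrix_inv (M t) - matrix_inv (M s) ** (M t ** matrix_inv (M t))"
      by (simp add: matrix_mult_diff_left matrix_mult_diff_right matrix_mul_assoc)
    also have "\<dots> = matrix_inv (M t) - matrix_inv (M s)"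
      using nz t that by (simp add: matrix_inv_mult)
    finally have "matrix_inv (M s) ** Q s ** matrix_inv (M t)
        = (1 / (s - t)) *\<^sub>R (matrix_inv (M t) - matrix_inv (M s))"
      by (simp add: Q_eq matrix_scalar_ac scalar_matrix_assoc[symmetric])
    then have "v \<bullet> ((matrix_inv (N s) ** Q s ** matrix_inv (M t)) *v w)
        = (v \<bullet> (matrix_inv (M t) *v w) - v \<bullet> (matrix_inv (M s) *v w)) / (s - t)"
      using that by (simp add: N_def scaleR_matrix_vector_assoc[symmetric]
          matrix_vector_mult_diff_rdistrib inner_diff_right divide_simps)
    then show ?thesis using that by (simp add: field_simps)
  qed
  ultimately have "((\<lambda>s. (v \<bullet> (matrix_inv (M s) *v w) - v \<bullet> (matrix_inv (M t) *v w)) / (s - t)) \<longlongrightarrow>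
      - (v \<bullet> ((matrix_inv (M t) ** M' ** matrix_inv (M t)) *v w))) (at t within S)"
    by (rule Lim_transform_within[OF _ zero_less_one]) simp_all
  then show ?thesis by (simp only: has_field_derivative_iff)
qed

section \<open>Change of chart: \<open>J\<close> is the Jacobian, \<open>M\<close> the metric,
  \<open>B\<close> a covariant 2-tensor\<close>

lemma matrix_inv_congruence:
  fixes J M :: "real ^ 'n ^ 'n"
  assumes J: "det J \<noteq> 0" and M: "det M \<noteq> 0"
  shows "matrix_inv (transpose J ** M ** J) = matrix_inv J ** matrix_inv M ** transpose (matrix_inv J)"
proof (rule matrix_inv_unique)
  have Jt: "transpose J ** transpose (matrix_inv J) = mat 1"
    by (metis J matrix_inv_mult(2) matrix_transpose_mul transpose_mat)
  have "transpose J ** M ** J ** (matrix_inv J ** matrix_inv M ** transpose (matrix_inv J))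
      = transpose J ** (M ** (J ** matrix_inv J) ** matrix_inv M) ** transpose (matrix_inv J)"
    by (simp only: matrix_mul_assoc)
  also have "\<dots> = mat 1" using J M by (simp add: matrix_inv_mult Jt)
  finally show "transpose J ** M ** J ** (matrix_inv J ** matrix_inv M ** transpose (matrix_inv J)) = mat 1" .
qed

lemma raised_congruence:
  fixes J M B :: "real ^ 'n ^ 'n"
  assumes J: "det J \<noteq> 0" and M: "det M \<noteq> 0"
  defines "N \<equiv> matrix_inv (transpose J ** M ** J)"
  shows "J ** N ** (transpose J ** B ** J) ** N ** transpose J = matrix_inv M ** B ** matrix_inv M"
proof -
  have Jt: "transpose (matrix_inv J) ** transpose J = mat 1"
    by (metis J matrix_inv_mult(1) matrix_transpose_mul transpose_mat)
  have "J ** N ** (transpose J ** B ** J) ** N ** transpose J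
      = (J ** matrix_inv J) ** matrix_inv M ** (transpose (matrix_inv J) ** transpose J) ** B
        ** (J ** matrix_inv J) ** matrix_inv M ** (transpose (matrix_inv J) ** transpose J)"
    by (simp only: N_def matrix_inv_congruence[OF J M] matrix_mul_assoc)
  then show ?thesis by (simp add: matrix_inv_mult J Jt)
qed

lemma inner_transpose_mult: "(transpose J *v x) \<bullet> y = x \<bullet> (J *v y)"
  for J :: "real ^ 'n ^ 'm"
  by (simp add: dot_lmul_matrix)

text \<open>The scalar B^{ij} D_i E_j: each Jacobian coming from a lowered index meets an inverse
  Jacobian from the raised metric.\<close>

lemma raised_form_congruence:
  fixes J M B :: "real ^ 'n ^ 'n"
  assumes J: "det J \<noteq> 0" and M: "det M \<noteq> 0"
  defines "N \<equiv> matrix_inv (transpose J ** M ** J)"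
  shows "(transpose J *v D) \<bullet> ((N ** (transpose J ** B ** J) ** N) *v (transpose J *v E))
      = D \<bullet> ((matrix_inv M ** B ** matrix_inv M) *v E)"
  unfolding N_def inner_transpose_mult matrix_vector_mul_assoc matrix_mul_assoc
  using raised_congruence[OF J M, of B] by (simp only: matrix_mul_assoc)

text \<open>The metric trace of \<open>B\<close>: congruence turns the mixed tensor into a conjugate
  one, and the trace is cyclic.\<close>

lemma trace_congruence:
  fixes J M B :: "real ^ 'n ^ 'n"
  assumes J: "det J \<noteq> 0" and M: "det M \<noteq> 0"
  shows "trace (matrix_inv (transpose J ** M ** J) ** (transpose J ** B ** J)) = trace (matrix_inv M ** B)"
proof -
  have Jt: "transpose (matrix_inv J) ** transpose J = mat 1"
    by (metis J matrix_inv_mult(1) matrix_transpose_mul transpose_mat)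
  have "matrix_inv (transpose J ** M ** J) ** (transpose J ** B ** J)
      = matrix_inv J ** (matrix_inv M ** (transpose (matrix_inv J) ** transpose J) ** B ** J)"
    by (simp only: matrix_inv_congruence[OF J M] matrix_mul_assoc)
  also have "trace \<dots> = trace (matrix_inv M ** B ** J ** matrix_inv J)"
    by (subst trace_mul_sym) (simp add: Jt)
  also have "\<dots> = trace (matrix_inv M ** B ** (J ** matrix_inv J))"
    by (simp only: matrix_mul_assoc)
  finally show ?thesis by (simp add: matrix_inv_mult J)
qed

section \<open>Positive definite forms and their norms\<close>

lemma positive_form_Cauchy_Schwarz:
  fixes P :: "real ^ 'n ^ 'n"
  assumes sym: "transpose P = P" and pos: "\<And>v. v \<noteq> 0 \<Longrightarrow> 0 < v \<bullet> (P *v v)"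
  shows "\<bar>v \<bullet> (P *v w)\<bar> \<le> sqrt (v \<bullet> (P *v v)) * sqrt (w \<bullet> (P *v w))"
proof (cases "w = 0")
  case True
  then show ?thesis by simp
next
  case False
  define a b c where "a = w \<bullet> (P *v w)" and "b = v \<bullet> (P *v w)" and "c = v \<bullet> (P *v v)"
  have a: "0 < a" using pos[OF False] by (simp add: a_def)
  have nonneg: "0 \<le> u \<bullet> (P *v u)" for u using pos[of u] by (cases "u = 0") auto
  have swap: "w \<bullet> (P *v v) = b"
    by (metis b_def dot_lmul_matrix inner_commute sym transpose_matrix_vector)
  \<comment> \<open>The multiple b/a of \<open>w\<close> is the orthogonal projection of
    \<open>v\<close>, so it minimizes the form on the line v + R w.\<close>
  have "0 \<le> (v - (b / a) *\<^sub>R w) \<bullet> (P *v (v - (b / a) *\<^sub>R w))" by (rule nonneg)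
  also have "\<dots> = c - (b / a) * b - (b / a) * b + (b / a) * (b / a) * a"
    by (simp add: matrix_vector_mult_diff_distrib matrix_vector_mult_scaleR inner_diff_left inner_diff_right
        swap a_def[symmetric] b_def[symmetric] c_def[symmetric] algebra_simps)
  also have "\<dots> = c - b\<^sup>2 / a" using a by (simp add: field_simps power2_eq_square)
  finally have "b\<^sup>2 \<le> c * a" using a by (simp add: field_simps)
  then have "sqrt (b\<^sup>2) \<le> sqrt (c * a)" by (rule real_sqrt_le_mono)
  then show ?thesis by (simp add: real_sqrt_mult a_def b_def c_def)
qed

lemma positive_form_triangle:
  fixes P :: "real ^ 'n ^ 'n"
  assumes sym: "transpose P = P" and pos: "\<And>v. v \<noteq> 0 \<Longrightarrow> 0 < v \<bullet> (P *v v)"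
  shows "sqrt ((v + w) \<bullet> (P *v (v + w))) \<le> sqrt (v \<bullet> (P *v v)) + sqrt (w \<bullet> (P *v w))"
proof -
  have nonneg: "0 \<le> u \<bullet> (P *v u)" for u using pos[of u] by (cases "u = 0") auto
  have swap: "w \<bullet> (P *v v) = v \<bullet> (P *v w)"
    by (metis dot_lmul_matrix inner_commute sym transpose_matrix_vector)
  have "(v + w) \<bullet> (P *v (v + w)) = v \<bullet> (P *v v) + 2 * (v \<bullet> (P *v w)) + w \<bullet> (P *v w)"
    by (simp add: matrix_vector_right_distrib inner_add_left inner_add_right swap)
  also have "\<dots> \<le> v \<bullet> (P *v v) + 2 * (sqrt (v \<bullet> (P *v v)) * sqrt (w \<bullet> (P *v w))) + w \<bullet> (P *v w)"
    using positive_form_Cauchy_Schwarz[OF sym pos, of v w] by simp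
  also have "\<dots> = (sqrt (v \<bullet> (P *v v)) + sqrt (w \<bullet> (P *v w)))\<^sup>2"
    using nonneg[of v] nonneg[of w] by (simp add: power2_sum)
  finally show ?thesis by (intro real_le_lsqrt) (use nonneg in auto)
qed

lemma matrix_mult_linear:
  fixes M N :: "real ^ 'n ^ 'm"
  shows "P ** (a *\<^sub>R M + b *\<^sub>R N) = a *\<^sub>R (P ** M) + b *\<^sub>R (P ** N)"
    and "(a *\<^sub>R M + b *\<^sub>R N) ** Q = a *\<^sub>R (M ** Q) + b *\<^sub>R (N ** Q)"
  by (simp_all add: matrix_matrix_mult_def vec_eq_iff sum.distrib distrib_left distrib_right sum_distrib_left
      mult_ac)

lemma trace_linear: "trace (a *\<^sub>R M + b *\<^sub>R N) = a * trace M + b * trace N"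
  for M N :: "real ^ 'n ^ 'n"
  by (simp add: trace_def sum.distrib sum_distrib_left)

lemma form_linear: "v \<bullet> ((a *\<^sub>R M + b *\<^sub>R N) *v w) = a * (v \<bullet> (M *v w)) + b * (v \<bullet> (N *v w))"
  for M N :: "real ^ 'n ^ 'm"
  by (simp add: matrix_vector_mult_add_rdistrib scaleR_matrix_vector_assoc[symmetric] inner_add_right)

text \<open>The value of \<open>cnorm\<close> at one point of one chart, detached from charts; there
  \<open>P\<close> is the inverse metric.\<close>

definition form_norm :: "real ^ 'n ^ 'n \<Rightarrow> real ^ 'n \<Rightarrow> real" where
  "form_norm P v = sqrt (v \<bullet> (P *v v))"

lemma cnorm_eq_form_norm: "cnorm g D c y = form_norm (matrix_inv (g c y)) (D c y)"
  by (simp add: cnorm_def form_norm_def)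

lemma form_norm_scaleR: "form_norm P (a *\<^sub>R v) = \<bar>a\<bar> * form_norm P v"
proof -
  have "(a *\<^sub>R v) \<bullet> (P *v (a *\<^sub>R v)) = a\<^sup>2 * (v \<bullet> (P *v v))"
    by (simp add: matrix_vector_mult_scaleR power2_eq_square)
  then show ?thesis by (simp add: form_norm_def real_sqrt_mult)
qed

text \<open>Interpreted both for the metric in a chart and for its inverse.\<close>

locale positive_form =
  fixes P :: "real ^ 'n ^ 'n"
  assumes sym: "transpose P = P" and pos: "\<And>v. v \<noteq> 0 \<Longrightarrow> 0 < v \<bullet> (P *v v)"
begin

lemma form_nonneg: "0 \<le> v \<bullet> (P *v v)"
  using pos[of v] by (cases "v = 0") auto

lemma form_norm_nonneg: "0 \<le> form_norm P v"
  by (simp add: form_norm_def form_nonneg)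

lemma form_norm_power2: "(form_norm P v)\<^sup>2 = v \<bullet> (P *v v)"
  by (simp add: form_norm_def form_nonneg)

lemma form_norm_eq_0_iff: "form_norm P v = 0 \<longleftrightarrow> v = 0"
  using pos[of v] by (cases "v = 0") (auto simp: form_norm_def)

lemma form_commute: "w \<bullet> (P *v v) = v \<bullet> (P *v w)"
  by (metis dot_lmul_matrix inner_commute sym transpose_matrix_vector)

lemma form_norm_Cauchy_Schwarz: "\<bar>v \<bullet> (P *v w)\<bar> \<le> form_norm P v * form_norm P w"
  using positive_form_Cauchy_Schwarz[OF sym pos] by (simp add: form_norm_def)

lemma form_norm_triangle: "form_norm P (v + w) \<le> form_norm P v + form_norm P w"
  using positive_form_triangle[OF sym pos] by (simp add: form_norm_def)

lemma form_norm_linear_le: "form_norm P (a *\<^sub>R v + b *\<^sub>R w) \<le> \<bar>a\<bar> * form_norm P v + \<bar>b\<bar> * form_norm P w"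
  using form_norm_triangle[of "a *\<^sub>R v" "b *\<^sub>R w"] by (simp add: form_norm_scaleR)

lemma form_norm_diff: "\<bar>form_norm P v - form_norm P w\<bar> \<le> form_norm P (v - w)"
proof -
  have "form_norm P (w - v) = form_norm P (v - w)"
    using form_norm_scaleR[of P "-1" "v - w"] by simp
  then show ?thesis
    using form_norm_triangle[of w "v - w"] form_norm_triangle[of v "w - v"] by simp
qed

lemma form_det_pos: "0 < det P"
  by (rule det_positive_definite[OF pos])

text \<open>A component is a \<open>P\<close>-product: v_i is the product of v with P^-1 e_i, so the
  Cauchy-Schwarz inequality applies. Convergence in the norm therefore gives convergence of
  components.\<close>

lemma component_le_form_norm: "\<bar>v $ i\<bar> \<le> form_norm P v * form_norm P (matrix_inv P *v axis i 1)"
proof -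
  have "P *v (matrix_inv P *v axis i 1) = axis i 1"
    using form_det_pos by (simp add: matrix_vector_mul_assoc matrix_inv_mult)
  then have "v \<bullet> (P *v (matrix_inv P *v axis i 1)) = v $ i" by (simp add: inner_axis)
  with form_norm_Cauchy_Schwarz[of v "matrix_inv P *v axis i 1"] show ?thesis by simp
qed

lemma tendsto_of_form_norm:
  assumes "(\<lambda>k. form_norm P (v k - w)) \<longlonglongrightarrow> 0"
  shows "(\<lambda>k. v k $ i) \<longlonglongrightarrow> w $ i"
proof -
  have "(\<lambda>k. form_norm P (v k - w) * form_norm P (matrix_inv P *v axis i 1)) \<longlonglongrightarrow> 0"
    using tendsto_mult_right[OF assms, of "form_norm P (matrix_inv P *v axis i 1)"]
    by (simp add: mult.commute)
  then have "(\<lambda>k. v k $ i - w $ i) \<longlonglongrightarrow> 0"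
    by (rule Lim_null_comparison[rotated])
      (use component_le_form_norm[of "v _ - w" i] in \<open>simp add: always_eventually\<close>)
  then show ?thesis by (simp add: LIM_zero_iff)
qed

end

text \<open>With v = P u the form of the inverse at v is the form of \<open>P\<close> at u.\<close>

lemma positive_form_matrix_inv:
  assumes "positive_form P"
  shows "positive_form (matrix_inv P)"
proof -
  interpret positive_form P by fact
  have nz: "det P \<noteq> 0" using form_det_pos by simp
  show ?thesis
  proof
    show "transpose (matrix_inv P) = matrix_inv P"
      by (simp only: transpose_matrix_inv[OF nz] sym)
    fix v :: "real ^ 'a" assume "v \<noteq> 0"
    define u where "u = matrix_inv P *v v"
    have v: "v = P *v u"
      using nz by (simp add: u_def matrix_vector_mul_assoc matrix_inv_mult)
    with \<open>v \<noteq> 0\<close> have "u \<noteq> 0" by auto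
    then show "0 < v \<bullet> (matrix_inv P *v v)"
      using pos[of u] by (simp add: u_def[symmetric]) (simp add: v inner_commute)
  qed
qed

section \<open>Difference quotients of integrals\<close>

text \<open>The mean value theorem asks for differentiability in the open interval only, so 0 as an
  endpoint is harmless; p >= 1 makes z^{p-1} monotone.\<close>

lemma powr_diff_bound:
  fixes x y m p :: real
  assumes p: "1 \<le> p" and "0 \<le> x" "0 \<le> y" "x \<le> m" "y \<le> m"
  shows "\<bar>x powr p - y powr p\<bar> \<le> p * m powr (p - 1) * \<bar>x - y\<bar>"
proof -
  have *: "\<bar>b powr p - a powr p\<bar> \<le> p * m powr (p - 1) * \<bar>b - a\<bar>" if "0 \<le> a" "a < b" "b \<le> m" for a b
  proof -
    have "\<exists>l z. a < z \<and> z < b \<and> DERIV (\<lambda>x. x powr p) z :> l \<and> b powr p - a powr p = (b - a) * l"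
    proof (rule MVT[OF \<open>a < b\<close>])
      show "continuous_on {a..b} (\<lambda>x. x powr p)"
        using p that by (intro continuous_on_powr') (auto intro!: continuous_intros)
      fix x assume "a < x" "x < b"
      then have "((\<lambda>x. x powr p) has_real_derivative p * x powr (p - 1)) (at x)"
        using that by (intro has_real_derivative_powr) simp
      then show "(\<lambda>x. x powr p) differentiable (at x)"
        by (auto simp: real_differentiable_def)
    qed
    then obtain l z where z: "a < z" "z < b" "DERIV (\<lambda>x. x powr p) z :> l"
      "b powr p - a powr p = (b - a) * l" by blast
    have "((\<lambda>x. x powr p) has_real_derivative p * z powr (p - 1)) (at z)"
      using that z by (intro has_real_derivative_powr) simp
    then have l: "l = p * z powr (p - 1)" using z(3) DERIV_unique by blast
    have "z powr (p - 1) \<le> m powr (p - 1)" using p that z by (intro powr_mono2) auto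
    then have "\<bar>l\<bar> \<le> p * m powr (p - 1)" using p by (simp add: l abs_mult)
    then have "\<bar>b - a\<bar> * \<bar>l\<bar> \<le> \<bar>b - a\<bar> * (p * m powr (p - 1))" by (intro mult_left_mono) auto
    then show ?thesis by (simp add: z(4) abs_mult mult_ac)
  qed
  consider "x < y" | "x = y" | "y < x" by linarith
  then show ?thesis
    by cases (use *[of x y] *[of y x] assms in \<open>simp_all add: abs_minus_commute\<close>)
qed

text \<open>The sum is at most three times the maximum, whence the constant 3^p.\<close>

lemma powr_add3_le:
  fixes x y z p :: real
  assumes "0 \<le> p" "0 \<le> x" "0 \<le> y" "0 \<le> z"
  shows "(x + y + z) powr p \<le> 3 powr p * (x powr p + y powr p + z powr p)"
proof -
  define m where "m = max x (max y z)"
  have "(x + y + z) powr p \<le> (3 * m) powr p"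
    using assms by (intro powr_mono2) (auto simp: m_def)
  also have "\<dots> = 3 powr p * m powr p" by (simp add: powr_mult)
  also have "m powr p \<le> x powr p + y powr p + z powr p"
    by (auto simp: m_def max_def add_nonneg_nonneg)
  finally show ?thesis by simp
qed

lemma powr_add_le:
  fixes x y p :: real
  assumes "0 \<le> p" "0 \<le> x" "0 \<le> y"
  shows "(x + y) powr p \<le> 3 powr p * (x powr p + y powr p)"
  using powr_add3_le[of p x y 0] assms by simp

text \<open>A Gronwall estimate: ln u is Lipschitz with constant \<open>L\<close>, and |e^d - 1| <=
  |d| e^{|d|} for d = ln (u t) - ln (u s). The restriction of the distance to 1 bounds |d| by
  \<open>L\<close> and so gives the factor \<open>exp L\<close>.\<close>

lemma abs_diff_le_of_log_derivative:
  fixes u u' :: "real \<Rightarrow> real"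
  assumes I: "convex I" "s \<in> I" "t \<in> I" and st: "\<bar>t - s\<bar> \<le> 1"
    and deriv: "\<And>r. r \<in> I \<Longrightarrow> (u has_real_derivative u' r) (at r within I)"
    and pos: "\<And>r. r \<in> I \<Longrightarrow> 0 < u r"
    and bound: "\<And>r. r \<in> I \<Longrightarrow> \<bar>u' r\<bar> \<le> L * u r"
  shows "\<bar>u t - u s\<bar> \<le> L * exp L * \<bar>t - s\<bar> * u s"
proof -
  have L: "0 \<le> L" using bound[OF I(2)] pos[OF I(2)]
    by (metis abs_ge_zero order_trans zero_le_mult_iff not_less order_less_imp_le)
  have "norm (ln (u t) - ln (u s)) \<le> L * norm (t - s)"
  proof (rule field_differentiable_bound[OF I(1) _ _ I(3,2)])
    fix r assume r: "r \<in> I"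
    show "((\<lambda>r. ln (u r)) has_field_derivative u' r / u r) (at r within I)"
      using deriv[OF r] pos[OF r] by (auto intro!: derivative_eq_intros)
    show "norm (u' r / u r) \<le> L"
      using bound[OF r] pos[OF r] by (simp add: field_simps)
  qed
  define d where "d = ln (u t) - ln (u s)"
  have d: "\<bar>d\<bar> \<le> L * \<bar>t - s\<bar>" using \<open>norm _ \<le> _\<close> by (simp add: d_def)
  have "u t = exp d * u s" using pos[OF I(2)] pos[OF I(3)] by (simp add: d_def exp_diff)
  have "\<bar>exp d - 1\<bar> \<le> \<bar>d\<bar> * exp \<bar>d\<bar>"
  proof (cases "0 \<le> d")
    case True
    have "1 - d \<le> exp (- d)" using exp_ge_add_one_self[of "- d"] by simp
    then have "(1 - d) * exp d \<le> exp (- d) * exp d" by (intro mult_right_mono) auto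
    then have "exp d - 1 \<le> d * exp d" by (simp add: exp_minus algebra_simps)
    with True show ?thesis by simp
  next
    case False
    have "1 - exp d \<le> - d" using exp_ge_add_one_self[of d] by linarith
    also have "\<dots> \<le> - d * exp (- d)" using False by (intro mult_le_cancel_left1[THEN iffD2]) auto
    finally show ?thesis using False by simp
  qed
  also have "\<dots> \<le> (L * \<bar>t - s\<bar>) * exp L"
  proof (intro mult_mono d)
    have "\<bar>d\<bar> \<le> L" using d mult_left_mono[OF st L] by simp
    then show "exp \<bar>d\<bar> \<le> exp L" by simp
  qed (use L in auto)
  finally have "\<bar>exp d - 1\<bar> * u s \<le> (L * \<bar>t - s\<bar>) * exp L * u s"
    using pos[OF I(2)] by (intro mult_right_mono) auto
  moreover have "\<bar>u t - u s\<bar> = \<bar>exp d - 1\<bar> * u s"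
  proof -
    have "u t - u s = (exp d - 1) * u s" unfolding \<open>u t = exp d * u s\<close> by (simp add: left_diff_distrib)
    then show ?thesis using pos[OF I(2)] by (simp add: abs_mult)
  qed
  ultimately show ?thesis by (simp add: mult_ac)
qed

text \<open>Caratheodory's form f z - f u0 = h z (z - u0) of the derivative avoids any division by u
  k - u0, which may vanish.\<close>

lemma quotient_chain:
  fixes f :: "real \<Rightarrow> real"
  assumes f: "(f has_real_derivative D) (at u0)" and \<tau>: "\<tau> \<longlonglongrightarrow> 0" "\<And>k. \<tau> k \<noteq> 0"
    and u: "(\<lambda>k. (u k - u0) / \<tau> k) \<longlonglongrightarrow> u'"
  shows "(\<lambda>k. (f (u k) - f u0) / \<tau> k) \<longlonglongrightarrow> D * u'"
proof -
  obtain h where h: "\<And>z. f z - f u0 = h z * (z - u0)" "isCont h u0" "h u0 = D"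
    using f unfolding CARAT_DERIV by blast
  have "(\<lambda>k. (u k - u0) / \<tau> k * \<tau> k + u0) \<longlonglongrightarrow> u' * 0 + u0" by (intro tendsto_intros u \<tau>)
  then have "u \<longlonglongrightarrow> u0" using \<tau>(2) by simp
  then have "(\<lambda>k. h (u k)) \<longlonglongrightarrow> D" using isCont_tendsto_compose[OF h(2)] h(3) by simp
  from tendsto_mult[OF this u] show ?thesis by (simp add: h(1))
qed

lemma quotient_mult:
  fixes u v :: "nat \<Rightarrow> real"
  assumes \<tau>: "\<tau> \<longlonglongrightarrow> 0" "\<And>k. \<tau> k \<noteq> 0"
    and u: "(\<lambda>k. (u k - u0) / \<tau> k) \<longlonglongrightarrow> u'" and v: "(\<lambda>k. (v k - v0) / \<tau> k) \<longlonglongrightarrow> v'"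
  shows "(\<lambda>k. (u k * v k - u0 * v0) / \<tau> k) \<longlonglongrightarrow> u' * v0 + u0 * v'"
proof -
  have "(\<lambda>k. (v k - v0) / \<tau> k * \<tau> k + v0) \<longlonglongrightarrow> v' * 0 + v0" by (intro tendsto_intros v \<tau>)
  then have "v \<longlonglongrightarrow> v0" using \<tau>(2) by simp
  from tendsto_add[OF tendsto_mult[OF u this] tendsto_mult[OF tendsto_const[of u0] v]]
  show ?thesis by (rule Lim_transform_eventually) (use \<tau>(2) in \<open>auto simp: field_simps\<close>)
qed

text \<open>Away from q0 = 0 this is the chain rule for z^{p/2}. At q0 = 0 the quotient has absolute
  value (q k / tau^2)^{p/2} |tau|^{p-1}: the first factor converges and the second tends to 0
  because p > 1.\<close>

lemma quotient_sqrt_powr: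
  fixes q :: "nat \<Rightarrow> real"
  assumes \<tau>: "\<tau> \<longlonglongrightarrow> 0" "\<And>k. \<tau> k \<noteq> 0" and p: "1 \<le> p"
    and q: "\<And>k. 0 \<le> q k" "0 \<le> q0" and lim: "(\<lambda>k. (q k - q0) / \<tau> k) \<longlonglongrightarrow> q'"
    and nz: "q0 = 0 \<Longrightarrow> 1 < p" and zero: "q0 = 0 \<Longrightarrow> (\<lambda>k. q k / (\<tau> k)\<^sup>2) \<longlonglongrightarrow> L"
  shows "(\<lambda>k. (sqrt (q k) powr p - sqrt q0 powr p) / \<tau> k) \<longlonglongrightarrow> p / 2 * sqrt q0 powr (p - 2) * q'"
proof (cases "q0 = 0")
  case False
  with q have q0: "0 < q0" by simp
  have sqrt: "sqrt z powr r = z powr (r / 2)" if "0 \<le> z" for z r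
    using that by (simp add: powr_half_sqrt[symmetric] powr_powr)
  have "((\<lambda>z. z powr (p / 2)) has_real_derivative p / 2 * q0 powr (p / 2 - 1)) (at q0)"
    by (rule has_real_derivative_powr[OF q0])
  from quotient_chain[OF this \<tau> lim]
  show ?thesis using q by (simp add: sqrt diff_divide_distrib)
next
  case True
  have "(\<lambda>k. sqrt (q k / (\<tau> k)\<^sup>2) powr p * \<bar>\<tau> k\<bar> powr (p - 1)) \<longlonglongrightarrow> sqrt L powr p * \<bar>0\<bar> powr (p - 1)"
    using nz[OF True] p by (intro tendsto_mult tendsto_powr' tendsto_real_sqrt zero True tendsto_rabs \<tau> tendsto_const)
      (auto simp: q)
  then have "(\<lambda>k. sqrt (q k / (\<tau> k)\<^sup>2) powr p * \<bar>\<tau> k\<bar> powr (p - 1)) \<longlonglongrightarrow> 0" by simp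
  moreover have "sqrt (q k / (\<tau> k)\<^sup>2) powr p * \<bar>\<tau> k\<bar> powr (p - 1) = \<bar>sqrt (q k) powr p / \<tau> k\<bar>" for k
  proof -
    have "sqrt (q k / (\<tau> k)\<^sup>2) powr p * \<bar>\<tau> k\<bar> powr (p - 1) = sqrt (q k) powr p * (\<bar>\<tau> k\<bar> powr (p - 1) / \<bar>\<tau> k\<bar> powr p)"
      using q(1) by (simp add: real_sqrt_divide powr_divide)
    also have "\<bar>\<tau> k\<bar> powr (p - 1) / \<bar>\<tau> k\<bar> powr p = \<bar>\<tau> k\<bar> powr ((p - 1) - p)" by (rule powr_diff[symmetric])
    also have "\<dots> = 1 / \<bar>\<tau> k\<bar>" using \<tau>(2) by (simp add: powr_minus_divide)
    finally show ?thesis by simp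
  qed
  ultimately have "(\<lambda>k. \<bar>sqrt (q k) powr p / \<tau> k\<bar>) \<longlonglongrightarrow> 0" by (simp only:)
  then have "(\<lambda>k. sqrt (q k) powr p / \<tau> k) \<longlonglongrightarrow> 0" by (simp only: tendsto_rabs_zero_iff)
  \<comment> \<open>The asserted limit is 0 as well, because \<open>0 powr a = 0\<close> for every
    exponent, including the possibly negative p - 2.\<close>
  with True p show ?thesis by simp
qed

text \<open>The geometric bounds make the series of integrals converge. By monotone convergence the
  pointwise series is finite almost everywhere and integrable; it dominates each of its terms, and
  the terms tend to 0.\<close>

lemma summable_domination:
  fixes u :: "nat \<Rightarrow> 'a \<Rightarrow> real"
  assumes int: "\<And>k. integrable M (u k)" and nonneg: "\<And>k x. 0 \<le> u k x"
    and bound: "\<And>k. integral\<^sup>L M (u k) \<le> (1 / 2) ^ k"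
  obtains S where "integrable M S" "AE x in M. (\<forall>k. u k x \<le> S x) \<and> (\<lambda>k. u k x) \<longlonglongrightarrow> 0"
proof
  have sums: "summable (\<lambda>k. integral\<^sup>L M (u k))"
    by (rule summable_comparison_test'[of "\<lambda>k. (1 / 2) ^ k" 0])
      (use bound nonneg in \<open>auto simp: summable_geometric integral_nonneg_AE\<close>)
  have "(\<integral>\<^sup>+ x. (\<Sum>k. ennreal (u k x)) \<partial>M) = (\<Sum>k. \<integral>\<^sup>+ x. ennreal (u k x) \<partial>M)"
    using borel_measurable_integrable[OF int] by (intro nn_integral_suminf) simp
  also have "\<dots> = (\<Sum>k. ennreal (integral\<^sup>L M (u k)))"
    using int nonneg by (simp add: nn_integral_eq_integral)
  also have "\<dots> < \<infinity>"
    using sums nonneg by (subst suminf_ennreal_eq[OF _ summable_sums]) (auto intro!: integral_nonneg_AE)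
  finally have "(\<integral>\<^sup>+ x. (\<Sum>k. ennreal (u k x)) \<partial>M) \<noteq> \<infinity>" by simp
  moreover have "(\<lambda>x. \<Sum>k. ennreal (u k x)) \<in> borel_measurable M"
    using borel_measurable_integrable[OF int] by (intro borel_measurable_suminf_order) simp
  ultimately have "AE x in M. (\<Sum>k. ennreal (u k x)) \<noteq> \<infinity>" by (rule nn_integral_noteq_infinite[rotated])
  then have AE: "AE x in M. summable (\<lambda>k. u k x)"
    by eventually_elim (rule summable_suminf_not_top, use nonneg in auto)
  show "integrable M (\<lambda>x. \<Sum>k. u k x)"
    by (rule integrable_suminf[OF int]) (use AE sums nonneg in auto)
  from AE show "AE x in M. (\<forall>k. u k x \<le> (\<Sum>k. u k x)) \<and> (\<lambda>k. u k x) \<longlonglongrightarrow> 0"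
  proof eventually_elim
    case (elim x)
    have "u k x \<le> (\<Sum>k. u k x)" for k
      using sum_le_suminf[OF elim, of "{k}"] nonneg by simp
    with summable_LIMSEQ_zero[OF elim] show ?case by blast
  qed
qed

text \<open>
  Differentiation under the integral along \<open>\<tau> k \<rightarrow> 0\<close>. The \<open>q k\<close> are squared norms of a moving vector in a
  moving metric, \<open>w k\<close> is the moving density, and \<open>X k\<close> is the norm of the same vector in the limiting metric;
  \<open>a\<close> and \<open>\<sigma> k\<close> are the norms of the limit of the vector's difference quotients and of the error. Where
  \<open>q0 = 0\<close> the norm is not differentiable, but its \<open>p\<close>-th power is if \<open>p > 1\<close>.
\<close>

lemma powr_integral_quotient:
  fixes M :: "'a measure" and q :: "nat \<Rightarrow> 'a \<Rightarrow> real"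
  assumes \<tau>: "\<tau> \<longlonglongrightarrow> 0" "\<And>k. \<tau> k \<noteq> 0" "\<And>k. \<bar>\<tau> k\<bar> \<le> 1" and p: "1 \<le> p"
    and q: "\<And>k x. 0 \<le> q k x" "\<And>x. 0 \<le> q0 x"
    and meas: "\<And>k. (\<lambda>x. w k x * sqrt (q k x) powr p) \<in> borel_measurable M"
      "(\<lambda>x. w0 x * sqrt (q0 x) powr p) \<in> borel_measurable M"
    and q_lim: "AE x in M. (\<lambda>k. (q k x - q0 x) / \<tau> k) \<longlonglongrightarrow> q' x"
    and q_zero: "AE x in M. q0 x = 0 \<longrightarrow> 1 < p \<and> (\<exists>L. (\<lambda>k. q k x / (\<tau> k)\<^sup>2) \<longlonglongrightarrow> L)"
    and w: "\<And>x. 0 \<le> w0 x" "\<And>x. w0 x \<le> W" "\<And>x. (\<lambda>k. (w k x - w0 x) / \<tau> k) \<longlonglongrightarrow> w' x"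
    and X: "\<And>k x. 0 \<le> X k x" "\<And>x. 0 \<le> a x" "\<And>k x. 0 \<le> \<sigma> k x"
      "\<And>k x. \<bar>X k x - sqrt (q0 x)\<bar> \<le> \<bar>\<tau> k\<bar> * (a x + \<sigma> k x)"
      "\<And>k x. \<bar>w k x * sqrt (q k x) powr p - w0 x * X k x powr p\<bar> \<le> C * \<bar>\<tau> k\<bar> * (w0 x * X k x powr p)"
    and int: "integrable M (\<lambda>x. sqrt (q0 x) powr p)" "integrable M (\<lambda>x. a x powr p)" "integrable M S"
    and S: "AE x in M. \<forall>k. \<sigma> k x powr p \<le> S x"
    and d_meas: "(\<lambda>x. w' x * sqrt (q0 x) powr p + w0 x * (p / 2 * sqrt (q0 x) powr (p - 2) * q' x)) \<in> borel_measurable M"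
  shows "(\<lambda>k. ((\<integral>x. w k x * sqrt (q k x) powr p \<partial>M) - (\<integral>x. w0 x * sqrt (q0 x) powr p \<partial>M)) / \<tau> k)
      \<longlonglongrightarrow> (\<integral>x. w' x * sqrt (q0 x) powr p + w0 x * (p / 2 * sqrt (q0 x) powr (p - 2) * q' x) \<partial>M)"
proof -
  let ?e = "\<lambda>k x. w k x * sqrt (q k x) powr p" and ?b = "\<lambda>x. w0 x * sqrt (q0 x) powr p"
  let ?d = "\<lambda>x. w' x * sqrt (q0 x) powr p + w0 x * (p / 2 * sqrt (q0 x) powr (p - 2) * q' x)"
  \<comment> \<open>In this majorant, \<open>C\<close> accounts for the change of density and metric
    at a fixed vector, \<open>p\<close> for the mean value bound on the p-th power, \<open>W\<close>
    for the density at the base time, and 3^p for splitting the power of the sum \<open>m\<close>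
    below.\<close>
  let ?G = "\<lambda>x. (\<bar>C\<bar> + p) * W * (3 powr p * (sqrt (q0 x) powr p + a x powr p + S x))"
  have int_e0: "integrable M ?b"
    by (rule Bochner_Integration.integrable_bound[OF integrable_mult_right[OF int(1), of W]])
      (use meas w in \<open>auto simp: abs_mult intro!: AE_I2 mult_right_mono order_trans[OF _ abs_ge_self]\<close>)
  have int_G: "integrable M ?G"
    by (intro integrable_mult_right Bochner_Integration.integrable_add int)
  have bound: "AE x in M. \<forall>k. \<bar>(?e k x - ?b x) / \<tau> k\<bar> \<le> ?G x"
    using S
  proof eventually_elim
    case (elim x)
    show ?case
    proof
      fix k
      let ?s = "sqrt (q0 x)" and ?Y = "X k x"
      \<comment> \<open>A common bound for the old and the new norm, since |tau k| <= 1; it also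
        bounds a + sigma, so that the mean value bound closes up to m^{p-1} m = m^p.\<close>
      define m where "m = ?s + a x + \<sigma> k x"
      have s: "0 \<le> ?s" using q by simp
      have "\<bar>\<tau> k\<bar> * (a x + \<sigma> k x) \<le> 1 * (a x + \<sigma> k x)" using \<tau>(3) X by (intro mult_right_mono) auto
      then have Ym: "?Y \<le> m" using X(4)[of k x] by (simp add: m_def)
      have sm: "?s \<le> m" and m0: "0 \<le> m" using X s by (auto simp: m_def)
      have "\<bar>?Y powr p - ?s powr p\<bar> \<le> p * m powr (p - 1) * \<bar>?Y - ?s\<bar>"
        by (rule powr_diff_bound[OF p X(1) s Ym sm])
      also have "\<dots> \<le> p * m powr (p - 1) * (\<bar>\<tau> k\<bar> * m)"
      proof (intro mult_left_mono)
        have "\<bar>\<tau> k\<bar> * (a x + \<sigma> k x) \<le> \<bar>\<tau> k\<bar> * m" using s by (intro mult_left_mono) (auto simp: m_def)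
        with X(4)[of k x] show "\<bar>?Y - ?s\<bar> \<le> \<bar>\<tau> k\<bar> * m" by linarith
      qed (use p in auto)
      also have "\<dots> = p * \<bar>\<tau> k\<bar> * m powr p"
        using m0 powr_mult_base[OF m0, of "p - 1"] by (simp add: mult_ac)
      finally have 1: "\<bar>?Y powr p - ?s powr p\<bar> \<le> p * \<bar>\<tau> k\<bar> * m powr p" .
      \<comment> \<open>The intermediate term has the new vector in the old metric with the old
        density. Thus one difference moves only metric and density, the other only the
        vector.\<close>
      have "\<bar>?e k x - ?b x\<bar> \<le> \<bar>?e k x - w0 x * ?Y powr p\<bar> + w0 x * \<bar>?Y powr p - ?s powr p\<bar>"
      proof -
        have "w0 x * \<bar>?Y powr p - ?s powr p\<bar> = \<bar>w0 x * ?Y powr p - w0 x * ?s powr p\<bar>"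
          using w(1)[of x] by (simp add: right_diff_distrib[symmetric] abs_mult)
        then show ?thesis by linarith
      qed
      also have "\<dots> \<le> C * \<bar>\<tau> k\<bar> * (w0 x * ?Y powr p) + w0 x * (p * \<bar>\<tau> k\<bar> * m powr p)"
        using X(5)[of k x] 1 w(1) by (intro add_mono mult_left_mono) auto
      also have "\<dots> \<le> \<bar>C\<bar> * \<bar>\<tau> k\<bar> * (w0 x * m powr p) + w0 x * (p * \<bar>\<tau> k\<bar> * m powr p)"
        using w(1) X(1) Ym p by (intro add_right_mono mult_mono mult_right_mono powr_mono2) auto
      also have "\<dots> = \<bar>\<tau> k\<bar> * ((\<bar>C\<bar> + p) * w0 x * m powr p)" by (simp add: algebra_simps)
      also have "\<dots> \<le> \<bar>\<tau> k\<bar> * ?G x"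
      proof (intro mult_left_mono mult_mono)
        have "m powr p \<le> 3 powr p * (?s powr p + a x powr p + \<sigma> k x powr p)"
          unfolding m_def by (rule powr_add3_le) (use p s X in auto)
        also have "\<dots> \<le> 3 powr p * (?s powr p + a x powr p + S x)" using elim by simp
        finally show "m powr p \<le> 3 powr p * (?s powr p + a x powr p + S x)" .
      qed (use p w order_trans[OF w(1,2)] in auto)
      finally show "\<bar>(?e k x - ?b x) / \<tau> k\<bar> \<le> ?G x" using \<tau>(2) by (simp add: abs_divide field_simps)
    qed
  qed
  have lim: "AE x in M. (\<lambda>k. (?e k x - ?b x) / \<tau> k) \<longlonglongrightarrow> ?d x"
    using q_lim q_zero
  proof eventually_elim
    case (elim x)
    obtain L where L: "q0 x = 0 \<Longrightarrow> (\<lambda>k. q k x / (\<tau> k)\<^sup>2) \<longlonglongrightarrow> L" using elim(2) by blast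
    have "(\<lambda>k. (sqrt (q k x) powr p - sqrt (q0 x) powr p) / \<tau> k) \<longlonglongrightarrow> p / 2 * sqrt (q0 x) powr (p - 2) * q' x"
      by (rule quotient_sqrt_powr[OF \<tau>(1,2) p q elim(1) _ L]) (use elim(2) in auto)
    from quotient_mult[OF \<tau>(1,2) w(3) this] show ?case .
  qed
  have meas_quot: "(\<lambda>x. (?e k x - ?b x) / \<tau> k) \<in> borel_measurable M" for k
    using meas by measurable
  have int_quot: "integrable M (\<lambda>x. (?e k x - ?b x) / \<tau> k)" for k
    by (rule Bochner_Integration.integrable_bound[OF int_G meas_quot])
      (use bound in \<open>eventually_elim, auto intro: order_trans[OF _ abs_ge_self]\<close>)
  have eq: "(\<integral>x. (?e k x - ?b x) / \<tau> k \<partial>M) = ((\<integral>x. ?e k x \<partial>M) - (\<integral>x. ?b x \<partial>M)) / \<tau> k" for k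
  proof -
    \<comment> \<open>Integrability of \<open>?e k\<close> is recovered from the dominated quotient;
      without it the integral of the difference could not be split.\<close>
    have "integrable M (\<lambda>x. (?e k x - ?b x) / \<tau> k * \<tau> k + ?b x)"
      by (intro Bochner_Integration.integrable_add integrable_mult_left int_quot int_e0)
    then have "integrable M (?e k)" using \<tau>(2) by simp
    with int_e0 show ?thesis by simp
  qed
  have "(\<lambda>k. \<integral>x. (?e k x - ?b x) / \<tau> k \<partial>M) \<longlonglongrightarrow> (\<integral>x. ?d x \<partial>M)"
  proof (rule integral_dominated_convergence[OF d_meas meas_quot int_G lim])
    show "AE x in M. norm ((?e k x - ?b x) / \<tau> k) \<le> ?G x" for k
      using bound by eventually_elim simp
  qed
  then show ?thesis by (simp only: eq)
qed

text \<open>The product rule entry by entry; symmetry of the limiting form merges the two cross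
  terms into one with the factor 2.\<close>

lemma quotient_form:
  fixes P :: "nat \<Rightarrow> real ^ 'n ^ 'n"
  assumes \<tau>: "\<tau> \<longlonglongrightarrow> 0" "\<And>k. \<tau> k \<noteq> 0"
    and P: "\<And>i j. (\<lambda>k. (P k $ i $ j - P0 $ i $ j) / \<tau> k) \<longlonglongrightarrow> P' $ i $ j"
    and v: "\<And>i. (\<lambda>k. (v k $ i - v0 $ i) / \<tau> k) \<longlonglongrightarrow> v' $ i"
    and sym: "transpose P0 = P0"
  shows "(\<lambda>k. (v k \<bullet> (P k *v v k) - v0 \<bullet> (P0 *v v0)) / \<tau> k)
    \<longlonglongrightarrow> v0 \<bullet> (P' *v v0) + 2 * (v' \<bullet> (P0 *v v0))"
proof -
  have "(\<lambda>k. \<Sum>i\<in>UNIV. \<Sum>j\<in>UNIV. (P k $ i $ j * (v k $ i * v k $ j) - P0 $ i $ j * (v0 $ i * v0 $ j)) / \<tau> k)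
      \<longlonglongrightarrow> (\<Sum>i\<in>UNIV. \<Sum>j\<in>UNIV. P' $ i $ j * (v0 $ i * v0 $ j) + P0 $ i $ j * (v' $ i * v0 $ j + v0 $ i * v' $ j))"
    by (intro tendsto_sum quotient_mult \<tau> P v)
  moreover have "(\<Sum>i\<in>UNIV. \<Sum>j\<in>UNIV. (P k $ i $ j * (v k $ i * v k $ j) - P0 $ i $ j * (v0 $ i * v0 $ j)) / \<tau> k)
      = (v k \<bullet> (P k *v v k) - v0 \<bullet> (P0 *v v0)) / \<tau> k" for k
    by (simp add: inner_matrix_vector_sum sum_subtractf sum_divide_distrib diff_divide_distrib)
  moreover have "(\<Sum>i\<in>UNIV. \<Sum>j\<in>UNIV. P' $ i $ j * (v0 $ i * v0 $ j) + P0 $ i $ j * (v' $ i * v0 $ j + v0 $ i * v' $ j))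
      = v0 \<bullet> (P' *v v0) + (v' \<bullet> (P0 *v v0) + v0 \<bullet> (P0 *v v'))"
    by (simp add: inner_matrix_vector_sum sum.distrib distrib_left)
  moreover have "v0 \<bullet> (P0 *v v') = v' \<bullet> (P0 *v v0)"
    by (metis dot_lmul_matrix inner_commute sym transpose_matrix_vector)
  ultimately show ?thesis by simp
qed

text \<open>The case of a vector vanishing at the base time: after division by tau both arguments of
  the form converge. This is the O(tau^2) behaviour that \<open>quotient_sqrt_powr\<close> requires
  at a zero.\<close>

lemma quotient_form_zero:
  fixes P :: "nat \<Rightarrow> real ^ 'n ^ 'n"
  assumes \<tau>: "\<tau> \<longlonglongrightarrow> 0" "\<And>k. \<tau> k \<noteq> 0"
    and P: "\<And>i j. (\<lambda>k. (P k $ i $ j - P0 $ i $ j) / \<tau> k) \<longlonglongrightarrow> P' $ i $ j"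
    and v: "\<And>i. (\<lambda>k. v k $ i / \<tau> k) \<longlonglongrightarrow> v' $ i"
  shows "(\<lambda>k. (v k \<bullet> (P k *v v k)) / (\<tau> k)\<^sup>2) \<longlonglongrightarrow> v' \<bullet> (P0 *v v')"
proof -
  have "(\<lambda>k. P k $ i $ j) \<longlonglongrightarrow> P0 $ i $ j" for i j
  proof -
    have "(\<lambda>k. (P k $ i $ j - P0 $ i $ j) / \<tau> k * \<tau> k + P0 $ i $ j) \<longlonglongrightarrow> P' $ i $ j * 0 + P0 $ i $ j"
      by (intro tendsto_intros P \<tau>)
    then show ?thesis using \<tau>(2) by simp
  qed
  then have "(\<lambda>k. \<Sum>i\<in>UNIV. \<Sum>j\<in>UNIV. P k $ i $ j * ((v k $ i / \<tau> k) * (v k $ j / \<tau> k)))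
      \<longlonglongrightarrow> (\<Sum>i\<in>UNIV. \<Sum>j\<in>UNIV. P0 $ i $ j * (v' $ i * v' $ j))"
    by (intro tendsto_sum tendsto_mult v)
  then show ?thesis
    by (simp add: inner_matrix_vector_sum sum_divide_distrib power2_eq_square)
qed

lemma has_real_derivative_sequentially:
  fixes u :: "real \<Rightarrow> real"
  assumes "(u has_real_derivative D) (at t within S)"
    and "\<And>k. s k \<in> S" "\<And>k. s k \<noteq> t" "s \<longlonglongrightarrow> t"
  shows "(\<lambda>k. (u (s k) - u t) / (s k - t)) \<longlonglongrightarrow> D"
proof -
  have "((\<lambda>r. (u r - u t) / (r - t)) \<longlongrightarrow> D) (at t within S)"
    using assms(1) by (simp only: has_field_derivative_iff)
  then have "((\<lambda>r. (u r - u t) / (r - t)) \<circ> s) \<longlonglongrightarrow> D"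
    using assms(2-4) unfolding tendsto_at_iff_sequentially by blast
  then show ?thesis by (simp only: o_def)
qed

lemma form_minus: "v \<bullet> ((- M) *v w) = - (v \<bullet> (M *v w))" for M :: "real ^ 'n ^ 'm"
  by (simp add: inner_matrix_vector_sum sum_negf)

lemma axis_form: "axis i 1 \<bullet> (M *v axis j 1) = M $ i $ j" for M :: "real ^ 'n ^ 'm"
proof -
  have "(M *v axis j 1) $ i = M $ i $ j"
    by (simp add: matrix_vector_mult_def axis_def if_distrib cong: if_cong)
  then show ?thesis by (simp only: inner_axis') simp
qed

lemma integrable_powr_linear:
  fixes u n1 n2 :: "'a \<Rightarrow> real"
  assumes p: "0 \<le> p" and int: "integrable M (\<lambda>x. n1 x powr p)" "integrable M (\<lambda>x. n2 x powr p)"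
    and u: "u \<in> borel_measurable M" "\<And>x. 0 \<le> u x" "\<And>x. u x \<le> \<bar>a\<bar> * n1 x + \<bar>b\<bar> * n2 x"
    and nonneg: "\<And>x. 0 \<le> n1 x" "\<And>x. 0 \<le> n2 x"
  shows "integrable M (\<lambda>x. u x powr p)"
proof (rule Bochner_Integration.integrable_bound)
  show "integrable M (\<lambda>x. 3 powr p * (\<bar>a\<bar> powr p * n1 x powr p + \<bar>b\<bar> powr p * n2 x powr p))"
    by (intro integrable_mult_right Bochner_Integration.integrable_add int)
  show "(\<lambda>x. u x powr p) \<in> borel_measurable M" using u(1) by measurable
  show "AE x in M. norm (u x powr p) \<le> norm (3 powr p * (\<bar>a\<bar> powr p * n1 x powr p + \<bar>b\<bar> powr p * n2 x powr p))"
  proof (rule AE_I2)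
    fix x
    have "u x powr p \<le> (\<bar>a\<bar> * n1 x + \<bar>b\<bar> * n2 x) powr p"
      using p u by (intro powr_mono2) auto
    also have "\<dots> \<le> 3 powr p * ((\<bar>a\<bar> * n1 x) powr p + (\<bar>b\<bar> * n2 x) powr p)"
      using p nonneg by (intro powr_add_le) auto
    finally show "norm (u x powr p) \<le> norm (3 powr p * (\<bar>a\<bar> powr p * n1 x powr p + \<bar>b\<bar> powr p * n2 x powr p))"
      using nonneg by (simp add: powr_mult)
  qed
qed

lemma tendsto_zero_of_powr:
  fixes u :: "nat \<Rightarrow> real"
  assumes "(\<lambda>k. u k powr p) \<longlonglongrightarrow> 0" "0 < p" "\<And>k. 0 \<le> u k"
  shows "u \<longlonglongrightarrow> 0"
proof -
  have "(\<lambda>k. (u k powr p) powr (1 / p)) \<longlonglongrightarrow> 0"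
    by (rule tendsto_zero_powrI[OF assms(1) tendsto_const]) (use assms(2) in auto)
  then show ?thesis using assms(2,3) by (simp add: powr_powr)
qed

text \<open>Valid at r = 0 too, whatever the sign of p - 2, because
  \<open>0 powr a = 0\<close>.\<close>

lemma powr_minus_2_mult_square:
  fixes r p :: real
  assumes "0 \<le> r"
  shows "r powr (p - 2) * r\<^sup>2 = r powr p"
proof (cases "r = 0")
  case False
  then have "r\<^sup>2 = r powr 2" using assms by (simp add: powr_numeral)
  then show ?thesis by (simp add: powr_add[symmetric])
qed simp

text \<open>A crude Young inequality: r^{p-1} a is at most the p-th power of the maximum. It makes
  the cross terms |f|^{p-2} f f' and |df|^{p-2} <df, df'> integrable.\<close>

lemma powr_minus_2_mult_le:
  fixes r a p :: real
  assumes r: "0 \<le> r" and a: "0 \<le> a" and p: "1 \<le> p"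
  shows "r powr (p - 2) * (r * a) \<le> r powr p + a powr p"
proof (cases "r = 0")
  case False
  with r have r0: "0 < r" by simp
  define m where "m = max r a"
  have "r powr (p - 2) * (r * a) = r powr (p - 1) * a"
    using r0 powr_mult_base[of r "p - 2"] by (simp add: mult_ac)
  also have "\<dots> \<le> m powr (p - 1) * m"
    using r a p by (intro mult_mono powr_mono2) (auto simp: m_def)
  also have "\<dots> = m powr p"
    using r powr_mult_base[of m "p - 1"] by (simp add: m_def max_def mult_ac)
  also have "\<dots> \<le> r powr p + a powr p" by (auto simp: m_def max_def)
  finally show ?thesis .
qed simp

lemma integrable_bounded_mult:
  fixes h k :: "'a \<Rightarrow> real"
  assumes h: "integrable M h" and k: "k \<in> borel_measurable M" "\<And>x. \<bar>k x\<bar> \<le> K"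
  shows "integrable M (\<lambda>x. k x * h x)"
proof (rule Bochner_Integration.integrable_bound)
  show "integrable M (\<lambda>x. K * h x)" using h by simp
  show "(\<lambda>x. k x * h x) \<in> borel_measurable M" using k(1) borel_measurable_integrable[OF h] by simp
  show "AE x in M. norm (k x * h x) \<le> norm (K * h x)"
  proof (rule AE_I2)
    fix x
    have "\<bar>k x\<bar> \<le> \<bar>K\<bar>" using k(2)[of x] by linarith
    then show "norm (k x * h x) \<le> norm (K * h x)" by (simp add: abs_mult mult_right_mono)
  qed
qed

lemma integrable_le:
  fixes h k :: "'a \<Rightarrow> real"
  assumes "integrable M h" "k \<in> borel_measurable M" "\<And>x. \<bar>k x\<bar> \<le> h x"
  shows "integrable M k"
  by (rule Bochner_Integration.integrable_bound[OF assms(1,2)])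
    (use assms(3) in \<open>auto intro: order_trans[OF _ abs_ge_self]\<close>)

lemma bounded_on_compact:
  fixes u :: "'a::topological_space \<Rightarrow> real"
  assumes "continuous_on S u" "compact S"
  obtains B where "0 \<le> B" "\<And>z. z \<in> S \<Longrightarrow> \<bar>u z\<bar> \<le> B"
proof -
  have "bounded (u ` S)" using assms by (intro compact_imp_bounded compact_continuous_image)
  then obtain B where "\<forall>r\<in>u ` S. norm r \<le> B" unfolding bounded_iff by blast
  then have "\<bar>u z\<bar> \<le> \<bar>B\<bar>" if "z \<in> S" for z using that by fastforce
  with that show ?thesis by (metis abs_ge_zero)
qed

text \<open>Both forms are homogeneous of degree 2, so their ratio need only be bounded on the
  product of \<open>S\<close> with the unit sphere, where compactness applies.\<close>

lemma form_ratio_bounded: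
  fixes P B :: "'a::topological_space \<Rightarrow> real ^ 'n ^ 'n"
  assumes S: "compact S" and P: "\<And>i j. continuous_on S (\<lambda>z. P z $ i $ j)"
    and B: "\<And>i j. continuous_on S (\<lambda>z. B z $ i $ j)"
    and pos: "\<And>z. z \<in> S \<Longrightarrow> positive_form (P z)"
  obtains L where "0 \<le> L" "\<And>z v. z \<in> S \<Longrightarrow> \<bar>v \<bullet> (B z *v v)\<bar> \<le> L * (v \<bullet> (P z *v v))"
proof -
  let ?K = "S \<times> sphere (0 :: real ^ 'n) 1"
  have cont: "continuous_on ?K (\<lambda>z. snd z \<bullet> (M (fst z) *v snd z))"
    if "\<And>i j. continuous_on S (\<lambda>z. M z $ i $ j)" for M :: "'a \<Rightarrow> real ^ 'n ^ 'n"
  proof -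
    have M: "continuous_on ?K (\<lambda>z. M (fst z) $ i $ j)" for i j
      by (rule continuous_on_compose2[OF that]) (auto intro!: continuous_intros)
    then show ?thesis
      unfolding inner_matrix_vector_sum
      by (intro continuous_on_sum continuous_on_mult M) (intro continuous_intros)+
  qed
  have nz: "0 < snd z \<bullet> (P (fst z) *v snd z)" if "z \<in> ?K" for z
  proof -
    have "snd z \<noteq> 0" using that by auto
    with positive_form.pos[OF pos] that show ?thesis by auto
  qed
  have "continuous_on ?K (\<lambda>z. (snd z \<bullet> (B (fst z) *v snd z)) / (snd z \<bullet> (P (fst z) *v snd z)))"
    using nz by (intro continuous_on_divide cont P B) force
  moreover have "compact ?K" using S by (intro compact_Times) auto
  ultimately obtain L where L: "0 \<le> L"
    "\<And>z. z \<in> ?K \<Longrightarrow> \<bar>(snd z \<bullet> (B (fst z) *v snd z)) / (snd z \<bullet> (P (fst z) *v snd z))\<bar> \<le> L"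
    by (rule bounded_on_compact) blast
  show thesis
  proof (rule that[OF L(1)])
    fix z v assume z: "z \<in> S"
    show "\<bar>v \<bullet> (B z *v v)\<bar> \<le> L * (v \<bullet> (P z *v v))"
    proof (cases "v = 0")
      case False
      define u where "u = (1 / norm v) *\<^sub>R v"
      have v: "v = norm v *\<^sub>R u" using False by (simp add: u_def)
      have u: "(z, u) \<in> ?K" using False z by (simp add: u_def)
      have scale: "v \<bullet> (M *v v) = (norm v)\<^sup>2 * (u \<bullet> (M *v u))" for M :: "real ^ 'n ^ 'n"
        by (subst (1 2) v) (simp add: matrix_vector_mult_scaleR power2_eq_square)
      have "\<bar>u \<bullet> (B z *v u)\<bar> \<le> L * (u \<bullet> (P z *v u))"
        using L(2)[OF u] nz[OF u] by (simp add: abs_divide field_simps)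
      then have "(norm v)\<^sup>2 * \<bar>u \<bullet> (B z *v u)\<bar> \<le> (norm v)\<^sup>2 * (L * (u \<bullet> (P z *v u)))"
        by (intro mult_left_mono) auto
      then show ?thesis by (simp add: scale abs_mult mult_ac)
    qed simp
  qed
qed

text \<open>Derivatives are kept in the shape value times logarithmic derivative: the latter add up
  under products, and they are what the Gronwall estimate consumes.\<close>

lemma has_real_derivative_mult_log:
  assumes "(u has_real_derivative u t * l) (at t within S)" "(v has_real_derivative v t * m) (at t within S)"
  shows "((\<lambda>s. u s * v s) has_real_derivative u t * v t * (l + m)) (at t within S)"
  by (rule DERIV_cong[OF DERIV_mult[OF assms]]) (simp add: algebra_simps)

lemma has_real_derivative_powr_log:
  fixes q :: "real \<Rightarrow> real"
  assumes q: "(q has_real_derivative q') (at t within S)" and pos: "0 < q t"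
  shows "((\<lambda>s. q s powr r) has_real_derivative q t powr r * (r * (q' / q t))) (at t within S)"
proof -
  have "((\<lambda>z. z powr r) has_real_derivative r * q t powr (r - 1)) (at (q t))"
    by (rule has_real_derivative_powr[OF pos])
  from DERIV_chain2[OF this q] show ?thesis
    by (rule DERIV_cong) (use pos in \<open>simp add: powr_diff\<close>)
qed

lemma at_within_Ico_neq_bot: "t \<in> {0..<T} \<Longrightarrow> at t within {0..<T} \<noteq> bot" for t T :: real
proof -
  assume t: "t \<in> {0..<T}"
  then have "{t<..<T} \<subseteq> {0..<T} - {t}" by auto
  from closure_mono[OF this] t have "t \<in> closure ({0..<T} - {t})" by auto
  then show ?thesis by (simp add: at_within_eq_bot_iff)
qed

lemma smooth_on_imp_continuous_on: "smooth_on S u \<Longrightarrow> continuous_on S u"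
  by (metis Ck_on.simps(1) smooth_on_def)

lemma smooth_on_imp_differentiable_on: "smooth_on S u \<Longrightarrow> u differentiable_on S"
  by (metis Ck_on.simps(2) smooth_on_def)

text \<open>\<open>smooth_on\<close> gives continuity of the Frechet derivative in the direction (1,
  0). Restricting to a line of constant \<open>y\<close> and using uniqueness of the (possibly
  one-sided) derivative identifies it with \<open>u'\<close>. Joint continuity of the right-hand
  sides of the flow follows without differentiating curvature expressions.\<close>

lemma continuous_on_time_derivative:
  fixes u u' :: "real \<Rightarrow> 'a::euclidean_space \<Rightarrow> real"
  assumes smooth: "smooth_on ({0..<T} \<times> U) (\<lambda>(t, y). u t y)"
    and deriv: "\<And>t y. t \<in> {0..<T} \<Longrightarrow> y \<in> U \<Longrightarrow>
      ((\<lambda>s. u s y) has_real_derivative u' t y) (at t within {0..<T})"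
  shows "continuous_on ({0..<T} \<times> U) (\<lambda>(t, y). u' t y)"
proof -
  let ?S = "{0..<T} \<times> U" and ?u = "\<lambda>(t, y). u t y"
  let ?e = "(1, 0) :: real \<times> 'a"
  have Ck: "Ck_on (Suc 0) ?S ?u" using smooth by (simp only: smooth_on_def)
  note Ck = Ck[unfolded Ck_on.simps]
  then have diff: "?u differentiable_on ?S" by (rule conjunct1)
  have e: "?e \<in> Basis" by (simp add: Basis_prod_def)
  from bspec[OF conjunct2[OF Ck] e]
  have cont: "continuous_on ?S (\<lambda>x. frechet_derivative ?u (at x within ?S) ?e)" .
  have "frechet_derivative ?u (at (t, y) within ?S) ?e = u' t y" if "t \<in> {0..<T}" "y \<in> U" for t y
  proof -
    let ?D = "frechet_derivative ?u (at (t, y) within ?S)"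
    have "(?u has_derivative ?D) (at (t, y) within ?S)"
      using diff that unfolding differentiable_on_def frechet_derivative_works by blast
    then have "(?u has_derivative ?D) (at (t, y) within (\<lambda>s. (s, y)) ` {0..<T})"
      by (rule has_derivative_subset) (use that in auto)
    moreover have "((\<lambda>s. (s, y)) has_derivative (\<lambda>h. (h, 0))) (at t within {0..<T})"
      by (auto intro!: derivative_eq_intros)
    ultimately have "((\<lambda>s. ?u (s, y)) has_derivative (\<lambda>h. ?D (h, 0))) (at t within {0..<T})"
      using has_derivative_in_compose[of "\<lambda>s. (s, y)" "\<lambda>h. (h, 0)" t "{0..<T}" ?u ?D] by simp
    moreover have "(\<lambda>h. ?D (h, 0)) = (\<lambda>h. h *\<^sub>R ?D ?e)"
    proof
      fix h show "?D (h, 0) = h *\<^sub>R ?D ?e"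
        using linear_scale[OF has_derivative_linear[OF \<open>(?u has_derivative ?D) (at (t, y) within ?S)\<close>], of h ?e]
        by simp
    qed
    ultimately have "((\<lambda>s. u s y) has_vector_derivative ?D ?e) (at t within {0..<T})"
      by (simp only: has_vector_derivative_def prod.case)
    moreover have "((\<lambda>s. u s y) has_vector_derivative u' t y) (at t within {0..<T})"
      using deriv[OF that] by (simp add: has_real_derivative_iff_has_vector_derivative)
    ultimately show ?thesis
      by (rule vector_derivative_unique_within[OF at_within_Ico_neq_bot[OF that(1)]])
  qed
  then show ?thesis by (intro continuous_on_eq[OF cont]) auto
qed

section \<open>Tensors and volumes on a closed manifold\<close>

text \<open>Local integrability yields measurability on compact subsets only; an open set is a
  countable union of closed boxes, on which the pieces can be glued.\<close>

lemma borel_measurable_open_of_compacts: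
  fixes u :: "'a::euclidean_space \<Rightarrow> real"
  assumes U: "open U" and u: "\<And>K. compact K \<Longrightarrow> K \<subseteq> U \<Longrightarrow> set_borel_measurable lborel K u"
  shows "u \<in> borel_measurable (restrict_space borel U)"
proof -
  obtain \<D> where D: "countable \<D>" "\<D> \<subseteq> Pow U" "\<And>X. X \<in> \<D> \<Longrightarrow> \<exists>a b. X = cbox a b" "\<Union>\<D> = U"
    using open_countable_Union_open_cbox[OF U] by metis
  show ?thesis
  proof (rule measurable_piecewise_restrict[OF D(1)])
    show "X \<inter> space (restrict_space borel U) \<in> sets (restrict_space borel U)" if "X \<in> \<D>" for X
      using D(3)[OF that] D(2) that by (auto simp: sets_restrict_space space_restrict_space)
    show "space (restrict_space borel U) \<subseteq> \<Union>\<D>" using D(4) by (simp add: space_restrict_space)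
    fix X assume X: "X \<in> \<D>"
    obtain a b where ab: "X = cbox a b" using D(3)[OF X] by auto
    have "X \<subseteq> U" using D(2) X by auto
    with u[of X] have "set_borel_measurable borel X u" by (simp add: ab set_borel_measurable_def)
    then have "u \<in> borel_measurable (restrict_space borel X)"
      unfolding set_borel_measurable_def by (subst borel_measurable_restrict_space_iff) (auto simp: ab)
    then show "u \<in> borel_measurable (restrict_space (restrict_space borel U) X)"
      using \<open>X \<subseteq> U\<close> U by (simp add: restrict_restrict_space ab Int_absorb1 Int_absorb2)
  qed
qed

text \<open>The condition under which the choice of a chart in \<open>on_M\<close> is
  immaterial.\<close>

definition chart_invariant :: "('m, 'n) chart set \<Rightarrow> (('m, 'n) chart \<Rightarrow> real ^ 'n \<Rightarrow> 'b) \<Rightarrow> bool" where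
  "chart_invariant A F \<longleftrightarrow>
     (\<forall>c\<in>A. \<forall>d\<in>A. \<forall>x\<in>cdom c \<inter> cdom d. F c (cmap c x) = F d (cmap d x))"

text \<open>The transformation clause of \<open>riemannian_metric\<close>, isolated because the time
  derivative of the metric satisfies it without being positive.\<close>

definition tensor2_field :: "('m, 'n::finite) chart set \<Rightarrow> ('m, 'n) tensor2 \<Rightarrow> bool" where
  "tensor2_field A B \<longleftrightarrow>
     (\<forall>c\<in>A. \<forall>d\<in>A. \<forall>y\<in>overlap c d.
        B c y = transpose (jac c d y) ** B d (transition c d y) ** jac c d y)"

lemma riemannian_metric_det_pos:
  "riemannian_metric A g \<Longrightarrow> c \<in> A \<Longrightarrow> y \<in> cimg c \<Longrightarrow> 0 < det (g c y)"
  unfolding riemannian_metric_def by (metis det_positive_definite)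

lemma riemannian_metric_tensor2_field: "riemannian_metric A g \<Longrightarrow> tensor2_field A g"
  unfolding riemannian_metric_def tensor2_field_def by blast

section \<open>Charts and chart-independent expressions on a closed manifold\<close>

locale closed_manifold =
  fixes A :: "('m::t2_space, 'n::finite) chart set"
  assumes manifold: "closed_oriented_manifold A"
begin

lemma chart_open: "c \<in> A \<Longrightarrow> open (cdom c)" "c \<in> A \<Longrightarrow> open (cimg c)"
  using manifold unfolding closed_oriented_manifold_def by auto

lemma chart_homeomorphism: "c \<in> A \<Longrightarrow> homeomorphism (cdom c) (cimg c) (cmap c) (cinv c)"
  using manifold unfolding closed_oriented_manifold_def by auto

lemma continuous_on_cmap: "c \<in> A \<Longrightarrow> continuous_on (cdom c) (cmap c)"
  using chart_homeomorphism by (auto simp: homeomorphism_def)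

lemma continuous_on_cinv: "c \<in> A \<Longrightarrow> continuous_on (cimg c) (cinv c)"
  using chart_homeomorphism by (auto simp: homeomorphism_def)

lemma cmap_in_cimg: "x \<in> cdom c \<Longrightarrow> cmap c x \<in> cimg c"
  by (simp add: cimg_def)

lemma cinv_cmap: "c \<in> A \<Longrightarrow> x \<in> cdom c \<Longrightarrow> cinv c (cmap c x) = x"
  using chart_homeomorphism by (auto simp: homeomorphism_def)

lemma cmap_cinv: "c \<in> A \<Longrightarrow> y \<in> cimg c \<Longrightarrow> cmap c (cinv c y) = y"
  using chart_homeomorphism by (auto simp: homeomorphism_def)

lemma cinv_in_cdom: "c \<in> A \<Longrightarrow> y \<in> cimg c \<Longrightarrow> cinv c y \<in> cdom c"
  using chart_homeomorphism unfolding homeomorphism_def by blast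

lemma chart_at: obtains c where "c \<in> A" "x \<in> cdom c"
  using manifold unfolding closed_oriented_manifold_def by blast

lemma finite_chart_cover: obtains C where "finite C" "C \<subseteq> A" "(\<Union>c\<in>C. cdom c) = UNIV"
proof -
  have "compact (UNIV :: 'm set)" "UNIV \<subseteq> (\<Union>c\<in>A. cdom c)"
    using manifold unfolding closed_oriented_manifold_def by auto
  from compactE_image[OF this(1) _ this(2)] chart_open(1)
  obtain C where "C \<subseteq> A" "finite C" "UNIV \<subseteq> (\<Union>c\<in>C. cdom c)" by metis
  with that show ?thesis by blast
qed

lemma chart_invariantI:
  assumes "\<And>c d x. c \<in> A \<Longrightarrow> d \<in> A \<Longrightarrow> x \<in> cdom c \<Longrightarrow> x \<in> cdom d \<Longrightarrow> F c (cmap c x) = F d (cmap d x)"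
  shows "chart_invariant A F"
  unfolding chart_invariant_def by (intro ballI assms) simp_all

lemma chart_invariantD:
  assumes "chart_invariant A F" "c \<in> A" "d \<in> A" "x \<in> cdom c" "x \<in> cdom d"
  shows "F c (cmap c x) = F d (cmap d x)"
  by (rule assms(1)[unfolded chart_invariant_def, rule_format]) (use assms in simp_all)

lemma on_M_eq:
  assumes "chart_invariant A F" "c \<in> A" "x \<in> cdom c"
  shows "on_M A F x = F c (cmap c x)"
proof -
  define d where "d = (SOME d. d \<in> A \<and> x \<in> cdom d)"
  have "d \<in> A \<and> x \<in> cdom d"
    unfolding d_def by (rule someI[of _ c]) (use assms in simp)
  then have "F d (cmap d x) = F c (cmap c x)"
    by (intro chart_invariantD[OF assms(1)]) (use assms in auto)
  then show ?thesis by (simp add: on_M_def d_def[symmetric] Let_def)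
qed

lemma overlap_point:
  assumes "c \<in> A" "d \<in> A" "x \<in> cdom c" "x \<in> cdom d"
  shows "cmap c x \<in> overlap c d" "transition c d (cmap c x) = cmap d x"
    "0 < det (jac c d (cmap c x))"
proof -
  show *: "cmap c x \<in> overlap c d" using assms by (auto simp: overlap_def)
  show "transition c d (cmap c x) = cmap d x" using assms by (simp add: transition_def cinv_cmap)
  show "0 < det (jac c d (cmap c x))"
    using * assms manifold unfolding closed_oriented_manifold_def by blast
qed

lemma tensor2_fieldD:
  assumes B: "tensor2_field A B" and cd: "c \<in> A" "d \<in> A" "x \<in> cdom c" "x \<in> cdom d"
  defines "J \<equiv> jac c d (cmap c x)"
  shows "B c (cmap c x) = transpose J ** B d (cmap d x) ** J"
proof -
  have "\<forall>y\<in>overlap c d. B c y = transpose (jac c d y) ** B d (transition c d y) ** jac c d y"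
    using B cd(1,2) unfolding tensor2_field_def by blast
  from bspec[OF this overlap_point(1)[OF cd]] show ?thesis
    by (simp only: overlap_point(2)[OF cd] J_def)
qed

lemma covector_fieldD:
  assumes D: "covector_field A D" and cd: "c \<in> A" "d \<in> A" "x \<in> cdom c" "x \<in> cdom d"
  shows "D c (cmap c x) = transpose (jac c d (cmap c x)) *v D d (cmap d x)"
proof -
  have "\<forall>y\<in>overlap c d. D c y = transpose (jac c d y) *v D d (transition c d y)"
    using D cd(1,2) unfolding covector_field_def by blast
  from bspec[OF this overlap_point(1)[OF cd]] show ?thesis
    by (simp only: overlap_point(2)[OF cd])
qed

lemma chart_invariant_raised_form:
  assumes g: "riemannian_metric A g" and B: "tensor2_field A B"
    and D: "covector_field A D" and E: "covector_field A E"
  shows "chart_invariant A (\<lambda>c y. D c y \<bullet> ((matrix_inv (g c y) ** B c y ** matrix_inv (g c y)) *v E c y))"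
proof (rule chart_invariantI)
  fix c d x assume cd: "c \<in> A" "d \<in> A" "x \<in> cdom c" "x \<in> cdom d"
  note o = overlap_point[OF cd]
  let ?J = "jac c d (cmap c x)"
  have J: "det ?J \<noteq> 0" using o(3) by simp
  have M: "det (g d (cmap d x)) \<noteq> 0"
    using riemannian_metric_det_pos[OF g cd(2) cmap_in_cimg[OF cd(4)]] by simp
  note gB = tensor2_fieldD[OF riemannian_metric_tensor2_field[OF g] cd] tensor2_fieldD[OF B cd]
  show "D c (cmap c x) \<bullet> ((matrix_inv (g c (cmap c x)) ** B c (cmap c x) ** matrix_inv (g c (cmap c x))) *v E c (cmap c x))
      = D d (cmap d x) \<bullet> ((matrix_inv (g d (cmap d x)) ** B d (cmap d x) ** matrix_inv (g d (cmap d x))) *v E d (cmap d x))"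
    by (simp only: gB covector_fieldD[OF D cd] covector_fieldD[OF E cd] raised_form_congruence[OF J M])
qed

lemma chart_invariant_trace:
  assumes g: "riemannian_metric A g" and B: "tensor2_field A B"
  shows "chart_invariant A (\<lambda>c y. trace (matrix_inv (g c y) ** B c y))"
proof (rule chart_invariantI)
  fix c d x assume cd: "c \<in> A" "d \<in> A" "x \<in> cdom c" "x \<in> cdom d"
  note o = overlap_point[OF cd]
  let ?J = "jac c d (cmap c x)"
  have J: "det ?J \<noteq> 0" using o(3) by simp
  have M: "det (g d (cmap d x)) \<noteq> 0"
    using riemannian_metric_det_pos[OF g cd(2) cmap_in_cimg[OF cd(4)]] by simp
  note gB = tensor2_fieldD[OF riemannian_metric_tensor2_field[OF g] cd] tensor2_fieldD[OF B cd]
  show "trace (matrix_inv (g c (cmap c x)) ** B c (cmap c x))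
      = trace (matrix_inv (g d (cmap d x)) ** B d (cmap d x))"
    by (simp only: gB trace_congruence[OF J M])
qed

text \<open>The raised form with the metric itself as tensor, since g^-1 g g^-1 = g^-1.\<close>

lemma chart_invariant_inner:
  assumes g: "riemannian_metric A g" and D: "covector_field A D" and E: "covector_field A E"
  shows "chart_invariant A (\<lambda>c y. D c y \<bullet> (matrix_inv (g c y) *v E c y))"
proof (rule chart_invariantI)
  fix c d x assume cd: "c \<in> A" "d \<in> A" "x \<in> cdom c" "x \<in> cdom d"
  have "matrix_inv (g c' (cmap c' x)) ** g c' (cmap c' x) ** matrix_inv (g c' (cmap c' x)) = matrix_inv (g c' (cmap c' x))"
    if "c' \<in> A" "x \<in> cdom c'" for c'
    using riemannian_metric_det_pos[OF g that(1) cmap_in_cimg[OF that(2)]] by (simp add: matrix_inv_mult)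
  note this[OF cd(1,3)] this[OF cd(2,4)]
  with chart_invariantD[OF chart_invariant_raised_form[OF g riemannian_metric_tensor2_field[OF g] D E] cd]
  show "D c (cmap c x) \<bullet> (matrix_inv (g c (cmap c x)) *v E c (cmap c x))
      = D d (cmap d x) \<bullet> (matrix_inv (g d (cmap d x)) *v E d (cmap d x))"
    by (simp only:)
qed

lemma chart_invariant_cnorm:
  assumes "riemannian_metric A g" "covector_field A D"
  shows "chart_invariant A (cnorm g D)"
proof (rule chart_invariantI)
  fix c d x assume "c \<in> A" "d \<in> A" "x \<in> cdom c" "x \<in> cdom d"
  from chart_invariantD[OF chart_invariant_inner[OF assms assms(2)] this]
  show "cnorm g D c (cmap c x) = cnorm g D d (cmap d x)" by (simp only: cnorm_def)
qed

text \<open>Both determinants acquire the same factor, the square of the Jacobian determinant, and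
  it cancels in the quotient.\<close>

lemma chart_invariant_volume_ratio:
  assumes g: "riemannian_metric A g" and h: "riemannian_metric A h"
  shows "chart_invariant A (\<lambda>c y. sqrt (det (g c y)) / sqrt (det (h c y)))"
proof (rule chart_invariantI)
  fix c d x assume cd: "c \<in> A" "d \<in> A" "x \<in> cdom c" "x \<in> cdom d"
  note o = overlap_point[OF cd]
  let ?J = "jac c d (cmap c x)"
  note gh = g[THEN riemannian_metric_tensor2_field, THEN tensor2_fieldD, OF cd]
    h[THEN riemannian_metric_tensor2_field, THEN tensor2_fieldD, OF cd]
  show "sqrt (det (g c (cmap c x))) / sqrt (det (h c (cmap c x)))
      = sqrt (det (g d (cmap d x))) / sqrt (det (h d (cmap d x)))"
    unfolding gh using o(3) by (simp add: det_mul det_transpose real_sqrt_mult)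
qed

lemma borel_measurable_on_M:
  fixes F :: "('m, 'n) chart \<Rightarrow> real ^ 'n \<Rightarrow> real"
  assumes inv: "chart_invariant A F"
    and meas: "\<And>c. c \<in> A \<Longrightarrow> F c \<in> borel_measurable (restrict_space borel (cimg c))"
  shows "on_M A F \<in> borel_measurable borel"
proof -
  obtain C where C: "finite C" "C \<subseteq> A" "(\<Union>c\<in>C. cdom c) = UNIV" by (rule finite_chart_cover)
  show ?thesis
  proof (rule measurable_piecewise_restrict[of "cdom ` C"])
    show "countable (cdom ` C)" using C(1) by (simp add: countable_finite)
    show "X \<inter> space borel \<in> sets borel" if "X \<in> cdom ` C" for X
      using that C(2) chart_open(1) by auto
    show "space borel \<subseteq> \<Union> (cdom ` C)" using C(3) by simp
    fix X assume "X \<in> cdom ` C"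
    then obtain c where c: "c \<in> A" "X = cdom c" using C(2) by auto
    have "cmap c \<in> measurable (restrict_space borel (cdom c)) (restrict_space borel (cimg c))"
      by (rule measurable_restrict_space2)
        (auto simp: space_restrict_space cmap_in_cimg
          intro: borel_measurable_continuous_on_restrict continuous_on_cmap c(1))
    from measurable_compose[OF this meas[OF c(1)]]
    have "(\<lambda>x. F c (cmap c x)) \<in> borel_measurable (restrict_space borel (cdom c))" .
    then show "on_M A F \<in> borel_measurable (restrict_space borel X)"
      unfolding c(2)
      by (subst measurable_cong[of _ _ "\<lambda>x. F c (cmap c x)"])
        (auto simp: space_restrict_space on_M_eq[OF inv c(1)])
  qed
qed

text \<open>Passage from local to global bounds by compactness. It is phrased for a predicate
  increasing in the bound, so that several quantities, read in a chart depending on the point, can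
  be bounded at once; the sum of the local bounds over a finite subcover serves everywhere.\<close>

lemma chart_bound:
  fixes P :: "'m \<Rightarrow> real \<Rightarrow> bool"
  assumes mono: "\<And>x L L'. P x L \<Longrightarrow> L \<le> L' \<Longrightarrow> P x L'"
    and loc: "\<And>c K. c \<in> A \<Longrightarrow> compact K \<Longrightarrow> K \<subseteq> cimg c \<Longrightarrow> \<exists>L. \<forall>y\<in>K. P (cinv c y) L"
  shows "\<exists>L\<ge>0. \<forall>x. P x L"
proof -
  have "\<exists>U L. open U \<and> x \<in> U \<and> (\<forall>z\<in>U. P z L)" for x
  proof -
    obtain c where c: "c \<in> A" "x \<in> cdom c" by (rule chart_at)
    obtain r where r: "0 < r" "cball (cmap c x) r \<subseteq> cimg c"
      using chart_open(2)[OF c(1)] cmap_in_cimg[OF c(2)] open_contains_cball by blast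
    obtain L where L: "\<forall>y\<in>cball (cmap c x) r. P (cinv c y) L"
      using loc[OF c(1) compact_cball r(2)] by blast
    have "open (cmap c -` ball (cmap c x) r \<inter> cdom c)"
      using continuous_on_cmap[OF c(1)] chart_open(1)[OF c(1)] open_ball
      by (simp add: continuous_on_open_vimage)
    moreover have "x \<in> cmap c -` ball (cmap c x) r \<inter> cdom c" using c r by simp
    moreover have "P z L" if "z \<in> cmap c -` ball (cmap c x) r \<inter> cdom c" for z
    proof -
      have "cmap c z \<in> cball (cmap c x) r" using that by auto
      with L have "P (cinv c (cmap c z)) L" by blast
      with that c(1) show ?thesis by (simp add: cinv_cmap)
    qed
    ultimately show ?thesis by blast
  qed
  then obtain U L where U: "\<And>x. open (U x)" "\<And>x. x \<in> U x" "\<And>x z. z \<in> U x \<Longrightarrow> P z (L x)"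
    by metis
  have "compact (UNIV :: 'm set)" using manifold unfolding closed_oriented_manifold_def by auto
  moreover have "UNIV \<subseteq> (\<Union>x\<in>UNIV. U x)" using U(2) by blast
  ultimately obtain X where X: "finite X" "UNIV \<subseteq> (\<Union>x\<in>X. U x)"
    using compactE_image[of "UNIV :: 'm set" UNIV U] U(1) by metis
  have "P z (\<Sum>x\<in>X. \<bar>L x\<bar>)" for z
  proof -
    obtain x where x: "x \<in> X" "z \<in> U x" using X(2) by blast
    have "L x \<le> \<bar>L x\<bar>" by simp
    also have "\<dots> \<le> (\<Sum>x\<in>X. \<bar>L x\<bar>)" using X(1) x(1) by (intro member_le_sum) auto
    finally show ?thesis using mono U(3)[OF x(2)] by blast
  qed
  moreover have "0 \<le> (\<Sum>x\<in>X. \<bar>L x\<bar>)" by (intro sum_nonneg) simp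
  ultimately show ?thesis by blast
qed

end

text \<open>\<open>diff\<close> is a choice among weak differentials and so need not be linear in
  the function. Differentials are therefore combined pointwise, within a class closed under linear
  combinations.\<close>

definition measurable_covector :: "('m, 'n::finite) chart set \<Rightarrow> ('m, 'n) covector \<Rightarrow> bool" where
  "measurable_covector A D \<longleftrightarrow> covector_field A D \<and>
     (\<forall>c\<in>A. \<forall>i. (\<lambda>y. D c y $ i) \<in> borel_measurable (restrict_space borel (cimg c)))"

lemma measurable_covectorD:
  assumes "measurable_covector A D"
  shows "covector_field A D"
    "c \<in> A \<Longrightarrow> (\<lambda>y. D c y $ i) \<in> borel_measurable (restrict_space borel (cimg c))"
  using assms by (simp_all add: measurable_covector_def)

lemma measurable_covector_linear:
  assumes D: "measurable_covector A D" and E: "measurable_covector A E"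
  shows "measurable_covector A (\<lambda>c y. a *\<^sub>R D c y + b *\<^sub>R E c y)"
  unfolding measurable_covector_def
proof (intro conjI ballI allI)
  show "covector_field A (\<lambda>c y. a *\<^sub>R D c y + b *\<^sub>R E c y)"
    unfolding covector_field_def
  proof (intro ballI)
    fix c d y assume cd: "c \<in> A" "d \<in> A" "y \<in> overlap c d"
    have "D c y = transpose (jac c d y) *v D d (transition c d y)"
      "E c y = transpose (jac c d y) *v E d (transition c d y)"
      using measurable_covectorD(1)[OF D] measurable_covectorD(1)[OF E] cd
      unfolding covector_field_def by blast+
    then show "a *\<^sub>R D c y + b *\<^sub>R E c y
        = transpose (jac c d y) *v (a *\<^sub>R D d (transition c d y) + b *\<^sub>R E d (transition c d y))"
      by (simp only: matrix_vector_right_distrib matrix_vector_mult_scaleR)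
  qed
  fix c i assume c: "c \<in> A"
  note [measurable] = measurable_covectorD(2)[OF D c] measurable_covectorD(2)[OF E c]
  show "(\<lambda>y. (a *\<^sub>R D c y + b *\<^sub>R E c y) $ i) \<in> borel_measurable (restrict_space borel (cimg c))"
    by simp
qed

section \<open>Measurability of invariant expressions, and integration in charts\<close>

context closed_manifold
begin

lemma measurable_covector_weak_differential:
  assumes "weak_differential A f D"
  shows "measurable_covector A D"
  unfolding measurable_covector_def
proof (intro conjI ballI allI)
  show "covector_field A D" using assms by (simp add: weak_differential_def)
  fix c i assume c: "c \<in> A"
  have loc: "locally_integrable (cimg c) (\<lambda>y. D c y $ i)"
    using assms c unfolding weak_differential_def by blast
  show "(\<lambda>y. D c y $ i) \<in> borel_measurable (restrict_space borel (cimg c))"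
  proof (rule borel_measurable_open_of_compacts[OF chart_open(2)[OF c]])
    fix K assume "compact K" "K \<subseteq> cimg c"
    with loc have "set_integrable lborel K (\<lambda>y. D c y $ i)" unfolding locally_integrable_def by blast
    then show "set_borel_measurable lborel K (\<lambda>y. D c y $ i)"
      unfolding set_integrable_def set_borel_measurable_def by (rule borel_measurable_integrable)
  qed
qed

lemma measurable_covector_diff:
  assumes "f \<in> W1p A g \<nu> p"
  shows "measurable_covector A (diff A f)"
proof -
  have "\<exists>D. weak_differential A f D" using assms by (simp add: W1p_def)
  then have "weak_differential A f (diff A f)" unfolding diff_def by (rule someI_ex)
  then show ?thesis by (rule measurable_covector_weak_differential)
qed

lemma continuous_on_metric:
  "riemannian_metric A g \<Longrightarrow> c \<in> A \<Longrightarrow> continuous_on (cimg c) (\<lambda>y. g c y $ i $ j)"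
  unfolding riemannian_metric_def by (blast intro: smooth_on_imp_continuous_on)

lemma continuous_on_metric_inv:
  assumes "riemannian_metric A g" "c \<in> A"
  shows "continuous_on (cimg c) (\<lambda>y. matrix_inv (g c y) $ i $ j)"
  using riemannian_metric_det_pos[OF assms]
  by (intro continuous_on_matrix_inv continuous_on_metric assms) force

lemma borel_measurable_form:
  fixes M :: "real ^ 'n \<Rightarrow> real ^ 'n ^ 'n"
  assumes c: "c \<in> A" and D: "measurable_covector A D" and E: "measurable_covector A E"
    and M: "\<And>i j. continuous_on (cimg c) (\<lambda>y. M y $ i $ j)"
  shows "(\<lambda>y. D c y \<bullet> (M y *v E c y)) \<in> borel_measurable (restrict_space borel (cimg c))"
proof -
  note [measurable] = measurable_covectorD(2)[OF D c] measurable_covectorD(2)[OF E c]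
    borel_measurable_continuous_on_restrict[OF M]
  show ?thesis unfolding inner_matrix_vector_sum by measurable
qed

lemma borel_measurable_on_M_inner:
  assumes g: "riemannian_metric A g" and D: "measurable_covector A D" and E: "measurable_covector A E"
  shows "on_M A (\<lambda>c y. D c y \<bullet> (matrix_inv (g c y) *v E c y)) \<in> borel_measurable borel"
  by (intro borel_measurable_on_M chart_invariant_inner borel_measurable_form
      continuous_on_metric_inv measurable_covectorD(1) g D E)

lemma borel_measurable_on_M_cnorm:
  assumes g: "riemannian_metric A g" and D: "measurable_covector A D"
  shows "on_M A (cnorm g D) \<in> borel_measurable borel"
proof (rule borel_measurable_on_M[OF chart_invariant_cnorm[OF g measurable_covectorD(1)[OF D]]])
  fix c assume c: "c \<in> A"
  note [measurable] = borel_measurable_form[OF c D D continuous_on_metric_inv[OF g c]]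
  show "cnorm g D c \<in> borel_measurable (restrict_space borel (cimg c))"
    unfolding cnorm_def[abs_def] by measurable
qed

lemma borel_measurable_on_M_raised_form:
  assumes g: "riemannian_metric A g" and B: "tensor2_field A B"
    and contB: "\<And>c i j. c \<in> A \<Longrightarrow> continuous_on (cimg c) (\<lambda>y. B c y $ i $ j)"
    and D: "measurable_covector A D" and E: "measurable_covector A E"
  shows "on_M A (\<lambda>c y. D c y \<bullet> ((matrix_inv (g c y) ** B c y ** matrix_inv (g c y)) *v E c y))
    \<in> borel_measurable borel"
proof (rule borel_measurable_on_M)
  show "chart_invariant A (\<lambda>c y. D c y \<bullet> ((matrix_inv (g c y) ** B c y ** matrix_inv (g c y)) *v E c y))"
    by (intro chart_invariant_raised_form measurable_covectorD(1) g B D E)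
  fix c assume c: "c \<in> A"
  have "continuous_on (cimg c) (\<lambda>y. (matrix_inv (g c y) ** B c y ** matrix_inv (g c y)) $ i $ j)" for i j
    unfolding matrix_matrix_mult_def
    by (simp, intro continuous_intros continuous_on_metric_inv[OF g c] contB[OF c])
  from borel_measurable_form[OF c D E this]
  show "(\<lambda>y. D c y \<bullet> ((matrix_inv (g c y) ** B c y ** matrix_inv (g c y)) *v E c y))
      \<in> borel_measurable (restrict_space borel (cimg c))" .
qed

lemma borel_measurable_on_M_trace:
  assumes g: "riemannian_metric A g" and B: "tensor2_field A B"
    and contB: "\<And>c i j. c \<in> A \<Longrightarrow> continuous_on (cimg c) (\<lambda>y. B c y $ i $ j)"
  shows "on_M A (\<lambda>c y. trace (matrix_inv (g c y) ** B c y)) \<in> borel_measurable borel"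
proof (rule borel_measurable_on_M[OF chart_invariant_trace[OF g B] borel_measurable_continuous_on_restrict])
  fix c assume c: "c \<in> A"
  show "continuous_on (cimg c) (\<lambda>y. trace (matrix_inv (g c y) ** B c y))"
    unfolding matrix_matrix_mult_def trace_def
    by (simp, intro continuous_intros continuous_on_metric_inv[OF g c] contB[OF c])
qed

lemma borel_measurable_on_M_volume_ratio:
  assumes g: "riemannian_metric A g" and h: "riemannian_metric A h"
  shows "on_M A (\<lambda>c y. sqrt (det (g c y)) / sqrt (det (h c y))) \<in> borel_measurable borel"
proof (rule borel_measurable_on_M[OF chart_invariant_volume_ratio[OF g h] borel_measurable_continuous_on_restrict])
  fix c assume c: "c \<in> A"
  have "sqrt (det (h c y)) \<noteq> 0" if "y \<in> cimg c" for y
    using riemannian_metric_det_pos[OF h c that] by simp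
  then show "continuous_on (cimg c) (\<lambda>y. sqrt (det (g c y)) / sqrt (det (h c y)))"
    by (intro continuous_intros continuous_on_det continuous_on_metric g h c) auto
qed

lemma borel_measurable_of_charts:
  fixes u :: "'m \<Rightarrow> real"
  assumes "\<And>c. c \<in> A \<Longrightarrow> continuous_on (cimg c) (u \<circ> cinv c)"
  shows "u \<in> borel_measurable borel"
proof -
  have inv: "chart_invariant A (\<lambda>c. u \<circ> cinv c)"
    by (rule chart_invariantI) (simp add: cinv_cmap)
  have "on_M A (\<lambda>c. u \<circ> cinv c) x = u x" for x
    using chart_at[of x] on_M_eq[OF inv] by (metis cinv_cmap comp_apply)
  then have "on_M A (\<lambda>c. u \<circ> cinv c) = u" by blast
  with borel_measurable_on_M[OF inv borel_measurable_continuous_on_restrict[OF assms]]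
  show ?thesis by simp
qed

text \<open>\<open>riemannian_volume\<close> prescribes only the measure of Borel sets inside one
  chart domain. This determines the restriction of the measure to the domain as the image, under the
  inverse chart, of a density of Lebesgue measure; the integral formula follows.\<close>

lemma nn_integral_chart:
  assumes g: "riemannian_metric A g" and \<nu>: "riemannian_volume A g \<nu>" and c: "c \<in> A"
    and u: "u \<in> borel_measurable borel"
  shows "(\<integral>\<^sup>+ x\<in>cdom c. u x \<partial>\<nu>) = (\<integral>\<^sup>+ y\<in>cimg c. u (cinv c y) * ennreal (sqrt (det (g c y))) \<partial>lborel)"
proof -
  have sets: "sets \<nu> = sets borel" using \<nu> by (simp add: riemannian_volume_def)
  have space: "space \<nu> = UNIV" using sets_eq_imp_space_eq[OF sets] by simp
  have [measurable]: "cdom c \<in> sets borel" "cimg c \<in> sets borel" using chart_open[OF c] by auto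
  obtain x\<^sub>0 where x0: "x\<^sub>0 = (undefined :: 'm)" by blast
  \<comment> \<open>A push-forward needs a total Borel map. The value outside the image is
    arbitrary, as the density \<open>w\<close> vanishes there.\<close>
  define \<psi> where "\<psi> y = (if y \<in> cimg c then cinv c y else x\<^sub>0)" for y
  define w where "w y = (if y \<in> cimg c then ennreal (sqrt (det (g c y))) else 0)" for y
  have [measurable]: "\<psi> \<in> measurable borel borel"
    unfolding \<psi>_def
    by (subst measurable_If_restrict_space_iff)
      (auto intro: borel_measurable_continuous_on_restrict continuous_on_cinv c)
  have "(\<lambda>y. sqrt (det (g c y))) \<in> borel_measurable (restrict_space borel (cimg c))"
    by (intro borel_measurable_continuous_on_restrict continuous_intros continuous_on_det
        continuous_on_metric g c)
  then have [measurable]: "w \<in> borel_measurable borel"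
    unfolding w_def
    by (subst measurable_If_restrict_space_iff) auto
  have eq: "density \<nu> (indicator (cdom c)) = distr (density lborel w) borel \<psi>"
  proof (rule measure_eqI)
    show "sets (density \<nu> (indicator (cdom c))) = sets (distr (density lborel w) borel \<psi>)"
      by (simp add: sets)
    fix B assume "B \<in> sets (density \<nu> (indicator (cdom c)))"
    then have B [measurable]: "B \<in> sets borel" by (simp add: sets)
    have "emeasure (density \<nu> (indicator (cdom c))) B = (\<integral>\<^sup>+ x. indicator (cdom c) x * indicator B x \<partial>\<nu>)"
      using B by (intro emeasure_density) (simp_all add: measurable_cong_sets[OF sets refl] sets)
    also have "\<dots> = (\<integral>\<^sup>+ x. indicator (cdom c \<inter> B) x \<partial>\<nu>)"
      by (simp add: indicator_inter_arith)
    also have "\<dots> = emeasure \<nu> (cdom c \<inter> B)"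
      using B by (intro nn_integral_indicator) (simp add: sets)
    also have "\<dots> = (\<integral>\<^sup>+ y\<in>cmap c ` (cdom c \<inter> B). ennreal (sqrt (det (g c y))) \<partial>lborel)"
      using \<nu> c B unfolding riemannian_volume_def by auto
    also have "\<dots> = (\<integral>\<^sup>+ y. w y * indicator (\<psi> -` B) y \<partial>lborel)"
    proof (rule nn_integral_cong)
      fix y
      have "y \<in> cmap c ` (cdom c \<inter> B) \<longleftrightarrow> y \<in> cimg c \<and> \<psi> y \<in> B"
      proof
        assume "y \<in> cmap c ` (cdom c \<inter> B)"
        then obtain x where "x \<in> cdom c" "x \<in> B" "y = cmap c x" by blast
        then show "y \<in> cimg c \<and> \<psi> y \<in> B" by (simp add: \<psi>_def cmap_in_cimg cinv_cmap[OF c])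
      next
        assume "y \<in> cimg c \<and> \<psi> y \<in> B"
        then have y: "y \<in> cimg c" "cinv c y \<in> B" by (simp_all add: \<psi>_def split: if_splits)
        show "y \<in> cmap c ` (cdom c \<inter> B)"
          by (rule image_eqI[of _ _ "cinv c y"]) (use y c in \<open>simp_all add: cmap_cinv cinv_in_cdom\<close>)
      qed
      then show "ennreal (sqrt (det (g c y))) * indicator (cmap c ` (cdom c \<inter> B)) y = w y * indicator (\<psi> -` B) y"
        by (auto simp: w_def indicator_def)
    qed
    also have "\<dots> = emeasure (distr (density lborel w) borel \<psi>) B"
    proof -
      have "\<psi> -` B \<in> sets borel" by (rule measurable_sets_borel) measurable
      then have "emeasure (density lborel w) (\<psi> -` B) = (\<integral>\<^sup>+ y. w y * indicator (\<psi> -` B) y \<partial>lborel)"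
        by (intro emeasure_density) simp_all
      then show ?thesis by (simp add: emeasure_distr)
    qed
    finally show "emeasure (density \<nu> (indicator (cdom c))) B = emeasure (distr (density lborel w) borel \<psi>) B" .
  qed
  note [measurable] = u
  have u\<nu>: "u \<in> borel_measurable \<nu>" "indicator (cdom c) \<in> borel_measurable \<nu>"
    using u by (simp_all add: measurable_cong_sets[OF sets refl])
  have "(\<integral>\<^sup>+ x\<in>cdom c. u x \<partial>\<nu>) = (\<integral>\<^sup>+ x. u x \<partial>density \<nu> (indicator (cdom c)))"
    using u\<nu> by (subst nn_integral_density) (auto simp: mult.commute)
  also have "\<dots> = (\<integral>\<^sup>+ y. w y * u (\<psi> y) \<partial>lborel)"
    unfolding eq by (simp add: nn_integral_distr nn_integral_density)
  also have "\<dots> = (\<integral>\<^sup>+ y\<in>cimg c. u (cinv c y) * ennreal (sqrt (det (g c y))) \<partial>lborel)"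
    by (intro nn_integral_cong) (auto simp: w_def \<psi>_def mult.commute)
  finally show ?thesis .
qed

text \<open>Inside one chart the ratio converts the density of \<open>h\<close> into that of
  \<open>g\<close>. Finitely many charts cover the manifold, and additivity extends the equality to
  all Borel sets. This allows the measures of all times to be replaced by one.\<close>

lemma riemannian_volume_density:
  assumes g: "riemannian_metric A g" and \<nu>: "riemannian_volume A g \<nu>"
    and h: "riemannian_metric A h" and \<nu>': "riemannian_volume A h \<nu>'"
  shows "\<nu> = density \<nu>' (\<lambda>x. ennreal (on_M A (\<lambda>c y. sqrt (det (g c y)) / sqrt (det (h c y))) x))"
    (is "_ = density \<nu>' ?r")
proof -
  have sets: "sets \<nu> = sets borel" "sets \<nu>' = sets borel"
    using \<nu> \<nu>' by (simp_all add: riemannian_volume_def)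
  have r [measurable]: "?r \<in> borel_measurable borel"
    using borel_measurable_on_M_volume_ratio[OF g h] by simp
  have r': "?r \<in> borel_measurable \<nu>'"
    using r by (simp add: measurable_cong_sets[OF sets(2) refl])
  have local: "emeasure \<nu> B = emeasure (density \<nu>' ?r) B"
    if c: "c \<in> A" and B [measurable]: "B \<in> sets borel" "B \<subseteq> cdom c" for B c
  proof -
    have "emeasure \<nu> B = (\<integral>\<^sup>+ x. indicator B x \<partial>\<nu>)"
      using B by (simp add: sets)
    also have "\<dots> = (\<integral>\<^sup>+ x\<in>cdom c. indicator B x \<partial>\<nu>)"
      using B(2) by (intro nn_integral_cong) (auto split: split_indicator)
    also have "\<dots> = (\<integral>\<^sup>+ y\<in>cimg c. indicator B (cinv c y) * ennreal (sqrt (det (g c y))) \<partial>lborel)"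
      using B by (intro nn_integral_chart g \<nu> c) auto
    also have "\<dots> = (\<integral>\<^sup>+ y\<in>cimg c. (?r (cinv c y) * indicator B (cinv c y)) * ennreal (sqrt (det (h c y))) \<partial>lborel)"
    proof (intro nn_integral_cong)
      fix y
      have "ennreal (sqrt (det (g c y))) = ?r (cinv c y) * ennreal (sqrt (det (h c y)))" if y: "y \<in> cimg c"
      proof -
        have "?r (cinv c y) = ennreal (sqrt (det (g c y)) / sqrt (det (h c y)))"
          using on_M_eq[OF chart_invariant_volume_ratio[OF g h] c cinv_in_cdom[OF c y]]
          by (simp add: cmap_cinv[OF c y])
        moreover have "0 < det (g c y)" "0 < det (h c y)"
          using riemannian_metric_det_pos g h c y by blast+
        ultimately show ?thesis by (simp add: ennreal_mult[symmetric])
      qed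
      then show "indicator B (cinv c y) * ennreal (sqrt (det (g c y))) * indicator (cimg c) y
          = ?r (cinv c y) * indicator B (cinv c y) * ennreal (sqrt (det (h c y))) * indicator (cimg c) y"
        by (auto simp: indicator_def)
    qed
    also have "\<dots> = (\<integral>\<^sup>+ x\<in>cdom c. ?r x * indicator B x \<partial>\<nu>')"
      using B by (intro nn_integral_chart[symmetric] h \<nu>' c) measurable
    also have "\<dots> = emeasure (density \<nu>' ?r) B"
      using B r' by (subst emeasure_density) (auto simp: sets indicator_def intro!: nn_integral_cong)
    finally show ?thesis .
  qed
  obtain C where C: "finite C" "C \<subseteq> A" "(\<Union>c\<in>C. cdom c) = UNIV" by (rule finite_chart_cover)
  \<comment> \<open>Induction on the number of charts: the part of \<open>B\<close> in the new
    domain is handled locally, the rest is covered by the remaining charts.\<close>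
  have glue: "emeasure \<nu> B = emeasure (density \<nu>' ?r) B" if "B \<in> sets borel" "B \<subseteq> (\<Union>c\<in>C'. cdom c)" "C' \<subseteq> C" for C' B
    using finite_subset[OF that(3) C(1)] that
  proof (induction C' arbitrary: B rule: finite_induct)
    case empty
    then show ?case by simp
  next
    case (insert c C')
    have c: "c \<in> A" using insert.prems(3) C(2) by auto
    have cd: "cdom c \<in> sets borel" using chart_open(1)[OF c] by simp
    let ?B1 = "B \<inter> cdom c" and ?B2 = "B - cdom c"
    have meas: "?B1 \<in> sets borel" "?B2 \<in> sets borel" using insert.prems(1) cd by auto
    have B2: "emeasure \<nu> ?B2 = emeasure (density \<nu>' ?r) ?B2"
      using insert.prems by (intro insert.IH meas) auto
    have B1: "emeasure \<nu> ?B1 = emeasure (density \<nu>' ?r) ?B1"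
      by (intro local[OF c] meas) auto
    have add: "emeasure N ?B1 + emeasure N ?B2 = emeasure N B" if "sets N = sets borel" for N :: "'m measure"
    proof -
      have "?B1 \<union> ?B2 = B" by blast
      then show ?thesis using plus_emeasure[of ?B1 N ?B2] meas that by auto
    qed
    have "sets (density \<nu>' ?r) = sets borel" by (simp add: sets)
    from add[OF sets(1)] add[OF this] show ?case unfolding B1 B2 by (rule subst)
  qed
  show ?thesis
    by (rule measure_eqI) (use glue[of _ C] C(3) sets in auto)
qed

end

section \<open>Pointwise norms of covector fields and the weak p-Laplacian\<close>

lemma riemannian_metric_positive_form:
  "riemannian_metric A g \<Longrightarrow> c \<in> A \<Longrightarrow> y \<in> cimg c \<Longrightarrow> positive_form (g c y)"
  unfolding riemannian_metric_def by unfold_locales blast+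

lemmas riemannian_metric_inv_positive_form =
  positive_form_matrix_inv[OF riemannian_metric_positive_form]

context closed_manifold
begin

lemma on_M_cnorm_eq:
  assumes "riemannian_metric A h" "covector_field A D" "c \<in> A" "x \<in> cdom c"
  shows "on_M A (cnorm h D) x = form_norm (matrix_inv (h c (cmap c x))) (D c (cmap c x))"
  unfolding on_M_eq[OF chart_invariant_cnorm[OF assms(1,2)] assms(3,4)] cnorm_eq_form_norm ..

lemma on_M_cnorm_nonneg:
  assumes "riemannian_metric A h" "covector_field A D"
  shows "0 \<le> on_M A (cnorm h D) x"
proof -
  obtain c where c: "c \<in> A" "x \<in> cdom c" by (rule chart_at)
  show ?thesis unfolding on_M_cnorm_eq[OF assms c]
    by (rule positive_form.form_norm_nonneg
        [OF riemannian_metric_inv_positive_form[OF assms(1) c(1) cmap_in_cimg[OF c(2)]]])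
qed

lemma on_M_inner_self:
  assumes "riemannian_metric A h" "covector_field A D"
  shows "on_M A (\<lambda>c y. D c y \<bullet> (matrix_inv (h c y) *v D c y)) x = (on_M A (cnorm h D) x)\<^sup>2"
proof -
  obtain c where c: "c \<in> A" "x \<in> cdom c" by (rule chart_at)
  show ?thesis
    unfolding on_M_cnorm_eq[OF assms c] on_M_eq[OF chart_invariant_inner[OF assms assms(2)] c]
      positive_form.form_norm_power2[OF riemannian_metric_inv_positive_form[OF assms(1) c(1) cmap_in_cimg[OF c(2)]]] ..
qed

lemma on_M_inner_le:
  assumes "riemannian_metric A h" "covector_field A D" "covector_field A E"
  shows "\<bar>on_M A (\<lambda>c y. D c y \<bullet> (matrix_inv (h c y) *v E c y)) x\<bar> \<le> on_M A (cnorm h D) x * on_M A (cnorm h E) x"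
proof -
  obtain c where c: "c \<in> A" "x \<in> cdom c" by (rule chart_at)
  show ?thesis
    unfolding on_M_cnorm_eq[OF assms(1,2) c] on_M_cnorm_eq[OF assms(1,3) c] on_M_eq[OF chart_invariant_inner[OF assms] c]
    by (rule positive_form.form_norm_Cauchy_Schwarz
        [OF riemannian_metric_inv_positive_form[OF assms(1) c(1) cmap_in_cimg[OF c(2)]]])
qed

lemma on_M_cnorm_linear_le:
  assumes h: "riemannian_metric A h" and D: "measurable_covector A D" "measurable_covector A E"
  shows "on_M A (cnorm h (\<lambda>c y. a *\<^sub>R D c y + b *\<^sub>R E c y)) x
    \<le> \<bar>a\<bar> * on_M A (cnorm h D) x + \<bar>b\<bar> * on_M A (cnorm h E) x"
proof -
  obtain c where c: "c \<in> A" "x \<in> cdom c" by (rule chart_at)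
  note E = measurable_covectorD(1)[OF measurable_covector_linear[OF D, of a b]]
  show ?thesis
    unfolding on_M_cnorm_eq[OF h E c] on_M_cnorm_eq[OF h measurable_covectorD(1)[OF D(1)] c]
      on_M_cnorm_eq[OF h measurable_covectorD(1)[OF D(2)] c]
    by (rule positive_form.form_norm_linear_le
        [OF riemannian_metric_inv_positive_form[OF h c(1) cmap_in_cimg[OF c(2)]]])
qed

lemma integrable_cnorm_linear:
  assumes h: "riemannian_metric A h" and D: "measurable_covector A D" "measurable_covector A E"
    and p: "0 \<le> p" and M: "sets M = sets borel"
    and int: "integrable M (\<lambda>x. on_M A (cnorm h D) x powr p)" "integrable M (\<lambda>x. on_M A (cnorm h E) x powr p)"
  shows "integrable M (\<lambda>x. on_M A (cnorm h (\<lambda>c y. a *\<^sub>R D c y + b *\<^sub>R E c y)) x powr p)"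
proof (rule integrable_powr_linear[OF p int])
  note E = measurable_covector_linear[OF D, of a b]
  show "on_M A (cnorm h (\<lambda>c y. a *\<^sub>R D c y + b *\<^sub>R E c y)) \<in> borel_measurable M"
    using borel_measurable_on_M_cnorm[OF h E] by (simp only: measurable_cong_sets[OF M refl])
  show "on_M A (cnorm h (\<lambda>c y. a *\<^sub>R D c y + b *\<^sub>R E c y)) x
      \<le> \<bar>a\<bar> * on_M A (cnorm h D) x + \<bar>b\<bar> * on_M A (cnorm h E) x" for x
    by (rule on_M_cnorm_linear_le[OF h D])
qed (intro on_M_cnorm_nonneg h D measurable_covectorD(1) measurable_covector_linear)+

text \<open>In every chart the integrand evaluates to the same expression in functions on the
  manifold, which shows its chart-independence and its value together.\<close>

lemma p_laplacian_eq:
  assumes h: "riemannian_metric A h" and D: "measurable_covector A (diff A u)" "measurable_covector A (diff A \<psi>)"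
  shows "- p_laplacian A h \<nu> \<theta> p u \<psi> = (\<integral>x. exp (- \<theta> x) * (grad_norm A h u x powr (p - 2)
    * on_M A (\<lambda>c y. diff A \<psi> c y \<bullet> (matrix_inv (h c y) *v diff A u c y)) x) \<partial>\<nu>)"
proof -
  let ?F = "\<lambda>c y. diff A \<psi> c y \<bullet> ((exp (- \<theta> (cinv c y)) * cnorm h (diff A u) c y powr (p - 2)) *\<^sub>R grad A h u c y)"
  let ?I = "\<lambda>c y. diff A \<psi> c y \<bullet> (matrix_inv (h c y) *v diff A u c y)"
  note inv = chart_invariant_inner[OF h D(2,1)[THEN measurable_covectorD(1)]]
    chart_invariant_cnorm[OF h D(1)[THEN measurable_covectorD(1)]]
  have F: "?F c (cmap c x) = exp (- \<theta> x) * (grad_norm A h u x powr (p - 2) * on_M A ?I x)"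
    if "c \<in> A" "x \<in> cdom c" for c x
    unfolding grad_norm_def on_M_eq[OF inv(1) that] on_M_eq[OF inv(2) that] cinv_cmap[OF that] grad_def
    by simp
  have inv_F: "chart_invariant A ?F"
  proof (rule chart_invariantI)
    fix c d x assume cd: "c \<in> A" "d \<in> A" "x \<in> cdom c" "x \<in> cdom d"
    show "?F c (cmap c x) = ?F d (cmap d x)" unfolding F[OF cd(1,3)] F[OF cd(2,4)] ..
  qed
  have "on_M A ?F x = exp (- \<theta> x) * (grad_norm A h u x powr (p - 2) * on_M A ?I x)" for x
  proof -
    obtain c where c: "c \<in> A" "x \<in> cdom c" by (rule chart_at)
    show ?thesis unfolding on_M_eq[OF inv_F c] F[OF c] ..
  qed
  then show ?thesis by (simp add: p_laplacian_def weak_div_def)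
qed

end

section \<open>The flow\<close>

locale curvature_flow = closed_manifold A
  for A :: "('m::t2_space, 'n::finite) chart set" +
  fixes \<rho> T :: real and g :: "real \<Rightarrow> ('m, 'n) tensor2" and \<phi> :: "real \<Rightarrow> 'm \<Rightarrow> real"
    and g\<^sub>0 :: "('m, 'n) tensor2" and \<phi>\<^sub>0 :: "'m \<Rightarrow> real"
  assumes flow: "flow_solution A \<rho> T g\<^sub>0 \<phi>\<^sub>0 g \<phi>"
    and \<rho>: "\<rho> * real CARD('n) \<noteq> 1"
begin

text \<open>
  The time derivative of the metric. Curvature is accessed only through this tensor: it inherits the
  transformation law of \<open>g\<close>, and since \<open>\<rho> n \<noteq> 1\<close> its trace \<open>(2 \<rho> n - 2) R\<close> determines \<open>R\<close>, and then
  \<open>Ric\<close>. Hence \<open>R\<close> and \<open>Ric\<close> do not depend on the chart, with no computation of Christoffel symbols.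
\<close>

definition gd :: "real \<Rightarrow> ('m, 'n) tensor2" where
  "gd t c y = (- 2) *\<^sub>R ricci (g t c) y + (2 * \<rho> * scalar_curv (g t c) y) *\<^sub>R g t c y"

lemma metric: "t \<in> {0..<T} \<Longrightarrow> riemannian_metric A (g t)"
  using flow unfolding flow_solution_def by blast

lemma metric_has_derivative:
  "t \<in> {0..<T} \<Longrightarrow> c \<in> A \<Longrightarrow> y \<in> cimg c \<Longrightarrow>
    ((\<lambda>s. g s c y) has_vector_derivative gd t c y) (at t within {0..<T})"
  using flow unfolding flow_solution_def gd_def by blast

lemma potential_has_derivative:
  "t \<in> {0..<T} \<Longrightarrow> ((\<lambda>s. \<phi> s x) has_real_derivative laplacian A (g t) (\<phi> t) x) (at t within {0..<T})"
  using flow unfolding flow_solution_def by blast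

lemma metric_component_smooth:
  "c \<in> A \<Longrightarrow> smooth_on ({0..<T} \<times> cimg c) (\<lambda>(t, y). g t c y $ i $ j)"
  using flow unfolding flow_solution_def by blast

lemma potential_smooth: "c \<in> A \<Longrightarrow> smooth_on ({0..<T} \<times> cimg c) (\<lambda>(t, y). \<phi> t (cinv c y))"
  using flow unfolding flow_solution_def by blast

lemma continuous_on_metric_time: "c \<in> A \<Longrightarrow> continuous_on ({0..<T} \<times> cimg c) (\<lambda>z. g (fst z) c (snd z) $ i $ j)"
  using smooth_on_imp_continuous_on[OF metric_component_smooth] by (simp add: case_prod_beta)

lemma continuous_on_gd_time:
  assumes c: "c \<in> A"
  shows "continuous_on ({0..<T} \<times> cimg c) (\<lambda>z. gd (fst z) c (snd z) $ i $ j)"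
proof -
  have "continuous_on ({0..<T} \<times> cimg c) (\<lambda>(t, y). gd t c y $ i $ j)"
    by (rule continuous_on_time_derivative[OF metric_component_smooth[OF c]
          has_vector_derivative_entry[OF metric_has_derivative[OF _ c]]])
  then show ?thesis by (simp add: case_prod_beta)
qed

lemma continuous_on_laplacian_time:
  assumes c: "c \<in> A"
  shows "continuous_on ({0..<T} \<times> cimg c) (\<lambda>z. laplacian A (g (fst z)) (\<phi> (fst z)) (cinv c (snd z)))"
proof -
  have "continuous_on ({0..<T} \<times> cimg c) (\<lambda>(t, y). laplacian A (g t) (\<phi> t) (cinv c y))"
    by (rule continuous_on_time_derivative[OF potential_smooth[OF c] potential_has_derivative])
  then show ?thesis by (simp add: case_prod_beta)
qed

lemma continuous_on_slice:
  fixes u :: "real \<times> (real ^ 'n) \<Rightarrow> real"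
  assumes "continuous_on ({0..<T} \<times> U) u" "t \<in> {0..<T}"
  shows "continuous_on U (\<lambda>y. u (t, y))"
  by (rule continuous_on_compose2[OF assms(1)]) (use assms(2) in \<open>auto intro!: continuous_intros\<close>)

lemma borel_measurable_potential:
  assumes t: "t \<in> {0..<T}"
  shows "\<phi> t \<in> borel_measurable borel"
proof (rule borel_measurable_of_charts)
  fix c assume c: "c \<in> A"
  have "continuous_on ({0..<T} \<times> cimg c) (\<lambda>z. \<phi> (fst z) (cinv c (snd z)))"
    using smooth_on_imp_continuous_on[OF potential_smooth[OF c]] by (simp add: case_prod_beta)
  from continuous_on_slice[OF this t] show "continuous_on (cimg c) (\<phi> t \<circ> cinv c)" by (simp add: o_def)
qed

lemma borel_measurable_laplacian:
  assumes t: "t \<in> {0..<T}"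
  shows "laplacian A (g t) (\<phi> t) \<in> borel_measurable borel"
proof (rule borel_measurable_of_charts)
  fix c assume c: "c \<in> A"
  from continuous_on_slice[OF continuous_on_laplacian_time[OF c] t]
  show "continuous_on (cimg c) (laplacian A (g t) (\<phi> t) \<circ> cinv c)" by (simp add: o_def)
qed

lemma continuous_on_gd:
  assumes "t \<in> {0..<T}" "c \<in> A"
  shows "continuous_on (cimg c) (\<lambda>y. gd t c y $ i $ j)"
  using continuous_on_slice[OF continuous_on_gd_time[OF assms(2)] assms(1)] by simp

text \<open>The Jacobian does not depend on time, so the transformation law of the metric can be
  differentiated; uniqueness of the derivative turns the result into a law for
  \<open>gd\<close>.\<close>

lemma tensor2_field_gd:
  assumes t: "t \<in> {0..<T}"
  shows "tensor2_field A (gd t)"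
  unfolding tensor2_field_def
proof (intro ballI)
  fix c d y assume cd: "c \<in> A" "d \<in> A" and "y \<in> overlap c d"
  then obtain x where x: "x \<in> cdom c" "x \<in> cdom d" "y = cmap c x" by (auto simp: overlap_def)
  note o = overlap_point[OF cd x(1,2)]
  let ?J = "jac c d y"
  have tr: "transition c d y = cmap d x" using o(2) x(3) by simp
  have g_eq: "g s c y = transpose ?J ** g s d (cmap d x) ** ?J" if "s \<in> {0..<T}" for s
    using tensor2_fieldD[OF riemannian_metric_tensor2_field[OF metric[OF that]] cd x(1,2)] x(3) by simp
  have "linear (\<lambda>M :: real ^ 'n ^ 'n. transpose ?J ** M ** ?J)"
  proof
    show "transpose ?J ** (M + N) ** ?J = transpose ?J ** M ** ?J + transpose ?J ** N ** ?J" for M N :: "real ^ 'n ^ 'n"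
      using matrix_mult_linear(1)[of "transpose ?J" 1 M 1 N]
        matrix_mult_linear(2)[of 1 "transpose ?J ** M" 1 "transpose ?J ** N" ?J]
      by (simp only: scaleR_one)
    show "transpose ?J ** (r *\<^sub>R M) ** ?J = r *\<^sub>R (transpose ?J ** M ** ?J)" for r and M :: "real ^ 'n ^ 'n"
      using matrix_mult_linear(1)[of "transpose ?J" r M 0 M]
        matrix_mult_linear(2)[of r "transpose ?J ** M" 0 "transpose ?J ** M" ?J]
      by (simp only: scaleR_zero_left add_0_right)
  qed
  then have "bounded_linear (\<lambda>M :: real ^ 'n ^ 'n. transpose ?J ** M ** ?J)"
    by (simp add: linear_conv_bounded_linear)
  from bounded_linear.has_vector_derivative[OF this metric_has_derivative[OF t cd(2) cmap_in_cimg[OF x(2)]]]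
  have "((\<lambda>s. transpose ?J ** g s d (cmap d x) ** ?J) has_vector_derivative
      transpose ?J ** gd t d (cmap d x) ** ?J) (at t within {0..<T})" .
  then have "((\<lambda>s. g s c y) has_vector_derivative
      transpose ?J ** gd t d (cmap d x) ** ?J) (at t within {0..<T})"
    by (rule has_vector_derivative_transform[OF t, rotated]) (simp add: g_eq)
  moreover have "((\<lambda>s. g s c y) has_vector_derivative gd t c y) (at t within {0..<T})"
    using metric_has_derivative[OF t cd(1)] x by (simp add: cmap_in_cimg)
  ultimately show "gd t c y = transpose ?J ** gd t d (transition c d y) ** ?J"
    unfolding tr by (metis vector_derivative_unique_within[OF at_within_Ico_neq_bot[OF t]])
qed

lemma trace_gd:
  assumes t: "t \<in> {0..<T}" and c: "c \<in> A" and y: "y \<in> cimg c"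
  shows "trace (matrix_inv (g t c y) ** gd t c y) = (2 * \<rho> * real CARD('n) - 2) * scalar_curv (g t c) y"
proof -
  let ?P = "matrix_inv (g t c y)"
  interpret positive_form ?P
    by (rule riemannian_metric_inv_positive_form[OF metric[OF t] c y])
  have nz: "det (g t c y) \<noteq> 0" using riemannian_metric_det_pos[OF metric[OF t] c y] by simp
  \<comment> \<open>The trace pairs an entry of the inverse metric with the transposed Ricci entry;
    symmetry of the inverse metric, rather than of the Ricci components, brings it to the form of
    \<open>scalar_curv\<close>.\<close>
  have P: "?P $ i $ j = ?P $ j $ i" for i j 
  proof -
    have "?P $ i $ j = transpose ?P $ j $ i" by (simp add: transpose_def)
    then show ?thesis by (simp only: sym)
  qed
  have "trace (?P ** ricci (g t c) y) = (\<Sum>i\<in>UNIV. \<Sum>j\<in>UNIV. ?P $ j $ i * ricci (g t c) y $ j $ i)"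
    unfolding trace_def matrix_matrix_mult_def vec_lambda_beta
    by (intro sum.cong refl arg_cong2[where f = "(*)"] P)
  also have "\<dots> = scalar_curv (g t c) y"
    unfolding scalar_curv_def by (rule sum.swap)
  finally have ric: "trace (?P ** ricci (g t c) y) = scalar_curv (g t c) y" .
  have "?P ** gd t c y = (- 2) *\<^sub>R (?P ** ricci (g t c) y) + (2 * \<rho> * scalar_curv (g t c) y) *\<^sub>R mat 1"
    unfolding gd_def matrix_mult_linear by (simp only: matrix_inv_mult[OF nz])
  then have "trace (?P ** gd t c y) = (- 2) * trace (?P ** ricci (g t c) y) + 2 * \<rho> * scalar_curv (g t c) y * trace (mat 1 :: real ^ 'n ^ 'n)"
    by (simp only: trace_linear)
  then show ?thesis by (simp add: ric trace_I algebra_simps)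
qed

lemma scal_eq:
  assumes t: "t \<in> {0..<T}" and c: "c \<in> A" and x: "x \<in> cdom c"
  shows "scal A (g t) x = scalar_curv (g t c) (cmap c x)"
    and "on_M A (\<lambda>c y. trace (matrix_inv (g t c y) ** gd t c y)) x = (2 * \<rho> * real CARD('n) - 2) * scal A (g t) x"
proof -
  note inv = chart_invariant_trace[OF metric[OF t] tensor2_field_gd[OF t]]
  have "chart_invariant A (\<lambda>c. scalar_curv (g t c))"
  proof (rule chart_invariantI)
    fix c d x assume cd: "c \<in> A" "d \<in> A" "x \<in> cdom c" "x \<in> cdom d"
    from chart_invariantD[OF inv cd] \<rho> show "scalar_curv (g t c) (cmap c x) = scalar_curv (g t d) (cmap d x)"
      by (simp add: trace_gd[OF t cd(1) cmap_in_cimg[OF cd(3)]] trace_gd[OF t cd(2) cmap_in_cimg[OF cd(4)]])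
  qed
  from on_M_eq[OF this c x] show *: "scal A (g t) x = scalar_curv (g t c) (cmap c x)" by (simp add: scal_def)
  show "on_M A (\<lambda>c y. trace (matrix_inv (g t c y) ** gd t c y)) x = (2 * \<rho> * real CARD('n) - 2) * scal A (g t) x"
    unfolding on_M_eq[OF inv c x] trace_gd[OF t c cmap_in_cimg[OF x]] * ..
qed

text \<open>The flow equation with both indices raised, solved for the Ricci term.\<close>

lemma ricci_up_form:
  assumes t: "t \<in> {0..<T}" and c: "c \<in> A" and y: "y \<in> cimg c"
  defines "P \<equiv> matrix_inv (g t c y)"
  shows "(\<Sum>i\<in>UNIV. \<Sum>j\<in>UNIV. ricci_up (g t c) y $ i $ j * v $ i * v $ j)
    = \<rho> * scalar_curv (g t c) y * (v \<bullet> (P *v v)) - (v \<bullet> ((P ** gd t c y ** P) *v v)) / 2"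
proof -
  have nz: "det (g t c y) \<noteq> 0" using riemannian_metric_det_pos[OF metric[OF t] c y] by simp
  have "P ** gd t c y ** P = (- 2) *\<^sub>R ricci_up (g t c) y + (2 * \<rho> * scalar_curv (g t c) y) *\<^sub>R P"
    unfolding gd_def P_def ricci_up_def matrix_mult_linear
    by (simp only: matrix_inv_mult[OF nz] matrix_mul_lid)
  then have "v \<bullet> ((P ** gd t c y ** P) *v v)
      = (- 2) * (v \<bullet> (ricci_up (g t c) y *v v)) + 2 * \<rho> * scalar_curv (g t c) y * (v \<bullet> (P *v v))"
    by (simp only: form_linear)
  moreover have "(\<Sum>i\<in>UNIV. \<Sum>j\<in>UNIV. ricci_up (g t c) y $ i $ j * v $ i * v $ j) = v \<bullet> (ricci_up (g t c) y *v v)"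
    by (simp add: inner_matrix_vector_sum mult.assoc)
  ultimately show ?thesis by (simp add: algebra_simps)
qed

text \<open>The right-hand side consists of invariant functions, so the formula in each chart shows
  that the left-hand side does not depend on the chart.\<close>

lemma on_M_ricci_up:
  assumes t: "t \<in> {0..<T}" and D: "covector_field A D" and c: "c \<in> A" and x: "x \<in> cdom c"
  shows "on_M A (\<lambda>c y. \<Sum>i\<in>UNIV. \<Sum>j\<in>UNIV. ricci_up (g t c) y $ i $ j * D c y $ i * D c y $ j) x
    = \<rho> * scal A (g t) x * (on_M A (cnorm (g t) D) x)\<^sup>2
      - on_M A (\<lambda>c y. D c y \<bullet> ((matrix_inv (g t c y) ** gd t c y ** matrix_inv (g t c y)) *v D c y)) x / 2"
proof -
  let ?F = "\<lambda>c y. \<Sum>i\<in>UNIV. \<Sum>j\<in>UNIV. ricci_up (g t c) y $ i $ j * D c y $ i * D c y $ j"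
  note inv1 = chart_invariant_cnorm[OF metric[OF t] D]
    and inv2 = chart_invariant_raised_form[OF metric[OF t] tensor2_field_gd[OF t] D D]
  have F: "?F c (cmap c x) = \<rho> * scal A (g t) x * (on_M A (cnorm (g t) D) x)\<^sup>2
      - on_M A (\<lambda>c y. D c y \<bullet> ((matrix_inv (g t c y) ** gd t c y ** matrix_inv (g t c y)) *v D c y)) x / 2"
    if c: "c \<in> A" and x: "x \<in> cdom c" for c x
  proof -
    note P = riemannian_metric_inv_positive_form[OF metric[OF t] c cmap_in_cimg[OF x]]
    show ?thesis
      unfolding ricci_up_form[OF t c cmap_in_cimg[OF x]] on_M_eq[OF inv1 c x] on_M_eq[OF inv2 c x]
        scal_eq(1)[OF t c x] cnorm_eq_form_norm positive_form.form_norm_power2[OF P] ..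
  qed
  have "chart_invariant A ?F"
  proof (rule chart_invariantI)
    fix c d x assume cd: "c \<in> A" "d \<in> A" "x \<in> cdom c" "x \<in> cdom d"
    show "?F c (cmap c x) = ?F d (cmap d x)"
      unfolding F[OF cd(1,3)] F[OF cd(2,4)] ..
  qed
  from on_M_eq[OF this c x] show ?thesis unfolding F[OF c x] .
qed

end

section \<open>Uniform bounds along the flow and the moving density\<close>

context curvature_flow
begin

text \<open>All three quantities are jointly continuous in time and space, and b < T makes the time
  interval compact inside the domain. The chart may depend on the point but not on the time, so that
  one chart serves for integration along a whole time interval.\<close>

lemma flow_bounds:
  assumes b: "b < T"
  obtains L where "0 \<le> L" "\<And>x. \<exists>c\<in>A. x \<in> cdom c \<and> (\<forall>t\<in>{0..b}.
    \<bar>trace (matrix_inv (g t c (cmap c x)) ** gd t c (cmap c x))\<bar> \<le> L \<and>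
    \<bar>laplacian A (g t) (\<phi> t) x\<bar> \<le> L \<and>
    (\<forall>v. \<bar>v \<bullet> (gd t c (cmap c x) *v v)\<bar> \<le> L * (v \<bullet> (g t c (cmap c x) *v v))))"
proof -
  let ?Q = "\<lambda>c x L. \<forall>t\<in>{0..b}.
    \<bar>trace (matrix_inv (g t c (cmap c x)) ** gd t c (cmap c x))\<bar> \<le> L \<and>
    \<bar>laplacian A (g t) (\<phi> t) x\<bar> \<le> L \<and>
    (\<forall>v. \<bar>v \<bullet> (gd t c (cmap c x) *v v)\<bar> \<le> L * (v \<bullet> (g t c (cmap c x) *v v)))"
  have "\<exists>L\<ge>0. \<forall>x. \<exists>c\<in>A. x \<in> cdom c \<and> ?Q c x L"
  proof (rule chart_bound)
    fix x and L L' :: real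
    assume "\<exists>c\<in>A. x \<in> cdom c \<and> ?Q c x L" and LL: "L \<le> L'"
    then obtain c where c: "c \<in> A" "x \<in> cdom c" "?Q c x L" by blast
    have "?Q c x L'"
    proof
      fix t assume t: "t \<in> {0..b}"
      then have "t \<in> {0..<T}" using b by auto
      note P = riemannian_metric_positive_form[OF metric[OF this] c(1) cmap_in_cimg[OF c(2)]]
      have "L * (v \<bullet> (g t c (cmap c x) *v v)) \<le> L' * (v \<bullet> (g t c (cmap c x) *v v))" for v
        using LL positive_form.form_nonneg[OF P] by (intro mult_right_mono) auto
      then show "\<bar>trace (matrix_inv (g t c (cmap c x)) ** gd t c (cmap c x))\<bar> \<le> L' \<and>
          \<bar>laplacian A (g t) (\<phi> t) x\<bar> \<le> L' \<and>
          (\<forall>v. \<bar>v \<bullet> (gd t c (cmap c x) *v v)\<bar> \<le> L' * (v \<bullet> (g t c (cmap c x) *v v)))"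
        using bspec[OF c(3) t] LL by (meson order_trans)
    qed
    with c show "\<exists>c\<in>A. x \<in> cdom c \<and> ?Q c x L'" by blast
  next
    fix c and K :: "(real ^ 'n) set"
    assume c: "c \<in> A" and K: "compact K" "K \<subseteq> cimg c"
    let ?S = "{0..b} \<times> K"
    have S: "?S \<subseteq> {0..<T} \<times> cimg c" "compact ?S" using b K by (auto intro: compact_Times)
    note cont_g = continuous_on_subset[OF continuous_on_metric_time[OF c] S(1)]
      and cont_gd = continuous_on_subset[OF continuous_on_gd_time[OF c] S(1)]
      and cont_lap = continuous_on_subset[OF continuous_on_laplacian_time[OF c] S(1)]
    have P: "positive_form (g (fst z) c (snd z))" if "z \<in> ?S" for z
      using that S(1) by (intro riemannian_metric_positive_form[where A = A] metric c) auto
    have "det (g (fst z) c (snd z)) \<noteq> 0" if "z \<in> ?S" for z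
      using positive_form.form_det_pos[OF P[OF that]] by simp
    note cont_inv = continuous_on_matrix_inv[OF cont_g this]
    have "continuous_on ?S (\<lambda>z. trace (matrix_inv (g (fst z) c (snd z)) ** gd (fst z) c (snd z)))"
      unfolding matrix_matrix_mult_def trace_def
      by (simp, intro continuous_intros cont_inv cont_gd) 
    from bounded_on_compact[OF this S(2)] obtain L1 where L1: "0 \<le> L1" "\<And>z. z \<in> ?S \<Longrightarrow>
      \<bar>trace (matrix_inv (g (fst z) c (snd z)) ** gd (fst z) c (snd z))\<bar> \<le> L1" by metis
    from bounded_on_compact[OF cont_lap S(2)] obtain L2 where L2: "0 \<le> L2" "\<And>z. z \<in> ?S \<Longrightarrow>
      \<bar>laplacian A (g (fst z)) (\<phi> (fst z)) (cinv c (snd z))\<bar> \<le> L2" by metis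
    from form_ratio_bounded[OF S(2) cont_g cont_gd P] obtain L3 where L3: "0 \<le> L3" "\<And>z v. z \<in> ?S \<Longrightarrow>
      \<bar>v \<bullet> (gd (fst z) c (snd z) *v v)\<bar> \<le> L3 * (v \<bullet> (g (fst z) c (snd z) *v v))" by metis
    define L where "L = L1 + L2 + L3"
    have LL: "L1 \<le> L" "L2 \<le> L" "L3 \<le> L" using L1(1) L2(1) L3(1) by (auto simp: L_def)
    have "\<exists>d\<in>A. cinv c y \<in> cdom d \<and> ?Q d (cinv c y) L" if y: "y \<in> K" for y
    proof (intro bexI[of _ c] conjI c)
      have y': "y \<in> cimg c" using y K by blast
      then show "cinv c y \<in> cdom c" by (rule cinv_in_cdom[OF c])
      show "?Q c (cinv c y) L"
      proof
        fix t assume "t \<in> {0..b}"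
        then have z: "(t, y) \<in> ?S" using y by simp
        have "L3 * (v \<bullet> (g t c y *v v)) \<le> L * (v \<bullet> (g t c y *v v))" for v
          using LL(3) positive_form.form_nonneg[OF P[OF z]] by (intro mult_right_mono) auto
        then show "\<bar>trace (matrix_inv (g t c (cmap c (cinv c y))) ** gd t c (cmap c (cinv c y)))\<bar> \<le> L \<and>
            \<bar>laplacian A (g t) (\<phi> t) (cinv c y)\<bar> \<le> L \<and>
            (\<forall>v. \<bar>v \<bullet> (gd t c (cmap c (cinv c y)) *v v)\<bar> \<le> L * (v \<bullet> (g t c (cmap c (cinv c y)) *v v)))"
          unfolding cmap_cinv[OF c y']
          using L1(2)[OF z] L2(2)[OF z] L3(2)[OF z] LL(1,2) by (auto intro: order_trans)
      qed
    qed
    then show "\<exists>L. \<forall>y\<in>K. \<exists>d\<in>A. cinv c y \<in> cdom d \<and> ?Q d (cinv c y) L" by blast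
  qed
  with that show thesis by blast
qed

text \<open>The density of \<open>e\<^sup>-\<^sup>\<phi>\<^sup>(\<^sup>s\<^sup>) d\<nu>(s)\<close> with respect to \<open>d\<nu>(t)\<close>.\<close>

definition weight :: "real \<Rightarrow> real \<Rightarrow> 'm \<Rightarrow> real" where
  "weight t s x = exp (- \<phi> s x) * on_M A (\<lambda>c y. sqrt (det (g s c y)) / sqrt (det (g t c y))) x"

lemma weight_eq:
  assumes "t \<in> {0..<T}" "s \<in> {0..<T}" "c \<in> A" "x \<in> cdom c"
  shows "weight t s x = exp (- \<phi> s x) * (sqrt (det (g s c (cmap c x))) / sqrt (det (g t c (cmap c x))))"
  unfolding weight_def on_M_eq[OF chart_invariant_volume_ratio[OF metric metric] assms(3,4), OF assms(2,1)] ..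

lemma metric_det_pos:
  "t \<in> {0..<T} \<Longrightarrow> c \<in> A \<Longrightarrow> x \<in> cdom c \<Longrightarrow> 0 < det (g t c (cmap c x))"
  by (rule riemannian_metric_det_pos[OF metric _ cmap_in_cimg])

lemma weight_self:
  assumes "t \<in> {0..<T}"
  shows "weight t t x = exp (- \<phi> t x)"
proof -
  obtain c where c: "c \<in> A" "x \<in> cdom c" by (rule chart_at)
  show ?thesis unfolding weight_eq[OF assms assms c] using metric_det_pos[OF assms c] by simp
qed

lemma weight_pos:
  assumes "t \<in> {0..<T}" "s \<in> {0..<T}"
  shows "0 < weight t s x"
proof -
  obtain c where c: "c \<in> A" "x \<in> cdom c" by (rule chart_at)
  show ?thesis unfolding weight_eq[OF assms c]
    using metric_det_pos[OF assms(1) c] metric_det_pos[OF assms(2) c] by simp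
qed

lemma borel_measurable_weight:
  assumes "t \<in> {0..<T}" "s \<in> {0..<T}"
  shows "weight t s \<in> borel_measurable borel"
proof -
  note [measurable] = borel_measurable_potential[OF assms(2)]
    borel_measurable_on_M_volume_ratio[OF metric[OF assms(2)] metric[OF assms(1)]]
  show ?thesis unfolding weight_def[abs_def] by measurable
qed

text \<open>One computation for two purposes: r = p/2 gives the density times the p-th power of the
  norm of a fixed covector, r = 0 the density alone. The exponential contributes the Laplacian,
  Jacobi's formula half the trace, and the inverse metric the last term.\<close>

lemma weight_form_has_derivative:
  assumes t: "t \<in> {0..<T}" and s: "s \<in> {0..<T}" and c: "c \<in> A" and x: "x \<in> cdom c"
    and v: "v \<noteq> 0"
  defines "y \<equiv> cmap c x"
  defines "P \<equiv> \<lambda>s. matrix_inv (g s c y)"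
  shows "((\<lambda>s. weight t s x * (v \<bullet> (P s *v v)) powr r) has_real_derivative
      weight t s x * (v \<bullet> (P s *v v)) powr r *
      ((trace (P s ** gd s c y) / 2 - laplacian A (g s) (\<phi> s) x)
        + r * (- (v \<bullet> ((P s ** gd s c y ** P s) *v v)) / (v \<bullet> (P s *v v)))))
    (at s within {0..<T})"
proof -
  let ?I = "{0..<T}"
  have y: "y \<in> cimg c" unfolding y_def by (rule cmap_in_cimg[OF x])
  note entry = has_vector_derivative_entry[OF metric_has_derivative[OF s c y]]
  have det: "0 < det (g r c y)" if "r \<in> ?I" for r
    using metric_det_pos[OF that c x] by (simp add: y_def)
  have "((\<lambda>s. exp (- \<phi> s x)) has_real_derivative exp (- \<phi> s x) * (- laplacian A (g s) (\<phi> s) x)) (at s within ?I)"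
    by (rule DERIV_chain2[OF DERIV_exp DERIV_minus[OF potential_has_derivative[OF s]]])
  moreover have "((\<lambda>s. sqrt (det (g s c y)) / sqrt (det (g t c y))) has_real_derivative
      sqrt (det (g s c y)) / sqrt (det (g t c y)) * (trace (P s ** gd s c y) / 2)) (at s within ?I)"
  proof -
    have "((\<lambda>s. det (g s c y)) has_real_derivative det (g s c y) * trace (P s ** gd s c y)) (at s within ?I)"
      unfolding P_def using det[OF s] by (intro det_has_derivative entry) simp
    from DERIV_cdivide[OF DERIV_chain2[OF DERIV_real_sqrt[OF det[OF s]] this], of "sqrt (det (g t c y))"]
    show ?thesis
    proof (rule DERIV_cong)
      define d where "d = sqrt (det (g s c y))"
      have "det (g s c y) = d * d" "0 < d" using det[OF s] by (simp_all add: d_def)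
      then show "inverse (sqrt (det (g s c y))) / 2 * (det (g s c y) * trace (P s ** gd s c y)) / sqrt (det (g t c y))
          = sqrt (det (g s c y)) / sqrt (det (g t c y)) * (trace (P s ** gd s c y) / 2)"
        by (simp add: field_simps)
    qed
  qed
  ultimately have "((\<lambda>s. exp (- \<phi> s x) * (sqrt (det (g s c y)) / sqrt (det (g t c y)))) has_real_derivative
      exp (- \<phi> s x) * (sqrt (det (g s c y)) / sqrt (det (g t c y))) *
      (- laplacian A (g s) (\<phi> s) x + trace (P s ** gd s c y) / 2)) (at s within ?I)"
    by (rule has_real_derivative_mult_log)
  then have "((\<lambda>s. weight t s x) has_real_derivative
      exp (- \<phi> s x) * (sqrt (det (g s c y)) / sqrt (det (g t c y))) *
      (- laplacian A (g s) (\<phi> s) x + trace (P s ** gd s c y) / 2)) (at s within ?I)"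
    by (rule has_field_derivative_transform_within[OF _ zero_less_one s]) (simp add: weight_eq[OF t _ c x] y_def)
  then have "((\<lambda>s. weight t s x) has_real_derivative
      weight t s x * (trace (P s ** gd s c y) / 2 - laplacian A (g s) (\<phi> s) x)) (at s within ?I)"
    by (rule DERIV_cong) (simp add: weight_eq[OF t s c x] y_def)
  moreover have "((\<lambda>s. (v \<bullet> (P s *v v)) powr r) has_real_derivative
      (v \<bullet> (P s *v v)) powr r * (r * (- (v \<bullet> ((P s ** gd s c y ** P s) *v v)) / (v \<bullet> (P s *v v))))) (at s within ?I)"
  proof (rule has_real_derivative_powr_log)
    show "((\<lambda>s. v \<bullet> (P s *v v)) has_real_derivative - (v \<bullet> ((P s ** gd s c y ** P s) *v v))) (at s within ?I)"
      unfolding P_def using det by (intro matrix_inv_form_has_derivative entry s) force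
    show "0 < v \<bullet> (P s *v v)"
      unfolding P_def using positive_form.pos[OF riemannian_metric_inv_positive_form[OF metric[OF s] c y]] v .
  qed
  ultimately show ?thesis by (rule has_real_derivative_mult_log)
qed

lemma weight_has_derivative:
  assumes t: "t \<in> {0..<T}" and s: "s \<in> {0..<T}"
  shows "((\<lambda>s. weight t s x) has_real_derivative
      weight t s x * ((\<rho> * real CARD('n) - 1) * scal A (g s) x - laplacian A (g s) (\<phi> s) x)) (at s within {0..<T})"
proof -
  obtain c where c: "c \<in> A" "x \<in> cdom c" by (rule chart_at)
  \<comment> \<open>Any nonzero covector would do: with exponent 0 the power of its positive square
    norm is 1.\<close>
  define v :: "real ^ 'n" where "v = (\<chi> i. 1)"
  have v: "v \<noteq> 0" by (simp add: v_def vec_eq_iff)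
  have pos: "0 < v \<bullet> (matrix_inv (g r c (cmap c x)) *v v)" if "r \<in> {0..<T}" for r
    using positive_form.pos[OF riemannian_metric_inv_positive_form[OF metric[OF that] c(1) cmap_in_cimg[OF c(2)]] v] .
  from weight_form_has_derivative[OF t s c v, of 0]
  have "((\<lambda>s. weight t s x) has_real_derivative
    weight t s x * (v \<bullet> (matrix_inv (g s c (cmap c x)) *v v)) powr 0 *
      ((trace (matrix_inv (g s c (cmap c x)) ** gd s c (cmap c x)) / 2 - laplacian A (g s) (\<phi> s) x)
        + 0 * (- (v \<bullet> ((matrix_inv (g s c (cmap c x)) ** gd s c (cmap c x) ** matrix_inv (g s c (cmap c x))) *v v)) / (v \<bullet> (matrix_inv (g s c (cmap c x)) *v v))))) (at s within {0..<T})"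
    by (rule has_field_derivative_transform_within[OF _ zero_less_one s]) (use pos in force)
  then show ?thesis
    by (rule DERIV_cong)
      (use pos[OF s] in \<open>simp add: trace_gd[OF s c(1) cmap_in_cimg[OF c(2)]] scal_eq(1)[OF s c] left_diff_distrib\<close>)
qed

end

context curvature_flow
begin

text \<open>In \<open>K\<close>, half the trace and the Laplacian together stay below 2 L, and the
  derivative of the inverse metric contributes at most R L. The Gronwall estimate then applies on
  \<open>{0..b}\<close>.\<close>

lemma weight_form_growth:
  assumes t: "t \<in> {0..b}" and s: "s \<in> {0..b}" and b: "b < T" and st: "\<bar>s - t\<bar> \<le> 1"
    and c: "c \<in> A" and x: "x \<in> cdom c" and v: "v \<noteq> 0" and r: "0 \<le> r" "r \<le> R"
    and bound: "\<And>s. s \<in> {0..b} \<Longrightarrow> \<bar>trace (matrix_inv (g s c (cmap c x)) ** gd s c (cmap c x))\<bar> \<le> L"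
      "\<And>s. s \<in> {0..b} \<Longrightarrow> \<bar>laplacian A (g s) (\<phi> s) x\<bar> \<le> L"
      "\<And>s v. s \<in> {0..b} \<Longrightarrow> \<bar>v \<bullet> (gd s c (cmap c x) *v v)\<bar> \<le> L * (v \<bullet> (g s c (cmap c x) *v v))"
    and L: "0 \<le> L"
  defines "q \<equiv> \<lambda>s. v \<bullet> (matrix_inv (g s c (cmap c x)) *v v)"
    and "K \<equiv> (2 + R) * L"
  shows "\<bar>weight t s x * q s powr r - weight t t x * q t powr r\<bar>
    \<le> K * exp K * \<bar>s - t\<bar> * (weight t t x * q t powr r)"
proof -
  define y where "y = cmap c x"
  define P where "P s = matrix_inv (g s c y)" for s
  let ?l = "\<lambda>s. (trace (P s ** gd s c y) / 2 - laplacian A (g s) (\<phi> s) x)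
        + r * (- (v \<bullet> ((P s ** gd s c y ** P s) *v v)) / q s)"
  have y: "y \<in> cimg c" unfolding y_def by (rule cmap_in_cimg[OF x])
  have I: "s \<in> {0..<T}" if "s \<in> {0..b}" for s using that b by auto
  have q: "0 < q s" if "s \<in> {0..b}" for s
    unfolding q_def
    using positive_form.pos[OF riemannian_metric_inv_positive_form[OF metric[OF I[OF that]] c cmap_in_cimg[OF x]] v] .
  have wpos: "0 < weight t s x * q s powr r" if "s \<in> {0..b}" for s
    using weight_pos[OF I[OF t] I[OF that]] q[OF that] by simp
  show ?thesis
  proof (rule abs_diff_le_of_log_derivative[OF _ t s st _ wpos])
    show "convex {0..b}" by simp
    fix s assume s: "s \<in> {0..b}"
    have "((\<lambda>s. weight t s x * q s powr r) has_real_derivative weight t s x * q s powr r * ?l s) (at s within {0..<T})"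
      unfolding q_def P_def y_def by (rule weight_form_has_derivative[OF I[OF t] I[OF s] c x v])
    then show "((\<lambda>s. weight t s x * q s powr r) has_real_derivative weight t s x * q s powr r * ?l s) (at s within {0..b})"
      by (rule DERIV_subset) (use I in blast)
    interpret positive_form "P s"
      unfolding P_def by (rule riemannian_metric_inv_positive_form[OF metric[OF I[OF s]] c y])
    have nz: "det (g s c y) \<noteq> 0" using metric_det_pos[OF I[OF s] c x] by (simp add: y_def)
    \<comment> \<open>Raising the index of \<open>v\<close> turns the form of P gd P at
      \<open>v\<close> into that of \<open>gd\<close> at \<open>w\<close>, and the inverse metric at
      \<open>v\<close> into the metric at \<open>w\<close>; the bound assumed for \<open>gd\<close>
      against the metric thus carries over to the inverse metric.\<close>
    define w where "w = P s *v v"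
    have "v \<bullet> ((P s ** gd s c y ** P s) *v v) = w \<bullet> (gd s c y *v w)"
    proof -
      have "v \<bullet> ((P s ** gd s c y ** P s) *v v) = v \<bullet> (P s *v (gd s c y *v w))"
        by (simp add: w_def matrix_vector_mul_assoc matrix_mul_assoc)
      also have "\<dots> = (gd s c y *v w) \<bullet> (P s *v v)" by (rule form_commute)
      finally show ?thesis by (simp add: w_def inner_commute)
    qed
    moreover have "w \<bullet> (g s c y *v w) = q s"
    proof -
      have "g s c y *v w = v"
        using nz by (simp add: w_def P_def matrix_vector_mul_assoc matrix_inv_mult)
      then show ?thesis by (simp add: q_def w_def P_def y_def inner_commute)
    qed
    ultimately have form: "\<bar>v \<bullet> ((P s ** gd s c y ** P s) *v v)\<bar> \<le> L * q s"
      using bound(3)[OF s, of w] by (simp add: y_def)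
    have "\<bar>r * (- (v \<bullet> ((P s ** gd s c y ** P s) *v v)) / q s)\<bar> = r * (\<bar>v \<bullet> ((P s ** gd s c y ** P s) *v v)\<bar> / q s)"
      using r q[OF s] by (simp add: abs_mult abs_divide)
    also have "\<dots> \<le> R * L"
      using form q[OF s] r L by (intro mult_mono) (auto simp: field_simps)
    finally have 1: "\<bar>r * (- (v \<bullet> ((P s ** gd s c y ** P s) *v v)) / q s)\<bar> \<le> R * L" .
    have "\<bar>trace (P s ** gd s c y)\<bar> \<le> L" using bound(1)[OF s] by (simp add: P_def y_def)
    with 1 bound(2)[OF s] have "\<bar>?l s\<bar> \<le> K"
      unfolding K_def distrib_right by linarith
    define U where "U = weight t s x * q s powr r"
    have "\<bar>U * ?l s\<bar> = U * \<bar>?l s\<bar>" using wpos[OF s] by (simp add: U_def[symmetric] abs_mult)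
    also have "\<dots> \<le> U * K"
      using \<open>\<bar>?l s\<bar> \<le> K\<close> wpos[OF s] by (intro mult_left_mono) (simp_all add: U_def)
    finally show "\<bar>weight t s x * q s powr r * ?l s\<bar> \<le> K * (weight t s x * q s powr r)"
      by (simp only: U_def mult.commute[of K])
  qed
qed

lemma weight_growth:
  assumes t: "t \<in> {0..b}" and b: "b < T" and p: "0 \<le> p"
  obtains C where
    "\<And>s x. s \<in> {0..b} \<Longrightarrow> \<bar>s - t\<bar> \<le> 1 \<Longrightarrow> \<bar>weight t s x - weight t t x\<bar> \<le> C * \<bar>s - t\<bar> * weight t t x"
    "\<And>s x D. s \<in> {0..b} \<Longrightarrow> \<bar>s - t\<bar> \<le> 1 \<Longrightarrow> covector_field A D \<Longrightarrow>
      \<bar>weight t s x * on_M A (cnorm (g s) D) x powr p - weight t t x * on_M A (cnorm (g t) D) x powr p\<bar>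
      \<le> C * \<bar>s - t\<bar> * (weight t t x * on_M A (cnorm (g t) D) x powr p)"
proof -
  obtain L where L: "0 \<le> L" "\<And>x. \<exists>c\<in>A. x \<in> cdom c \<and> (\<forall>t\<in>{0..b}.
    \<bar>trace (matrix_inv (g t c (cmap c x)) ** gd t c (cmap c x))\<bar> \<le> L \<and>
    \<bar>laplacian A (g t) (\<phi> t) x\<bar> \<le> L \<and>
    (\<forall>v. \<bar>v \<bullet> (gd t c (cmap c x) *v v)\<bar> \<le> L * (v \<bullet> (g t c (cmap c x) *v v))))"
    using flow_bounds[OF b] by metis
  \<comment> \<open>The constant for exponents up to p/2, which covers both r = 0 and r =
    p/2.\<close>
  define K where "K = (2 + p / 2) * L"
  have I: "s \<in> {0..<T}" if "s \<in> {0..b}" for s using that b by auto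
  show thesis
  proof (rule that[of "K * exp K"])
    fix s x assume s: "s \<in> {0..b}" and st: "\<bar>s - t\<bar> \<le> 1"
    obtain c where c: "c \<in> A" "x \<in> cdom c" and bound: "\<And>s. s \<in> {0..b} \<Longrightarrow>
      \<bar>trace (matrix_inv (g s c (cmap c x)) ** gd s c (cmap c x))\<bar> \<le> L"
      "\<And>s. s \<in> {0..b} \<Longrightarrow> \<bar>laplacian A (g s) (\<phi> s) x\<bar> \<le> L"
      "\<And>s v. s \<in> {0..b} \<Longrightarrow> \<bar>v \<bullet> (gd s c (cmap c x) *v v)\<bar> \<le> L * (v \<bullet> (g s c (cmap c x) *v v))"
      using L(2)[of x] by blast
    note growth = weight_form_growth[OF t s b st c _ _ _ bound L(1), where R = "p / 2", folded K_def]
    define v :: "real ^ 'n" where "v = (\<chi> i. 1)"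
    have v: "v \<noteq> 0" by (simp add: v_def vec_eq_iff)
    have form: "0 < u \<bullet> (matrix_inv (g r c (cmap c x)) *v u)" if "r \<in> {0..b}" "u \<noteq> 0" for r u
      using positive_form.pos[OF riemannian_metric_inv_positive_form[OF metric[OF I[OF that(1)]] c(1) cmap_in_cimg[OF c(2)]] that(2)] .
    show "\<bar>weight t s x - weight t t x\<bar> \<le> K * exp K * \<bar>s - t\<bar> * weight t t x"
      using growth[OF v, of 0] p form[OF s v] form[OF t v] by simp
    fix D assume D: "covector_field A D"
    let ?v = "D c (cmap c x)"
    note eqs = on_M_cnorm_eq[OF metric[OF I[OF s]] D c] on_M_cnorm_eq[OF metric[OF I[OF t]] D c]
    show "\<bar>weight t s x * on_M A (cnorm (g s) D) x powr p - weight t t x * on_M A (cnorm (g t) D) x powr p\<bar>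
        \<le> K * exp K * \<bar>s - t\<bar> * (weight t t x * on_M A (cnorm (g t) D) x powr p)"
    proof (cases "?v = 0")
      case True
      then show ?thesis unfolding eqs by (simp add: form_norm_def)
    next
      case False
      have "form_norm (matrix_inv (g r c (cmap c x))) ?v powr p
          = (?v \<bullet> (matrix_inv (g r c (cmap c x)) *v ?v)) powr (p / 2)" if "r \<in> {0..b}" for r
        using form[OF that False] by (simp add: form_norm_def powr_half_sqrt[symmetric] powr_powr)
      then show ?thesis unfolding eqs using growth[OF False, of "p / 2"] p s t by simp
    qed
  qed
qed

end

section \<open>Bounds at a fixed time, and transport of integrals to one measure\<close>

context curvature_flow
begin

lemma borel_measurable_scal:
  assumes t: "t \<in> {0..<T}"
  shows "scal A (g t) \<in> borel_measurable borel"
proof -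
  note [measurable] = borel_measurable_on_M_trace[OF metric[OF t] tensor2_field_gd[OF t] continuous_on_gd[OF t]]
  have "scal A (g t) x = on_M A (\<lambda>c y. trace (matrix_inv (g t c y) ** gd t c y)) x / (2 * \<rho> * real CARD('n) - 2)" for x
  proof -
    obtain c where c: "c \<in> A" "x \<in> cdom c" by (rule chart_at)
    show ?thesis unfolding scal_eq(2)[OF t c] using \<rho> by simp
  qed
  then have "scal A (g t) = (\<lambda>x. on_M A (\<lambda>c y. trace (matrix_inv (g t c y) ** gd t c y)) x / (2 * \<rho> * real CARD('n) - 2))"
    by (rule ext)
  also have "\<dots> \<in> borel_measurable borel" by measurable
  finally show ?thesis .
qed

lemma curvature_bounds:
  assumes t: "t \<in> {0..<T}"
  obtains C where "0 \<le> C" "\<And>x. \<bar>scal A (g t) x\<bar> \<le> C" "\<And>x. \<bar>laplacian A (g t) (\<phi> t) x\<bar> \<le> C"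
    "\<And>D x. covector_field A D \<Longrightarrow>
      \<bar>on_M A (\<lambda>c y. D c y \<bullet> ((matrix_inv (g t c y) ** gd t c y ** matrix_inv (g t c y)) *v D c y)) x\<bar>
      \<le> C * (on_M A (cnorm (g t) D) x)\<^sup>2"
proof -
  \<comment> \<open>A bound at the single time \<open>t\<close> is read off from
    \<open>flow_bounds\<close> with b = t.\<close>
  have tT: "t < T" and tt: "t \<in> {0..t}" using t by auto
  obtain L where L: "0 \<le> L" "\<And>x. \<exists>c\<in>A. x \<in> cdom c \<and> (\<forall>s\<in>{0..t}.
    \<bar>trace (matrix_inv (g s c (cmap c x)) ** gd s c (cmap c x))\<bar> \<le> L \<and>
    \<bar>laplacian A (g s) (\<phi> s) x\<bar> \<le> L \<and>
    (\<forall>v. \<bar>v \<bullet> (gd s c (cmap c x) *v v)\<bar> \<le> L * (v \<bullet> (g s c (cmap c x) *v v))))"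
    using flow_bounds[OF tT] by metis
  define a where "a = \<bar>2 * \<rho> * real CARD('n) - 2\<bar>"
  have a: "0 < a" using \<rho> by (auto simp: a_def)
  have bounds: "\<bar>scal A (g t) x\<bar> \<le> L / a" "\<bar>laplacian A (g t) (\<phi> t) x\<bar> \<le> L"
    "\<And>D. covector_field A D \<Longrightarrow>
      \<bar>on_M A (\<lambda>c y. D c y \<bullet> ((matrix_inv (g t c y) ** gd t c y ** matrix_inv (g t c y)) *v D c y)) x\<bar>
      \<le> L * (on_M A (cnorm (g t) D) x)\<^sup>2" for x
  proof -
    obtain c where c: "c \<in> A" "x \<in> cdom c" and bound:
      "\<bar>trace (matrix_inv (g t c (cmap c x)) ** gd t c (cmap c x))\<bar> \<le> L"
      "\<bar>laplacian A (g t) (\<phi> t) x\<bar> \<le> L"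
      "\<And>v. \<bar>v \<bullet> (gd t c (cmap c x) *v v)\<bar> \<le> L * (v \<bullet> (g t c (cmap c x) *v v))"
      using L(2)[of x] tt by blast
    have y: "cmap c x \<in> cimg c" by (rule cmap_in_cimg[OF c(2)])
    have "\<bar>(2 * \<rho> * real CARD('n) - 2) * scal A (g t) x\<bar> \<le> L"
      using bound(1) unfolding trace_gd[OF t c(1) y] scal_eq(1)[OF t c] .
    then have "\<bar>scal A (g t) x\<bar> * a \<le> L" by (simp only: abs_mult a_def mult.commute)
    then show "\<bar>scal A (g t) x\<bar> \<le> L / a" using a by (simp add: pos_le_divide_eq)
    show "\<bar>laplacian A (g t) (\<phi> t) x\<bar> \<le> L" by (rule bound(2))
    fix D assume D: "covector_field A D"
    define P G v where "P = matrix_inv (g t c (cmap c x))" and "G = gd t c (cmap c x)" and "v = D c (cmap c x)"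
    interpret positive_form P
      unfolding P_def by (rule riemannian_metric_inv_positive_form[OF metric[OF t] c(1) y])
    have nz: "det (g t c (cmap c x)) \<noteq> 0" using metric_det_pos[OF t c] by simp
    define w where "w = P *v v"
    have "v \<bullet> ((P ** G ** P) *v v) = v \<bullet> (P *v (G *v w))"
      by (simp add: w_def matrix_vector_mul_assoc matrix_mul_assoc)
    also have "\<dots> = (G *v w) \<bullet> (P *v v)" by (rule form_commute)
    finally have 1: "v \<bullet> ((P ** G ** P) *v v) = w \<bullet> (G *v w)" by (simp add: w_def inner_commute)
    have "g t c (cmap c x) *v w = v"
      using nz by (simp add: w_def P_def matrix_vector_mul_assoc matrix_inv_mult)
    then have 2: "w \<bullet> (g t c (cmap c x) *v w) = v \<bullet> (P *v v)" by (simp add: w_def inner_commute)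
    show "\<bar>on_M A (\<lambda>c y. D c y \<bullet> ((matrix_inv (g t c y) ** gd t c y ** matrix_inv (g t c y)) *v D c y)) x\<bar>
      \<le> L * (on_M A (cnorm (g t) D) x)\<^sup>2"
      unfolding on_M_eq[OF chart_invariant_raised_form[OF metric[OF t] tensor2_field_gd[OF t] D D] c]
        on_M_cnorm_eq[OF metric[OF t] D c] P_def[symmetric] G_def[symmetric] v_def[symmetric]
        form_norm_power2 1 2[symmetric]
      unfolding G_def by (rule bound(3))
  qed
  define C where "C = L + L / a"
  have C: "L \<le> C" "L / a \<le> C" "0 \<le> C" using L(1) a by (auto simp: C_def)
  show thesis
  proof (rule that[OF C(3)])
    show "\<bar>scal A (g t) x\<bar> \<le> C" for x using bounds(1) C(2) by (rule order_trans)
    show "\<bar>laplacian A (g t) (\<phi> t) x\<bar> \<le> C" for x using bounds(2) C(1) by (rule order_trans)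
    fix D x assume "covector_field A D"
    from bounds(3)[OF this] mult_right_mono[OF C(1) zero_le_power2]
    show "\<bar>on_M A (\<lambda>c y. D c y \<bullet> ((matrix_inv (g t c y) ** gd t c y ** matrix_inv (g t c y)) *v D c y)) x\<bar>
      \<le> C * (on_M A (cnorm (g t) D) x)\<^sup>2" by (rule order_trans)
  qed
qed

lemma weight_bounded:
  assumes t: "t \<in> {0..<T}"
  obtains W where "\<And>x. weight t t x \<le> W"
proof -
  have "\<exists>L\<ge>0. \<forall>x. \<bar>\<phi> t x\<bar> \<le> L"
  proof (rule chart_bound)
    fix c K assume c: "c \<in> A" and K: "compact K" "K \<subseteq> cimg c"
    have "continuous_on ({0..<T} \<times> cimg c) (\<lambda>z. \<phi> (fst z) (cinv c (snd z)))"
      using smooth_on_imp_continuous_on[OF potential_smooth[OF c]] by (simp add: case_prod_beta)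
    from continuous_on_slice[OF this t] have "continuous_on K (\<lambda>y. \<phi> t (cinv c y))"
      using continuous_on_subset[OF _ K(2)] by simp
    from bounded_on_compact[OF this K(1)] show "\<exists>L. \<forall>y\<in>K. \<bar>\<phi> t (cinv c y)\<bar> \<le> L" by metis
  qed (rule order_trans)
  then obtain L where L: "\<And>x. \<bar>\<phi> t x\<bar> \<le> L" by blast
  have "weight t t x \<le> exp L" for x
    using L[of x] unfolding weight_self[OF t] by simp
  with that show thesis by blast
qed

text \<open>Two versions, because the mass is an integral against the weighted measure, whereas the
  energy carries the factor exp (-phi) in its integrand.\<close>

lemma integral_weighted_volume:
  assumes t: "t \<in> {0..<T}" and s: "s \<in> {0..<T}"
    and \<nu>: "riemannian_volume A (g t) \<nu>" and \<nu>': "riemannian_volume A (g s) \<nu>'"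
    and u: "u \<in> borel_measurable borel"
  shows "(\<integral>x. u x \<partial>weighted \<nu>' (\<phi> s)) = (\<integral>x. weight t s x * u x \<partial>\<nu>)"
    and "(\<integral>x. exp (- \<phi> s x) * u x \<partial>\<nu>') = (\<integral>x. weight t s x * u x \<partial>\<nu>)"
proof -
  let ?r = "on_M A (\<lambda>c y. sqrt (det (g s c y)) / sqrt (det (g t c y)))"
  have sets: "sets \<nu> = sets borel" "sets \<nu>' = sets borel"
    using \<nu> \<nu>' by (simp_all add: riemannian_volume_def)
  note m = measurable_cong_sets[OF sets(1) refl] measurable_cong_sets[OF sets(2) refl]
  note [measurable] = borel_measurable_potential[OF s] u
    borel_measurable_on_M_volume_ratio[OF metric[OF s] metric[OF t]]
  have "0 \<le> ?r x" for x using weight_pos[OF t s, of x] by (simp add: weight_def zero_less_mult_iff)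
  then have eq: "(\<integral>x. exp (- \<phi> s x) * u x \<partial>\<nu>') = (\<integral>x. ?r x * (exp (- \<phi> s x) * u x) \<partial>\<nu>)"
    by (subst riemannian_volume_density[OF metric[OF s] \<nu>' metric[OF t] \<nu>], subst integral_density)
      (simp_all add: m)
  then show "(\<integral>x. exp (- \<phi> s x) * u x \<partial>\<nu>') = (\<integral>x. weight t s x * u x \<partial>\<nu>)"
    by (simp add: weight_def mult_ac)
  moreover have "(\<integral>x. u x \<partial>weighted \<nu>' (\<phi> s)) = (\<integral>x. exp (- \<phi> s x) * u x \<partial>\<nu>')"
    unfolding weighted_def by (subst integral_density) (simp_all add: m)
  ultimately show "(\<integral>x. u x \<partial>weighted \<nu>' (\<phi> s)) = (\<integral>x. weight t s x * u x \<partial>\<nu>)" by simp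
qed

text \<open>Testing with \<open>u\<close> itself gives |du|^{p-2} |du|^2 = |du|^p, also at zeros of
  du by the convention for powers of 0.\<close>

lemma energy_eq:
  assumes t: "t \<in> {0..<T}" and s: "s \<in> {0..<T}"
    and \<nu>: "riemannian_volume A (g t) \<nu>" and \<nu>': "riemannian_volume A (g s) \<nu>'"
    and u: "measurable_covector A (diff A u)"
  shows "energy A (g s) \<nu>' (\<phi> s) p u = (\<integral>x. weight t s x * on_M A (cnorm (g s) (diff A u)) x powr p \<partial>\<nu>)"
proof -
  note [measurable] = borel_measurable_on_M_cnorm[OF metric[OF s] u]
  note cov = measurable_covectorD(1)[OF u]
  have "energy A (g s) \<nu>' (\<phi> s) p u = (\<integral>x. exp (- \<phi> s x) * on_M A (cnorm (g s) (diff A u)) x powr p \<partial>\<nu>')"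
    unfolding energy_def p_laplacian_eq[OF metric[OF s] u u] on_M_inner_self[OF metric[OF s] cov] grad_norm_def
      powr_minus_2_mult_square[OF on_M_cnorm_nonneg[OF metric[OF s] cov]] ..
  also have "\<dots> = (\<integral>x. weight t s x * on_M A (cnorm (g s) (diff A u)) x powr p \<partial>\<nu>)"
    by (rule integral_weighted_volume(2)[OF t s \<nu> \<nu>']) measurable
  finally show ?thesis .
qed

end

text \<open>Times approaching the base time \<open>t\<close>. Staying in \<open>{0..b}\<close> and
  within distance 1 of \<open>t\<close> makes the constant of \<open>weight_growth\<close> available
  along the whole sequence.\<close>

locale flow_sequence = curvature_flow A \<rho> T g \<phi> g\<^sub>0 \<phi>\<^sub>0
  for A :: "('m::t2_space, 'n::finite) chart set" and \<rho> T g \<phi> g\<^sub>0 \<phi>\<^sub>0 +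
  fixes t b p :: real and s :: "nat \<Rightarrow> real" and \<nu> :: "'m measure"
  assumes b: "b < T" and t: "t \<in> {0..b}" and s: "\<And>k. s k \<in> {0..b}" "\<And>k. s k \<noteq> t"
    and close: "\<And>k. \<bar>s k - t\<bar> \<le> 1" and lim: "s \<longlonglongrightarrow> t" and p: "1 \<le> p"
    and sets: "sets \<nu> = sets borel"
begin

lemma time: "t \<in> {0..<T}" "s k \<in> {0..<T}"
  using t s(1)[of k] b by auto

lemma measurable_iff: "borel_measurable \<nu> = borel_measurable borel"
  by (rule measurable_cong_sets[OF sets refl])

lemma step: "(\<lambda>k. s k - t) \<longlonglongrightarrow> 0" "s k - t \<noteq> 0"
  using lim s(2) by (auto simp: LIM_zero_iff)

abbreviation weight' :: "'m \<Rightarrow> real" where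
  "weight' x \<equiv> weight t t x * ((\<rho> * real CARD('n) - 1) * scal A (g t) x - laplacian A (g t) (\<phi> t) x)"

lemma weight_quotient: "(\<lambda>k. (weight t (s k) x - weight t t x) / (s k - t)) \<longlonglongrightarrow> weight' x"
  by (rule has_real_derivative_sequentially[OF weight_has_derivative[OF time(1,1)] time(2) s(2) lim])

lemma borel_measurable_weight': "weight' \<in> borel_measurable borel"
proof -
  note [measurable] = borel_measurable_weight[OF time(1,1)] borel_measurable_scal[OF time(1)]
    borel_measurable_laplacian[OF time(1)]
  show ?thesis by measurable
qed

text \<open>\<open>powr_integral_quotient\<close> with q k the square of f k. Absolute values do not
  involve the metric, so \<open>X\<close> is the moving norm itself and only the density
  differs.\<close>

lemma mass_quotient:
  fixes f :: "nat \<Rightarrow> 'm \<Rightarrow> real"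
  assumes meas: "\<And>k. f k \<in> borel_measurable borel" "f0 \<in> borel_measurable borel" "f1 \<in> borel_measurable borel"
    and int: "integrable \<nu> (\<lambda>x. \<bar>f0 x\<bar> powr p)" "integrable \<nu> (\<lambda>x. \<bar>f1 x\<bar> powr p)" "integrable \<nu> S"
    and S: "AE x in \<nu>. (\<forall>k. \<bar>(f k x - f0 x) / (s k - t) - f1 x\<bar> powr p \<le> S x) \<and>
      (\<lambda>k. \<bar>(f k x - f0 x) / (s k - t) - f1 x\<bar> powr p) \<longlonglongrightarrow> 0"
    and nz: "p = 1 \<Longrightarrow> AE x in \<nu>. f0 x \<noteq> 0"
  shows "(\<lambda>k. ((\<integral>x. weight t (s k) x * \<bar>f k x\<bar> powr p \<partial>\<nu>) - (\<integral>x. weight t t x * \<bar>f0 x\<bar> powr p \<partial>\<nu>)) / (s k - t))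
    \<longlonglongrightarrow> (\<integral>x. weight' x * \<bar>f0 x\<bar> powr p + weight t t x * (p / 2 * \<bar>f0 x\<bar> powr (p - 2) * (2 * (f1 x * f0 x))) \<partial>\<nu>)"
proof -
  note [measurable] = borel_measurable_weight[OF time(1,1)] borel_measurable_weight[OF time(1,2)]
    borel_measurable_weight' meas
  obtain C where C: "\<And>r x. r \<in> {0..b} \<Longrightarrow> \<bar>r - t\<bar> \<le> 1 \<Longrightarrow> \<bar>weight t r x - weight t t x\<bar> \<le> C * \<bar>r - t\<bar> * weight t t x"
    by (rule weight_growth[OF t b order_refl]) blast
  obtain W where W: "\<And>x. weight t t x \<le> W" by (rule weight_bounded[OF time(1)]) blast
  let ?\<tau> = "\<lambda>k. s k - t"
  let ?\<sigma> = "\<lambda>k x. (f k x - f0 x) / (s k - t) - f1 x"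
  have conv: "AE x in \<nu>. (\<lambda>k. (f k x - f0 x) / (s k - t)) \<longlonglongrightarrow> f1 x"
    using S
  proof eventually_elim
    case (elim x)
    have "(\<lambda>k. \<bar>?\<sigma> k x\<bar>) \<longlonglongrightarrow> 0" by (rule tendsto_zero_of_powr[of _ p]) (use elim p in auto)
    then have "(\<lambda>k. ?\<sigma> k x) \<longlonglongrightarrow> 0" by (simp only: tendsto_rabs_zero_iff)
    then show ?case by (simp only: LIM_zero_iff)
  qed
  have "(\<lambda>k. ((\<integral>x. weight t (s k) x * sqrt ((f k x)\<^sup>2) powr p \<partial>\<nu>) - (\<integral>x. weight t t x * sqrt ((f0 x)\<^sup>2) powr p \<partial>\<nu>)) / (s k - t))
    \<longlonglongrightarrow> (\<integral>x. weight' x * sqrt ((f0 x)\<^sup>2) powr p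
        + weight t t x * (p / 2 * sqrt ((f0 x)\<^sup>2) powr (p - 2) * (2 * (f1 x * f0 x))) \<partial>\<nu>)"
  proof (rule powr_integral_quotient[where X = "\<lambda>k x. \<bar>f k x\<bar>" and a = "\<lambda>x. \<bar>f1 x\<bar>"
        and \<sigma> = "\<lambda>k x. \<bar>?\<sigma> k x\<bar>" and S = S and W = W and C = C, OF step close p])
    show "AE x in \<nu>. (\<lambda>k. ((f k x)\<^sup>2 - (f0 x)\<^sup>2) / ?\<tau> k) \<longlonglongrightarrow> 2 * (f1 x * f0 x)"
      using conv
    proof eventually_elim
      case (elim x)
      from quotient_mult[OF step elim elim] show ?case by (simp add: power2_eq_square mult_ac)
    qed
    have "AE x in \<nu>. f0 x = 0 \<longrightarrow> 1 < p" using nz p by (cases "p = 1") auto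
    with conv show "AE x in \<nu>. (f0 x)\<^sup>2 = 0 \<longrightarrow> 1 < p \<and> (\<exists>L. (\<lambda>k. (f k x)\<^sup>2 / (?\<tau> k)\<^sup>2) \<longlonglongrightarrow> L)"
    proof eventually_elim
      case (elim x)
      have "(\<lambda>k. (f k x)\<^sup>2 / (?\<tau> k)\<^sup>2) \<longlonglongrightarrow> (f1 x)\<^sup>2" if "f0 x = 0"
        using tendsto_power[OF elim(1), of 2] that by (simp add: power_divide)
      with elim(2) show ?case by auto
    qed
    show "\<bar>\<bar>f k x\<bar> - sqrt ((f0 x)\<^sup>2)\<bar> \<le> \<bar>?\<tau> k\<bar> * (\<bar>f1 x\<bar> + \<bar>?\<sigma> k x\<bar>)" for k x
    proof -
      have "\<bar>\<bar>f k x\<bar> - sqrt ((f0 x)\<^sup>2)\<bar> \<le> \<bar>f k x - f0 x\<bar>" by simp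
      also have "f k x - f0 x = ?\<tau> k * (f1 x + ?\<sigma> k x)" using s(2)[of k] by simp
      also have "\<bar>?\<tau> k * (f1 x + ?\<sigma> k x)\<bar> \<le> \<bar>?\<tau> k\<bar> * (\<bar>f1 x\<bar> + \<bar>?\<sigma> k x\<bar>)"
        unfolding abs_mult by (intro mult_left_mono abs_triangle_ineq) simp
      finally show ?thesis .
    qed
    show "\<bar>weight t (s k) x * sqrt ((f k x)\<^sup>2) powr p - weight t t x * \<bar>f k x\<bar> powr p\<bar>
        \<le> C * \<bar>?\<tau> k\<bar> * (weight t t x * \<bar>f k x\<bar> powr p)" for k x
    proof -
      have "\<bar>weight t (s k) x * \<bar>f k x\<bar> powr p - weight t t x * \<bar>f k x\<bar> powr p\<bar>
          = \<bar>weight t (s k) x - weight t t x\<bar> * \<bar>f k x\<bar> powr p"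
        by (simp only: left_diff_distrib[symmetric] abs_mult abs_of_nonneg[OF powr_ge_zero])
      also have "\<dots> \<le> C * \<bar>?\<tau> k\<bar> * weight t t x * \<bar>f k x\<bar> powr p"
        by (intro mult_right_mono C s close) simp
      finally show ?thesis by (simp add: mult.assoc)
    qed
    show "AE x in \<nu>. \<forall>k. \<bar>?\<sigma> k x\<bar> powr p \<le> S x" using S by eventually_elim blast
  qed (use W int weight_quotient less_imp_le[OF weight_pos[OF time(1,1)]] in \<open>simp_all add: measurable_iff\<close>)
  then show ?thesis by (simp only: real_sqrt_abs)
qed

text \<open>\<open>powr_integral_quotient\<close> with q k the squared norm of D k in the metric at
  time s k, and \<open>X\<close> the norm of the same covector in the metric at \<open>t\<close>.
  The minus sign in \<open>q'\<close> comes from differentiating the inverse metric.\<close>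

lemma energy_quotient:
  fixes D :: "nat \<Rightarrow> ('m, 'n) covector" and D0 D1 :: "('m, 'n) covector"
  defines "\<sigma> \<equiv> \<lambda>k. on_M A (cnorm (g t) (\<lambda>c y. (D k c y - D0 c y) /\<^sub>R (s k - t) - D1 c y))"
    and "r \<equiv> on_M A (cnorm (g t) D0)"
    and "q' \<equiv> \<lambda>x. 2 * on_M A (\<lambda>c y. D1 c y \<bullet> (matrix_inv (g t c y) *v D0 c y)) x
      - on_M A (\<lambda>c y. D0 c y \<bullet> ((matrix_inv (g t c y) ** gd t c y ** matrix_inv (g t c y)) *v D0 c y)) x"
  assumes D: "\<And>k. measurable_covector A (D k)" "measurable_covector A D0" "measurable_covector A D1"
    and int: "integrable \<nu> (\<lambda>x. r x powr p)" "integrable \<nu> (\<lambda>x. on_M A (cnorm (g t) D1) x powr p)" "integrable \<nu> S"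
    and S: "AE x in \<nu>. (\<forall>k. \<sigma> k x powr p \<le> S x) \<and> (\<lambda>k. \<sigma> k x powr p) \<longlonglongrightarrow> 0"
    and nz: "p = 1 \<Longrightarrow> AE x in \<nu>. r x \<noteq> 0"
  shows "(\<lambda>k. ((\<integral>x. weight t (s k) x * on_M A (cnorm (g (s k)) (D k)) x powr p \<partial>\<nu>) - (\<integral>x. weight t t x * r x powr p \<partial>\<nu>)) / (s k - t))
    \<longlonglongrightarrow> (\<integral>x. weight' x * r x powr p + weight t t x * (p / 2 * r x powr (p - 2) * q' x) \<partial>\<nu>)"
proof -
  let ?\<tau> = "\<lambda>k. s k - t"
  define R where "R k c y = (D k c y - D0 c y) /\<^sub>R (s k - t) - D1 c y" for k c y
  \<comment> \<open>Written with explicit coefficients to match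
    \<open>measurable_covector_linear\<close>.\<close>
  have R_eq: "R k = (\<lambda>c y. 1 *\<^sub>R (inverse (s k - t) *\<^sub>R D k c y + (- inverse (s k - t)) *\<^sub>R D0 c y) + (- 1) *\<^sub>R D1 c y)" for k
    by (simp add: R_def fun_eq_iff scaleR_diff_right)
  have R: "measurable_covector A (R k)" for k
    unfolding R_eq by (intro measurable_covector_linear D)
  have \<sigma>: "\<sigma> k = on_M A (cnorm (g t) (R k))" for k by (simp add: \<sigma>_def R_def[abs_def])
  note cov = D(1)[THEN measurable_covectorD(1)] D(2)[THEN measurable_covectorD(1)]
    D(3)[THEN measurable_covectorD(1)] R[THEN measurable_covectorD(1)]
  define N where "N k = on_M A (cnorm (g (s k)) (D k))" for k
  define X where "X k = on_M A (cnorm (g t) (D k))" for k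
  define a where "a = on_M A (cnorm (g t) D1)"
  have nonneg: "0 \<le> N k x" "0 \<le> X k x" "0 \<le> a x" "0 \<le> r x" "0 \<le> \<sigma> k x" for k x
    unfolding N_def X_def a_def r_def \<sigma> by (intro on_M_cnorm_nonneg metric time cov)+
  have [measurable]: "N k \<in> borel_measurable borel" "r \<in> borel_measurable borel" for k
    unfolding N_def r_def by (intro borel_measurable_on_M_cnorm metric time D)+
  note [measurable] = borel_measurable_weight[OF time(1,1)] borel_measurable_weight[OF time(1,2)]
    borel_measurable_weight' borel_measurable_on_M_inner[OF metric[OF time(1)] D(3,2)]
    borel_measurable_on_M_raised_form[OF metric[OF time(1)] tensor2_field_gd[OF time(1)] continuous_on_gd[OF time(1)] D(2,2)]
  have [measurable]: "q' \<in> borel_measurable borel" unfolding q'_def by measurable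
  obtain C where C: "\<And>r x E. r \<in> {0..b} \<Longrightarrow> \<bar>r - t\<bar> \<le> 1 \<Longrightarrow> covector_field A E \<Longrightarrow>
      \<bar>weight t r x * on_M A (cnorm (g r) E) x powr p - weight t t x * on_M A (cnorm (g t) E) x powr p\<bar>
      \<le> C * \<bar>r - t\<bar> * (weight t t x * on_M A (cnorm (g t) E) x powr p)"
    by (rule weight_growth[OF t b order_trans[OF zero_le_one p]]) blast
  obtain W where W: "\<And>x. weight t t x \<le> W" by (rule weight_bounded[OF time(1)]) blast
  \<comment> \<open>Computed in one chart around \<open>x\<close>, fixed for all times, where the
    squared norms are quadratic forms with differentiable coefficients. The second part is the
    quadratic decay at a zero of \<open>D0\<close>.\<close>
  have local: "(\<lambda>k. ((N k x)\<^sup>2 - (r x)\<^sup>2) / ?\<tau> k) \<longlonglongrightarrow> q' x \<and>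
      (r x = 0 \<longrightarrow> (\<exists>L. (\<lambda>k. (N k x)\<^sup>2 / (?\<tau> k)\<^sup>2) \<longlonglongrightarrow> L))"
    if lim_\<sigma>: "(\<lambda>k. \<sigma> k x powr p) \<longlonglongrightarrow> 0" for x
  proof -
    obtain c where c: "c \<in> A" "x \<in> cdom c" by (rule chart_at)
    define y where "y = cmap c x"
    have y: "y \<in> cimg c" unfolding y_def by (rule cmap_in_cimg[OF c(2)])
    define P where "P u = matrix_inv (g u c y)" for u
    define v where "v k = D k c y" for k
    define v0 v1 where "v0 = D0 c y" and "v1 = D1 c y"
    have pf: "positive_form (P u)" if "u \<in> {0..<T}" for u
      unfolding P_def by (rule riemannian_metric_inv_positive_form[OF metric[OF that] c(1) y])
    interpret P: positive_form "P t" by (rule pf[OF time(1)])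
    have N: "(N k x)\<^sup>2 = v k \<bullet> (P (s k) *v v k)" for k
      unfolding N_def on_M_cnorm_eq[OF metric[OF time(2)] cov(1) c] y_def[symmetric] P_def[symmetric] v_def[symmetric]
      by (rule positive_form.form_norm_power2[OF pf[OF time(2)]])
    have r: "(r x)\<^sup>2 = v0 \<bullet> (P t *v v0)" and r0: "r x = 0 \<longleftrightarrow> v0 = 0"
      unfolding r_def on_M_cnorm_eq[OF metric[OF time(1)] cov(2) c] y_def[symmetric] P_def[symmetric] v0_def[symmetric]
      by (rule P.form_norm_power2 P.form_norm_eq_0_iff)+
    have q': "q' x = v0 \<bullet> ((- (P t ** gd t c y ** P t)) *v v0) + 2 * (v1 \<bullet> (P t *v v0))"
      unfolding q'_def on_M_eq[OF chart_invariant_inner[OF metric[OF time(1)] cov(3,2)] c]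
        on_M_eq[OF chart_invariant_raised_form[OF metric[OF time(1)] tensor2_field_gd[OF time(1)] cov(2,2)] c]
        form_minus y_def[symmetric] P_def[symmetric] v0_def[symmetric] v1_def[symmetric]
      by simp
    have "(\<lambda>k. \<sigma> k x) \<longlonglongrightarrow> 0"
      by (rule tendsto_zero_of_powr[OF lim_\<sigma>]) (use p nonneg in auto)
    moreover have "\<sigma> k x = form_norm (P t) ((v k - v0) /\<^sub>R ?\<tau> k - v1)" for k
      unfolding \<sigma> on_M_cnorm_eq[OF metric[OF time(1)] cov(4) c] y_def[symmetric] P_def[symmetric]
      by (simp add: R_def v_def v0_def v1_def)
    ultimately have "(\<lambda>k. form_norm (P t) ((v k - v0) /\<^sub>R ?\<tau> k - v1)) \<longlonglongrightarrow> 0" by (simp only:)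
    from P.tendsto_of_form_norm[OF this]
    have v_lim: "(\<lambda>k. (v k $ i - v0 $ i) / ?\<tau> k) \<longlonglongrightarrow> v1 $ i" for i
      by (simp add: divide_inverse mult.commute)
    \<comment> \<open>The entries of the inverse metric are its values on pairs of basis
      covectors.\<close>
    have P_lim: "(\<lambda>k. (P (s k) $ i $ j - P t $ i $ j) / ?\<tau> k) \<longlonglongrightarrow> (- (P t ** gd t c y ** P t)) $ i $ j" for i j
    proof -
      have "det (g u c y) \<noteq> 0" if "u \<in> {0..<T}" for u
        using metric_det_pos[OF that c] by (simp add: y_def)
      from matrix_inv_form_has_derivative[OF
          has_vector_derivative_entry[OF metric_has_derivative[OF time(1) c(1) y]] this time(1),
          of "axis i 1" "axis j 1"]
      have "((\<lambda>u. P u $ i $ j) has_real_derivative - ((P t ** gd t c y ** P t) $ i $ j)) (at t within {0..<T})"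
        by (simp only: axis_form P_def)
      from has_real_derivative_sequentially[OF this time(2) s(2) lim] show ?thesis by simp
    qed
    have "(\<lambda>k. ((N k x)\<^sup>2 - (r x)\<^sup>2) / ?\<tau> k) \<longlonglongrightarrow> q' x"
      unfolding N r q' by (rule quotient_form[OF step P_lim v_lim P.sym])
    moreover have "(\<lambda>k. (N k x)\<^sup>2 / (?\<tau> k)\<^sup>2) \<longlonglongrightarrow> v1 \<bullet> (P t *v v1)" if "v0 = 0"
      unfolding N by (rule quotient_form_zero[OF step P_lim]) (use v_lim that in simp)
    ultimately show ?thesis using r0 by blast
  qed
  have "(\<lambda>k. ((\<integral>x. weight t (s k) x * sqrt ((N k x)\<^sup>2) powr p \<partial>\<nu>) - (\<integral>x. weight t t x * sqrt ((r x)\<^sup>2) powr p \<partial>\<nu>)) / (s k - t))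
    \<longlonglongrightarrow> (\<integral>x. weight' x * sqrt ((r x)\<^sup>2) powr p
        + weight t t x * (p / 2 * sqrt ((r x)\<^sup>2) powr (p - 2) * q' x) \<partial>\<nu>)"
  proof (rule powr_integral_quotient[where X = X and a = a and \<sigma> = \<sigma> and S = S and W = W and C = C, OF step close p])
    show "AE x in \<nu>. (\<lambda>k. ((N k x)\<^sup>2 - (r x)\<^sup>2) / ?\<tau> k) \<longlonglongrightarrow> q' x"
      using S by eventually_elim (use local in blast)
    have "AE x in \<nu>. r x = 0 \<longrightarrow> 1 < p" using nz p by (cases "p = 1") auto
    with S show "AE x in \<nu>. (r x)\<^sup>2 = 0 \<longrightarrow> 1 < p \<and> (\<exists>L. (\<lambda>k. (N k x)\<^sup>2 / (?\<tau> k)\<^sup>2) \<longlonglongrightarrow> L)"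
    proof eventually_elim
      case (elim x)
      with local[of x] show ?case by simp
    qed
    show "\<bar>X k x - sqrt ((r x)\<^sup>2)\<bar> \<le> \<bar>?\<tau> k\<bar> * (a x + \<sigma> k x)" for k x
    proof -
      obtain c where c: "c \<in> A" "x \<in> cdom c" by (rule chart_at)
      define y where "y = cmap c x"
      have y: "y \<in> cimg c" unfolding y_def by (rule cmap_in_cimg[OF c(2)])
      interpret P: positive_form "matrix_inv (g t c y)"
        by (rule riemannian_metric_inv_positive_form[OF metric[OF time(1)] c(1) y])
      have "D k c y - D0 c y = ?\<tau> k *\<^sub>R (D1 c y + R k c y)"
        using step(2)[of k] by (simp add: R_def)
      then have "\<bar>form_norm (matrix_inv (g t c y)) (D k c y) - form_norm (matrix_inv (g t c y)) (D0 c y)\<bar>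
          \<le> \<bar>?\<tau> k\<bar> * form_norm (matrix_inv (g t c y)) (D1 c y + R k c y)"
        using P.form_norm_diff[of "D k c y" "D0 c y"] by (simp only: form_norm_scaleR)
      also have "\<dots> \<le> \<bar>?\<tau> k\<bar> * (form_norm (matrix_inv (g t c y)) (D1 c y) + form_norm (matrix_inv (g t c y)) (R k c y))"
        by (intro mult_left_mono P.form_norm_triangle) simp
      finally have "\<bar>X k x - r x\<bar> \<le> \<bar>?\<tau> k\<bar> * (a x + \<sigma> k x)"
        unfolding X_def r_def a_def \<sigma> on_M_cnorm_eq[OF metric[OF time(1)] cov(1) c]
          on_M_cnorm_eq[OF metric[OF time(1)] cov(2) c] on_M_cnorm_eq[OF metric[OF time(1)] cov(3) c]
          on_M_cnorm_eq[OF metric[OF time(1)] cov(4) c] y_def[symmetric] .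
      then show ?thesis using nonneg(4)[of x] by simp
    qed
    show "\<bar>weight t (s k) x * sqrt ((N k x)\<^sup>2) powr p - weight t t x * X k x powr p\<bar>
        \<le> C * \<bar>?\<tau> k\<bar> * (weight t t x * X k x powr p)" for k x
      using C[OF s(1) close cov(1), of k x k] nonneg(1)[of k x] by (simp add: N_def X_def)
    show "AE x in \<nu>. \<forall>k. \<sigma> k x powr p \<le> S x" using S by eventually_elim blast
    show "integrable \<nu> (\<lambda>x. a x powr p)" using int(2) by (simp add: a_def)
  qed (use W int nonneg weight_quotient less_imp_le[OF weight_pos[OF time(1,1)]] in \<open>simp_all add: measurable_iff\<close>)
  then show ?thesis using nonneg(1,4) by (simp add: N_def)
qed

end

section \<open>The derivative of the energy\<close>

theorem proposition3p3:
  fixes A :: "('m::t2_space, 'n::finite) chart set"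
    and g\<^sub>0 :: "('m, 'n) tensor2" and \<phi>\<^sub>0 :: "'m \<Rightarrow> real"
    and g :: "real \<Rightarrow> ('m, 'n) tensor2" and \<phi> :: "real \<Rightarrow> 'm \<Rightarrow> real"
    and \<nu> \<mu> :: "real \<Rightarrow> 'm measure"
    and lam :: "real \<Rightarrow> real" and f :: "real \<Rightarrow> 'm \<Rightarrow> real"
    and \<rho> p T t\<^sub>0 :: real and n :: nat
  assumes dim: "n = CARD('n)" "2 \<le> n"
    and manifold: "closed_oriented_manifold A"
    and initial: "riemannian_metric A g\<^sub>0" "smooth_function A \<phi>\<^sub>0"
    and rho: "\<rho> < 1 / (2 * (real n - 1))"
    and p: "1 \<le> p"
    and flow: "flow_solution A \<rho> T g\<^sub>0 \<phi>\<^sub>0 g \<phi>"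
    and volume: "\<And>t. t \<in> {0..<T} \<Longrightarrow> riemannian_volume A (g t) (\<nu> t)"
    and weighted_volume: "\<And>t. t \<in> {0..<T} \<Longrightarrow> \<mu> t = weighted (\<nu> t) (\<phi> t)"
    and first: "\<And>t. t \<in> {0..<T} \<Longrightarrow> first_eigenvalue A (g t) (\<nu> t) (\<phi> t) p (lam t)"
    and first_C1: "Ck_on 1 {0..<T} lam"
    and t0: "t\<^sub>0 \<in> {0..<T}"
    and family: "smooth_W1p_curve A (g t\<^sub>0) (\<nu> t\<^sub>0) p {0..<T} f"
    and normalized: "\<And>t. t \<in> {0..<T} \<Longrightarrow> (\<integral>x. \<bar>f t x\<bar> powr p \<partial>\<mu> t) = 1"
    and eigen: "eigenfunction A (g t\<^sub>0) (\<nu> t\<^sub>0) (\<phi> t\<^sub>0) p (lam t\<^sub>0) (f t\<^sub>0)"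
    and energy_smooth: "smooth_on {0..<T} (\<lambda>t. energy A (g t) (\<nu> t) (\<phi> t) p (f t))"
  shows "((\<lambda>t. energy A (g t) (\<nu> t) (\<phi> t) p (f t)) has_real_derivative
      lam t\<^sub>0 * (1 - real n * \<rho>) * (\<integral>x. scal A (g t\<^sub>0) x * \<bar>f t\<^sub>0 x\<bar> powr p \<partial>\<mu> t\<^sub>0)
      - (1 + \<rho> * p - \<rho> * real n) * (\<integral>x. scal A (g t\<^sub>0) x * grad_norm A (g t\<^sub>0) (f t\<^sub>0) x powr p \<partial>\<mu> t\<^sub>0)
      + p * (\<integral>x. grad_norm A (g t\<^sub>0) (f t\<^sub>0) x powr (p - 2) *
               on_M A (\<lambda>c y. \<Sum>i\<in>UNIV. \<Sum>j\<in>UNIV. ricci_up (g t\<^sub>0 c) y $ i $ j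
                         * diff A (f t\<^sub>0) c y $ i * diff A (f t\<^sub>0) c y $ j) x \<partial>\<mu> t\<^sub>0)
      + lam t\<^sub>0 * (\<integral>x. laplacian A (g t\<^sub>0) (\<phi> t\<^sub>0) x * \<bar>f t\<^sub>0 x\<bar> powr p \<partial>\<mu> t\<^sub>0)
      - (\<integral>x. laplacian A (g t\<^sub>0) (\<phi> t\<^sub>0) x * grad_norm A (g t\<^sub>0) (f t\<^sub>0) x powr p \<partial>\<mu> t\<^sub>0))
    (at t\<^sub>0 within {0..<T})"
proof -
  \<comment> \<open>If equality held, multiplying the bound on \<open>\<rho>\<close> by 2 n (n - 1)
    would give 2 (n - 1) < n, which is impossible for n >= 2.\<close>
  have "\<rho> * real CARD('n) \<noteq> 1"
  proof
    assume eq: "\<rho> * real CARD('n) = 1"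
    have n: "2 \<le> real CARD('n)" using dim by simp
    then have "\<rho> * (2 * (real CARD('n) - 1)) < 1" using rho dim(1) by (simp add: pos_less_divide_eq)
    then have "\<rho> * real CARD('n) * (2 * (real CARD('n) - 1)) < 1 * real CARD('n)"
      using n mult_strict_right_mono[of "\<rho> * (2 * (real CARD('n) - 1))" 1 "real CARD('n)"] by (simp add: mult_ac)
    with eq n show False by simp
  qed
  then interpret curvature_flow A \<rho> T g \<phi> g\<^sub>0 \<phi>\<^sub>0
    using manifold flow by unfold_locales
  define M where "M = \<nu> t\<^sub>0"
  \<comment> \<open>Any time strictly between \<open>t\<^sub>0\<close> and \<open>T\<close>: it
    leaves room for the sequence to the right of \<open>t\<^sub>0\<close>, the only side available
    when that time is 0, and keeps \<open>{0..b}\<close> compact inside the domain.\<close>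
  define b where "b = (t\<^sub>0 + T) / 2"
  have t0b: "0 \<le> t\<^sub>0" "t\<^sub>0 < b" "b < T" using t0 by (auto simp: b_def)
  have vol: "riemannian_volume A (g t\<^sub>0) M" unfolding M_def by (rule volume[OF t0])
  then have sets: "sets M = sets borel" by (simp add: riemannian_volume_def)
  have meas_M: "borel_measurable M = borel_measurable borel" by (rule measurable_cong_sets[OF sets refl])
  obtain H where H: "H 0 = f" "\<And>k t. t \<in> {0..<T} \<Longrightarrow> H k t \<in> W1p A (g t\<^sub>0) M p"
    "\<And>k t. t \<in> {0..<T} \<Longrightarrow> W1p_derivative A (g t\<^sub>0) M p {0..<T} (H k) (H (Suc k)) t"
    using family unfolding smooth_W1p_curve_def M_def by blast
  define F1 where "F1 = H (Suc 0) t\<^sub>0"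
  have W1p_f: "f t \<in> W1p A (g t\<^sub>0) M p" if "t \<in> {0..<T}" for t using H(2)[OF that, of 0] H(1) by simp
  have W1p_F1: "F1 \<in> W1p A (g t\<^sub>0) M p" unfolding F1_def by (rule H(2)[OF t0])
  let ?D = "\<lambda>t. diff A (f t)" and ?D1 = "diff A F1"
  note D = measurable_covector_diff[OF W1p_f] and D1 = measurable_covector_diff[OF W1p_F1]
  define \<alpha> where "\<alpha> r = (\<lambda>x. \<bar>(f r x - f t\<^sub>0 x) / (r - t\<^sub>0) - F1 x\<bar> powr p)" for r
  define \<beta> where "\<beta> r = (\<lambda>x. on_M A (cnorm (g t\<^sub>0) (\<lambda>c y. (?D r c y - ?D t\<^sub>0 c y) /\<^sub>R (r - t\<^sub>0) - ?D1 c y)) x powr p)" for r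
  have lim_quot: "((\<lambda>r. integral\<^sup>L M (\<alpha> r) + integral\<^sup>L M (\<beta> r)) \<longlongrightarrow> 0) (at t\<^sub>0 within {0..<T})"
    using H(3)[OF t0, of 0] unfolding W1p_derivative_def H(1) \<alpha>_def \<beta>_def F1_def .
  have nonneg_\<alpha>\<beta>: "0 \<le> \<alpha> r x" "0 \<le> \<beta> r x" for r x by (simp_all add: \<alpha>_def \<beta>_def)
  \<comment> \<open>The tolerance (1/2)^k feeds \<open>summable_domination\<close>; the distance
    bounds give convergence to \<open>t\<^sub>0\<close> and the hypotheses of
    \<open>flow_sequence\<close>.\<close>
  have "\<exists>s. s \<in> {0..b} \<and> s \<noteq> t\<^sub>0 \<and> \<bar>s - t\<^sub>0\<bar> \<le> 1 \<and> \<bar>s - t\<^sub>0\<bar> < inverse (real (Suc k))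
      \<and> integral\<^sup>L M (\<alpha> s) + integral\<^sup>L M (\<beta> s) < (1 / 2) ^ k" for k
  proof -
    define d where "d = min (b - t\<^sub>0) (min 1 (inverse (real (Suc k))))"
    have d: "0 < d" "d \<le> b - t\<^sub>0" "d \<le> 1" "d \<le> inverse (real (Suc k))" using t0b by (auto simp: d_def)
    have "\<forall>\<^sub>F s in at t\<^sub>0 within {0..<T}. s \<in> {0..<T} \<and> s \<noteq> t\<^sub>0 \<and> dist s t\<^sub>0 < d"
      using d(1) by (auto simp: eventually_at)
    moreover have "\<forall>\<^sub>F s in at t\<^sub>0 within {0..<T}. integral\<^sup>L M (\<alpha> s) + integral\<^sup>L M (\<beta> s) < (1 / 2) ^ k"
      by (rule order_tendstoD(2)[OF lim_quot]) simp
    ultimately have "\<forall>\<^sub>F s in at t\<^sub>0 within {0..<T}. (s \<in> {0..<T} \<and> s \<noteq> t\<^sub>0 \<and> dist s t\<^sub>0 < d)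
        \<and> integral\<^sup>L M (\<alpha> s) + integral\<^sup>L M (\<beta> s) < (1 / 2) ^ k" by (rule eventually_conj)
    from eventually_happens'[OF at_within_Ico_neq_bot[OF t0] this] obtain s where
      "s \<in> {0..<T}" "s \<noteq> t\<^sub>0" "dist s t\<^sub>0 < d" "integral\<^sup>L M (\<alpha> s) + integral\<^sup>L M (\<beta> s) < (1 / 2) ^ k" by blast
    with d show ?thesis by (intro exI[of _ s]) (auto simp: dist_real_def)
  qed
  then obtain s where seq: "\<And>k. s k \<in> {0..b}" "\<And>k. s k \<noteq> t\<^sub>0" "\<And>k. \<bar>s k - t\<^sub>0\<bar> \<le> 1"
    "\<And>k. \<bar>s k - t\<^sub>0\<bar> < inverse (real (Suc k))"
    "\<And>k. integral\<^sup>L M (\<alpha> (s k)) + integral\<^sup>L M (\<beta> (s k)) < (1 / 2) ^ k" by metis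
  have "(\<lambda>k. s k - t\<^sub>0) \<longlonglongrightarrow> 0"
    by (rule Lim_null_comparison[OF _ LIMSEQ_inverse_real_of_nat])
      (use seq(4) in \<open>auto intro!: always_eventually less_imp_le\<close>)
  then have lim: "s \<longlonglongrightarrow> t\<^sub>0" by (simp only: LIM_zero_iff)
  interpret flow_sequence A \<rho> T g \<phi> g\<^sub>0 \<phi>\<^sub>0 t\<^sub>0 b p s M
    by unfold_locales (use t0b seq(1-3) lim p sets in auto)
  note Ds = D[OF time(2)] and Dt = D[OF t0]
  note cov = Dt[THEN measurable_covectorD(1)] D1[THEN measurable_covectorD(1)]
  define r where "r = on_M A (cnorm (g t\<^sub>0) (?D t\<^sub>0))"
  define a where "a = on_M A (cnorm (g t\<^sub>0) ?D1)"
  have ra: "0 \<le> r x" "0 \<le> a x" for x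
    unfolding r_def a_def by (intro on_M_cnorm_nonneg metric t0 cov)+
  have grad_r: "grad_norm A (g t\<^sub>0) (f t\<^sub>0) = r" by (simp add: r_def grad_norm_def)
  have W1p_int: "u \<in> borel_measurable borel" "integrable M (\<lambda>x. \<bar>u x\<bar> powr p)"
    "integrable M (\<lambda>x. on_M A (cnorm (g t\<^sub>0) (diff A u)) x powr p)" if "u \<in> W1p A (g t\<^sub>0) M p" for u
    using that by (simp_all add: W1p_def grad_norm_def)
  note f_int = W1p_int[OF W1p_f] and F1_int = W1p_int[OF W1p_F1]
  have p0: "0 \<le> p" using p by simp
  note [measurable] = f_int(1)[OF t0] f_int(1)[OF time(2)] F1_int(1)

  \<comment> \<open>The integral of a non-integrable function is 0 by convention, so the small
    integrals mean something only once integrability is known. It follows from membership in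
    W^{1,p}.\<close>
  have int_\<alpha>: "integrable M (\<alpha> (s k))" for k
  proof -
    have "integrable M (\<lambda>x. \<bar>(f (s k) x - f t\<^sub>0 x) / (s k - t\<^sub>0)\<bar> powr p)"
    proof (rule integrable_powr_linear[OF p0 f_int(2)[OF time(2)] f_int(2)[OF t0]])
      show "\<bar>(f (s k) x - f t\<^sub>0 x) / (s k - t\<^sub>0)\<bar> \<le> \<bar>inverse (s k - t\<^sub>0)\<bar> * \<bar>f (s k) x\<bar> + \<bar>inverse (s k - t\<^sub>0)\<bar> * \<bar>f t\<^sub>0 x\<bar>" for x
        unfolding divide_inverse abs_mult distrib_left[symmetric] mult.commute[of _ "\<bar>inverse _\<bar>"]
        by (intro mult_left_mono abs_triangle_ineq4) simp
    qed (simp_all add: meas_M)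
    then show ?thesis
      unfolding \<alpha>_def
    proof (rule integrable_powr_linear[OF p0 _ F1_int(2), where a = 1 and b = 1])
      show "\<bar>(f (s k) x - f t\<^sub>0 x) / (s k - t\<^sub>0) - F1 x\<bar>
          \<le> \<bar>1\<bar> * \<bar>(f (s k) x - f t\<^sub>0 x) / (s k - t\<^sub>0)\<bar> + \<bar>1\<bar> * \<bar>F1 x\<bar>" for x
        using abs_triangle_ineq4[of "(f (s k) x - f t\<^sub>0 x) / (s k - t\<^sub>0)" "F1 x"] by simp
    qed (simp_all add: meas_M)
  qed
  have int_\<beta>: "integrable M (\<beta> (s k))" for k
  proof -
    have eq: "(\<lambda>c y. (?D (s k) c y - ?D t\<^sub>0 c y) /\<^sub>R (s k - t\<^sub>0) - ?D1 c y)
        = (\<lambda>c y. 1 *\<^sub>R (inverse (s k - t\<^sub>0) *\<^sub>R ?D (s k) c y + (- inverse (s k - t\<^sub>0)) *\<^sub>R ?D t\<^sub>0 c y) + (- 1) *\<^sub>R ?D1 c y)"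
      by (simp add: fun_eq_iff scaleR_diff_right)
    show ?thesis unfolding \<beta>_def eq
      by (intro integrable_cnorm_linear measurable_covector_linear metric t0 Ds Dt D1 p0 sets
          f_int(3)[OF time(2)] f_int(3)[OF t0] F1_int(3))
  qed
  have "integral\<^sup>L M (\<alpha> (s k)) \<le> (1 / 2) ^ k" "integral\<^sup>L M (\<beta> (s k)) \<le> (1 / 2) ^ k" for k
  proof -
    have "0 \<le> integral\<^sup>L M (\<alpha> (s k))" "0 \<le> integral\<^sup>L M (\<beta> (s k))"
      using nonneg_\<alpha>\<beta> by (auto intro: integral_nonneg_AE)
    with seq(5)[of k] show "integral\<^sup>L M (\<alpha> (s k)) \<le> (1 / 2) ^ k" "integral\<^sup>L M (\<beta> (s k)) \<le> (1 / 2) ^ k" by linarith+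
  qed
  note small = this
  obtain S1 where S1: "integrable M S1" "AE x in M. (\<forall>k. \<alpha> (s k) x \<le> S1 x) \<and> (\<lambda>k. \<alpha> (s k) x) \<longlonglongrightarrow> 0"
    by (rule summable_domination[OF int_\<alpha> nonneg_\<alpha>\<beta>(1) small(1)]) blast
  obtain S2 where S2: "integrable M S2" "AE x in M. (\<forall>k. \<beta> (s k) x \<le> S2 x) \<and> (\<lambda>k. \<beta> (s k) x) \<longlonglongrightarrow> 0"
    by (rule summable_domination[OF int_\<beta> nonneg_\<alpha>\<beta>(2) small(2)]) blast
  have nz: "AE x in M. f t\<^sub>0 x \<noteq> 0" "AE x in M. r x \<noteq> 0" if "p = 1"
  proof -
    have "AE x in M. f t\<^sub>0 x \<noteq> 0 \<and> r x \<noteq> 0"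
      using eigen that unfolding eigenfunction_def M_def grad_r by blast
    then show "AE x in M. f t\<^sub>0 x \<noteq> 0" "AE x in M. r x \<noteq> 0" by auto
  qed

  \<comment> \<open>Curvature terms at the base time and integrability of all integrands\<close>
  define w where "w = weight t\<^sub>0 t\<^sub>0"
  define sc where "sc = scal A (g t\<^sub>0)"
  define lap where "lap = laplacian A (g t\<^sub>0) (\<phi> t\<^sub>0)"
  define N where "N = real CARD('n)"
  define ip where "ip = on_M A (\<lambda>c y. ?D1 c y \<bullet> (matrix_inv (g t\<^sub>0 c y) *v ?D t\<^sub>0 c y))"
  define B where "B = on_M A (\<lambda>c y. ?D t\<^sub>0 c y \<bullet> ((matrix_inv (g t\<^sub>0 c y) ** gd t\<^sub>0 c y ** matrix_inv (g t\<^sub>0 c y)) *v ?D t\<^sub>0 c y))"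
  define ric where "ric = on_M A (\<lambda>c y. \<Sum>i\<in>UNIV. \<Sum>j\<in>UNIV. ricci_up (g t\<^sub>0 c) y $ i $ j * ?D t\<^sub>0 c y $ i * ?D t\<^sub>0 c y $ j)"
  define F0 where "F0 = f t\<^sub>0"
  have ric: "ric x = \<rho> * sc x * (r x)\<^sup>2 - B x / 2" for x
  proof -
    obtain c where c: "c \<in> A" "x \<in> cdom c" by (rule chart_at)
    show ?thesis unfolding ric_def sc_def r_def B_def by (rule on_M_ricci_up[OF t0 cov(1) c])
  qed
  note m = borel_measurable_weight[OF t0 t0] borel_measurable_scal[OF t0] borel_measurable_laplacian[OF t0]
    borel_measurable_on_M_inner[OF metric[OF t0] D1 Dt] borel_measurable_on_M_cnorm[OF metric[OF t0] Dt]
    borel_measurable_on_M_raised_form[OF metric[OF t0] tensor2_field_gd[OF t0] continuous_on_gd[OF t0] Dt Dt]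
    f_int(1)[OF t0]
  note [measurable] = m[folded w_def sc_def lap_def ip_def r_def B_def F0_def]
  have [measurable]: "ric \<in> borel_measurable borel"
    unfolding ric[abs_def] by measurable
  obtain C where C: "0 \<le> C" "\<And>x. \<bar>sc x\<bar> \<le> C" "\<And>x. \<bar>lap x\<bar> \<le> C" "\<And>x. \<bar>B x\<bar> \<le> C * (r x)\<^sup>2"
    unfolding sc_def lap_def B_def r_def
    by (rule curvature_bounds[OF t0]) (use cov(1) in blast)
  obtain W where W: "\<And>x. w x \<le> W" unfolding w_def by (rule weight_bounded[OF t0]) blast
  have w0: "0 \<le> w x" for x unfolding w_def by (rule less_imp_le[OF weight_pos[OF t0 t0]])
  have wW: "\<bar>w x\<bar> \<le> W" for x using W w0 by simp
  note int_F0 = f_int(2)[OF t0, folded F0_def] and int_r = f_int(3)[OF t0, folded r_def]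
  note int_a = F1_int(3)[folded a_def]
  have int_w: "integrable M (\<lambda>x. w x * h x)" if "integrable M h" for h
    by (rule integrable_bounded_mult[OF that _ wW]) (simp add: meas_M)
  have int_sc: "integrable M (\<lambda>x. w x * (sc x * h x))" and int_lap: "integrable M (\<lambda>x. w x * (lap x * h x))"
    if "integrable M h" for h
    by (intro int_w integrable_bounded_mult[OF that _ C(2)] integrable_bounded_mult[OF that _ C(3)], simp add: meas_M)+
  have int_f1: "integrable M (\<lambda>x. w x * (\<bar>F0 x\<bar> powr (p - 2) * F0 x * F1 x))"
  proof (intro int_w integrable_le[OF Bochner_Integration.integrable_add[OF int_F0 F1_int(2)]])
    show "\<bar>\<bar>F0 x\<bar> powr (p - 2) * F0 x * F1 x\<bar> \<le> \<bar>F0 x\<bar> powr p + \<bar>F1 x\<bar> powr p" for x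
      using powr_minus_2_mult_le[OF abs_ge_zero abs_ge_zero p, of "F0 x" "F1 x"]
      by (simp add: abs_mult mult.assoc)
  qed (simp add: meas_M)
  have int_ip: "integrable M (\<lambda>x. w x * (r x powr (p - 2) * ip x))"
  proof (intro int_w integrable_le[OF Bochner_Integration.integrable_add[OF int_r int_a]])
    fix x
    have "\<bar>ip x\<bar> \<le> r x * a x"
      using on_M_inner_le[OF metric[OF t0] cov(2,1), of x] by (simp add: ip_def r_def a_def mult.commute)
    then have "r x powr (p - 2) * \<bar>ip x\<bar> \<le> r x powr (p - 2) * (r x * a x)" by (intro mult_left_mono) simp_all
    also have "\<dots> \<le> r x powr p + a x powr p" by (rule powr_minus_2_mult_le[OF ra p])
    finally show "\<bar>r x powr (p - 2) * ip x\<bar> \<le> r x powr p + a x powr p" by (simp add: abs_mult)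
  qed (simp add: meas_M)
  have int_ric: "integrable M (\<lambda>x. w x * (r x powr (p - 2) * ric x))"
  proof (intro int_w integrable_le[OF integrable_mult_right[OF int_r, of "\<bar>\<rho>\<bar> * C + C / 2"]])
    fix x
    have "\<bar>\<rho> * sc x * (r x)\<^sup>2\<bar> \<le> \<bar>\<rho>\<bar> * C * (r x)\<^sup>2"
      unfolding abs_mult using C(1,2) by (intro mult_mono mult_nonneg_nonneg) auto
    with C(4)[of x] have "\<bar>ric x\<bar> \<le> (\<bar>\<rho>\<bar> * C + C / 2) * (r x)\<^sup>2"
      unfolding ric distrib_right by linarith
    then have "r x powr (p - 2) * \<bar>ric x\<bar> \<le> r x powr (p - 2) * ((\<bar>\<rho>\<bar> * C + C / 2) * (r x)\<^sup>2)"
      by (intro mult_left_mono) simp_all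
    also have "\<dots> = (\<bar>\<rho>\<bar> * C + C / 2) * (r x powr (p - 2) * (r x)\<^sup>2)" by (simp only: mult_ac)
    finally show "\<bar>r x powr (p - 2) * ric x\<bar> \<le> (\<bar>\<rho>\<bar> * C + C / 2) * r x powr p"
      unfolding powr_minus_2_mult_square[OF ra(1)] by (simp add: abs_mult)
  qed (simp add: meas_M)

  \<comment> \<open>The identity from the normalization\<close>
  have mass: "(\<integral>x. weight t\<^sub>0 t x * \<bar>f t x\<bar> powr p \<partial>M) = 1" if t: "t \<in> {0..<T}" for t
  proof -
    note [measurable] = f_int(1)[OF t]
    have "(\<integral>x. \<bar>f t x\<bar> powr p \<partial>weighted (\<nu> t) (\<phi> t)) = (\<integral>x. weight t\<^sub>0 t x * \<bar>f t x\<bar> powr p \<partial>M)"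
      by (rule integral_weighted_volume(1)[OF t0 t vol volume[OF t]]) measurable
    with normalized[OF t] weighted_volume[OF t] show ?thesis by simp
  qed
  have "(\<lambda>k. ((\<integral>x. weight t\<^sub>0 (s k) x * \<bar>f (s k) x\<bar> powr p \<partial>M) - (\<integral>x. weight t\<^sub>0 t\<^sub>0 x * \<bar>f t\<^sub>0 x\<bar> powr p \<partial>M)) / (s k - t\<^sub>0))
    \<longlonglongrightarrow> (\<integral>x. weight' x * \<bar>f t\<^sub>0 x\<bar> powr p + weight t\<^sub>0 t\<^sub>0 x * (p / 2 * \<bar>f t\<^sub>0 x\<bar> powr (p - 2) * (2 * (F1 x * f t\<^sub>0 x))) \<partial>M)"
    by (rule mass_quotient[OF f_int(1)[OF time(2)] f_int(1)[OF t0] F1_int(1) f_int(2)[OF t0] F1_int(2) S1(1)])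
      (use S1(2) nz(1) in \<open>simp_all add: \<alpha>_def\<close>)
  \<comment> \<open>Every numerator is 1 - 1, so the limiting integral must vanish.\<close>
  then have "(\<lambda>k. 0) \<longlonglongrightarrow> (\<integral>x. weight' x * \<bar>f t\<^sub>0 x\<bar> powr p + weight t\<^sub>0 t\<^sub>0 x * (p / 2 * \<bar>f t\<^sub>0 x\<bar> powr (p - 2) * (2 * (F1 x * f t\<^sub>0 x))) \<partial>M)"
    unfolding mass[OF t0] mass[OF time(2)] by simp
  then have "(\<integral>x. weight' x * \<bar>f t\<^sub>0 x\<bar> powr p + weight t\<^sub>0 t\<^sub>0 x * (p / 2 * \<bar>f t\<^sub>0 x\<bar> powr (p - 2) * (2 * (F1 x * f t\<^sub>0 x))) \<partial>M) = 0"
    by (rule LIMSEQ_unique[OF _ tendsto_const])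
  also have "(\<lambda>x. weight' x * \<bar>f t\<^sub>0 x\<bar> powr p + weight t\<^sub>0 t\<^sub>0 x * (p / 2 * \<bar>f t\<^sub>0 x\<bar> powr (p - 2) * (2 * (F1 x * f t\<^sub>0 x))))
      = (\<lambda>x. (\<rho> * N - 1) * (w x * (sc x * \<bar>F0 x\<bar> powr p)) - w x * (lap x * \<bar>F0 x\<bar> powr p)
          + p * (w x * (\<bar>F0 x\<bar> powr (p - 2) * F0 x * F1 x)))"
    unfolding w_def[symmetric] sc_def[symmetric] lap_def[symmetric] N_def[symmetric] F0_def[symmetric]
    by (simp add: fun_eq_iff algebra_simps)
  finally have mass_identity: "(\<rho> * N - 1) * (\<integral>x. w x * (sc x * \<bar>F0 x\<bar> powr p) \<partial>M) - (\<integral>x. w x * (lap x * \<bar>F0 x\<bar> powr p) \<partial>M)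
      + p * (\<integral>x. w x * (\<bar>F0 x\<bar> powr (p - 2) * F0 x * F1 x) \<partial>M) = 0"
    using int_sc[OF int_F0] int_lap[OF int_F0] int_f1 by simp

  \<comment> \<open>The identity from the energy\<close>
  let ?E = "\<lambda>t. energy A (g t) (\<nu> t) (\<phi> t) p (f t)"
  have energy: "?E t = (\<integral>x. weight t\<^sub>0 t x * on_M A (cnorm (g t) (?D t)) x powr p \<partial>M)" if t: "t \<in> {0..<T}" for t
    by (rule energy_eq[OF t0 t vol volume[OF t] D[OF t]])
  have "?E differentiable (at t\<^sub>0 within {0..<T})"
    using smooth_on_imp_differentiable_on[OF energy_smooth] t0 by (simp add: differentiable_on_def)
  then obtain E' where E': "(?E has_real_derivative E') (at t\<^sub>0 within {0..<T})"
    by (auto simp: real_differentiable_def)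
  have "(\<lambda>k. (?E (s k) - ?E t\<^sub>0) / (s k - t\<^sub>0)) \<longlonglongrightarrow> E'"
    by (rule has_real_derivative_sequentially[OF E' time(2) s(2) lim])
  then have "(\<lambda>k. ((\<integral>x. weight t\<^sub>0 (s k) x * on_M A (cnorm (g (s k)) (?D (s k))) x powr p \<partial>M)
      - (\<integral>x. weight t\<^sub>0 t\<^sub>0 x * r x powr p \<partial>M)) / (s k - t\<^sub>0)) \<longlonglongrightarrow> E'"
    unfolding energy[OF t0] energy[OF time(2)] r_def .
  moreover have "(\<lambda>k. ((\<integral>x. weight t\<^sub>0 (s k) x * on_M A (cnorm (g (s k)) (?D (s k))) x powr p \<partial>M)
      - (\<integral>x. weight t\<^sub>0 t\<^sub>0 x * r x powr p \<partial>M)) / (s k - t\<^sub>0))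
    \<longlonglongrightarrow> (\<integral>x. weight' x * r x powr p + weight t\<^sub>0 t\<^sub>0 x * (p / 2 * r x powr (p - 2) * (2 * ip x - B x)) \<partial>M)"
    unfolding r_def ip_def B_def
    by (rule energy_quotient[OF Ds Dt D1 f_int(3)[OF t0] F1_int(3) S2(1)])
      (use S2(2) nz(2) in \<open>simp_all add: \<beta>_def r_def\<close>)
  ultimately have "E' = (\<integral>x. weight' x * r x powr p + weight t\<^sub>0 t\<^sub>0 x * (p / 2 * r x powr (p - 2) * (2 * ip x - B x)) \<partial>M)"
    by (rule LIMSEQ_unique)
  also have "(\<lambda>x. weight' x * r x powr p + weight t\<^sub>0 t\<^sub>0 x * (p / 2 * r x powr (p - 2) * (2 * ip x - B x)))
      = (\<lambda>x. (\<rho> * N - 1 - \<rho> * p) * (w x * (sc x * r x powr p)) - w x * (lap x * r x powr p)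
          + p * (w x * (r x powr (p - 2) * ip x)) + p * (w x * (r x powr (p - 2) * ric x)))"
  proof
    fix x
    \<comment> \<open>Trading the derivative of the metric for curvature: the scalar part is the
      source of the term \<open>\<rho> * p\<close> in the coefficient of R |df|^p, the other part
      gives the Ricci integral.\<close>
    have B: "B x = 2 * \<rho> * sc x * (r x)\<^sup>2 - 2 * ric x" unfolding ric by simp
    have eq: "p / 2 * r x powr (p - 2) * (2 * ip x - B x)
        = p * (r x powr (p - 2) * ip x) - \<rho> * p * (sc x * (r x powr (p - 2) * (r x)\<^sup>2)) + p * (r x powr (p - 2) * ric x)"
      unfolding B by (simp add: algebra_simps)
    show "weight' x * r x powr p + weight t\<^sub>0 t\<^sub>0 x * (p / 2 * r x powr (p - 2) * (2 * ip x - B x))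
      = (\<rho> * N - 1 - \<rho> * p) * (w x * (sc x * r x powr p)) - w x * (lap x * r x powr p)
          + p * (w x * (r x powr (p - 2) * ip x)) + p * (w x * (r x powr (p - 2) * ric x))"
      unfolding eq powr_minus_2_mult_square[OF ra(1)] w_def[symmetric] sc_def[symmetric] lap_def[symmetric] N_def[symmetric]
      by (simp add: algebra_simps)
  qed
  finally have energy_identity: "E' = (\<rho> * N - 1 - \<rho> * p) * (\<integral>x. w x * (sc x * r x powr p) \<partial>M)
      - (\<integral>x. w x * (lap x * r x powr p) \<partial>M)
      + p * (\<integral>x. w x * (r x powr (p - 2) * ip x) \<partial>M) + p * (\<integral>x. w x * (r x powr (p - 2) * ric x) \<partial>M)"
    using int_sc[OF int_r] int_lap[OF int_r] int_ip int_ric by simp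

  \<comment> \<open>The eigenvalue equation and the elimination of the velocity of f\<close>
  have weighted: "(\<integral>x. u x \<partial>weighted M (\<phi> t\<^sub>0)) = (\<integral>x. w x * u x \<partial>M)" if "u \<in> borel_measurable borel" for u
    unfolding w_def by (rule integral_weighted_volume(1)[OF t0 t0 vol vol that])
  have "- p_laplacian A (g t\<^sub>0) M (\<phi> t\<^sub>0) p (f t\<^sub>0) F1
      = lam t\<^sub>0 * (\<integral>x. \<bar>f t\<^sub>0 x\<bar> powr (p - 2) * f t\<^sub>0 x * F1 x \<partial>weighted M (\<phi> t\<^sub>0))"
    using eigen W1p_F1 unfolding eigenfunction_def M_def by blast
  moreover have "- p_laplacian A (g t\<^sub>0) M (\<phi> t\<^sub>0) p (f t\<^sub>0) F1 = (\<integral>x. w x * (r x powr (p - 2) * ip x) \<partial>M)"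
    unfolding p_laplacian_eq[OF metric[OF t0] Dt D1] grad_r ip_def w_def weight_self[OF t0] ..
  moreover have "(\<integral>x. \<bar>f t\<^sub>0 x\<bar> powr (p - 2) * f t\<^sub>0 x * F1 x \<partial>weighted M (\<phi> t\<^sub>0))
      = (\<integral>x. w x * (\<bar>F0 x\<bar> powr (p - 2) * F0 x * F1 x) \<partial>M)"
    unfolding F0_def[symmetric] by (rule weighted) measurable
  ultimately have eigen_identity: "(\<integral>x. w x * (r x powr (p - 2) * ip x) \<partial>M)
      = lam t\<^sub>0 * (\<integral>x. w x * (\<bar>F0 x\<bar> powr (p - 2) * F0 x * F1 x) \<partial>M)" by simp

  have \<mu>: "\<mu> t\<^sub>0 = weighted M (\<phi> t\<^sub>0)" unfolding M_def by (rule weighted_volume[OF t0])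
  have integrals: "(\<integral>x. sc x * \<bar>F0 x\<bar> powr p \<partial>\<mu> t\<^sub>0) = (\<integral>x. w x * (sc x * \<bar>F0 x\<bar> powr p) \<partial>M)"
    "(\<integral>x. lap x * \<bar>F0 x\<bar> powr p \<partial>\<mu> t\<^sub>0) = (\<integral>x. w x * (lap x * \<bar>F0 x\<bar> powr p) \<partial>M)"
    "(\<integral>x. sc x * r x powr p \<partial>\<mu> t\<^sub>0) = (\<integral>x. w x * (sc x * r x powr p) \<partial>M)"
    "(\<integral>x. lap x * r x powr p \<partial>\<mu> t\<^sub>0) = (\<integral>x. w x * (lap x * r x powr p) \<partial>M)"
    "(\<integral>x. r x powr (p - 2) * ric x \<partial>\<mu> t\<^sub>0) = (\<integral>x. w x * (r x powr (p - 2) * ric x) \<partial>M)"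
    unfolding \<mu> by (rule weighted, measurable)+
  define I1 I2 I3 where "I1 = (\<integral>x. w x * (sc x * \<bar>F0 x\<bar> powr p) \<partial>M)"
    and "I2 = (\<integral>x. w x * (lap x * \<bar>F0 x\<bar> powr p) \<partial>M)"
    and "I3 = (\<integral>x. w x * (\<bar>F0 x\<bar> powr (p - 2) * F0 x * F1 x) \<partial>M)"
  \<comment> \<open>The normalization expresses the unknown cross integral by curvature and
    Laplacian integrals. Multiplied by the eigenvalue, it replaces the cross term of the energy and
    yields the two terms with \<open>lam t\<^sub>0\<close>.\<close>
  have "p * I3 = (1 - N * \<rho>) * I1 + I2"
    using mass_identity unfolding I1_def[symmetric] I2_def[symmetric] I3_def[symmetric] by (simp add: algebra_simps)
  then have "p * (lam t\<^sub>0 * I3) = lam t\<^sub>0 * (1 - N * \<rho>) * I1 + lam t\<^sub>0 * I2"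
    by (simp add: mult.left_commute[of p] distrib_left mult.assoc)
  with energy_identity eigen_identity
  have "E' = lam t\<^sub>0 * (1 - N * \<rho>) * I1 - (1 + \<rho> * p - \<rho> * N) * (\<integral>x. w x * (sc x * r x powr p) \<partial>M)
      + p * (\<integral>x. w x * (r x powr (p - 2) * ric x) \<partial>M) + lam t\<^sub>0 * I2 - (\<integral>x. w x * (lap x * r x powr p) \<partial>M)"
    unfolding I3_def[symmetric] by (simp add: algebra_simps)
  with E' show ?thesis
    unfolding grad_r dim(1) N_def[symmetric] sc_def[symmetric] lap_def[symmetric] ric_def[symmetric]
    unfolding F0_def[symmetric] integrals I1_def[symmetric] I2_def[symmetric] by simp
qed

end
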